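(* For the dimension function $$g(\varepsilon)=\frac{\log|\log\varepsilon|}{|\log\varepsilon|^3\,(\log\log|\log\varepsilon|)},$$ we have $\mathcal{H}^{g}(K_3)<\infty$. For a large enough constant $\hat{C}>0$, the dimension function $$g(\varepsilon)=\frac{\exp\big(\hat{C}\sqrt{\log|\log\varepsilon|}\big)}{|\log\varepsilon|^3}$$ satisfies $\mathcal{H}^g(K_3)=\infty$.
   Context: A dimension function is a nondecreasing, right continuous function $h:(0,\infty)\to(0,\infty)$ with $h(r)\to 0$ as $r\to 0$; we set $h(0)=0$. The associated Hausdorff measure on subsets $E\subset\mathbb{R}$ is $$\mathcal{H}^h(E)=\lim_{\delta\to 0}\inf\Big\{\sum_i h(\operatorname{diam}(U_i)) : E\subset\bigcup_i U_i,\ \operatorname{diam}(U_i)<\delta\Big\},$$ the infimum being over countable covers. Only the values of $h$ near $0$ matter for $\mathcal{H}^h$; a dimension function given by a formula is understood to be given by that formula for all sufficiently small $\varepsilon>0$ (and extended arbitrarily to a dimension function for larger $\varepsilon$). The set $K_3$ is the set of all real numbers with infinite continued fraction expansion $[0;a_1,a_2,\dots,a_n,\dots]$ ($a_i$ positive integers) for which there exists a sequence of positive integers $(a_{-n})_{n\ge 0}$ such that the bi-infinite sequence $(a_n)_{n\in\mathbb{Z}}$ satisfies $$[a_k;a_{k+1},a_{k+2},\dots]+[0;a_{k-1},a_{k-2},\dots]\le 3\quad\text{for all }k\in\mathbb{Z}.$$ Here $[c_0;c_1,c_2,\dots]=c_0+\frac{1}{c_1+\frac{1}{c_2+\cdots}}$.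 *)

theory Defs
  imports "HOL-Analysis.Analysis"
begin

text \<open>
  A dimension function lives on \<open>[0, \<infinity>)\<close>; its values at negative arguments are irrelevant.
\<close>

definition dimension_function :: "(real \<Rightarrow> real) \<Rightarrow> bool" where
  "dimension_function h \<longleftrightarrow>
     h 0 = 0 \<and> (\<forall>r>0. h r > 0) \<and> mono_on {0<..} h \<and>
     (\<forall>r>0. continuous (at_right r) h) \<and> (h \<longlongrightarrow> 0) (at_right 0)"

text \<open>
  A formula only determines a dimension function near \<open>0\<close>; away from \<open>0\<close> the extension is
  arbitrary.
\<close>

definition dimension_function_given_by :: "(real \<Rightarrow> real) \<Rightarrow> (real \<Rightarrow> real) \<Rightarrow> bool" where
  "dimension_function_given_by g f \<longleftrightarrow>
     dimension_function g \<and> (\<forall>\<^sub>F \<epsilon> in at_right 0. g \<epsilon> = f \<epsilon>)"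

text \<open>
  Boundedness is required because \<^const>\<open>diameter\<close> is real-valued and meaningless on unbounded
  sets.  Finite covers are included, since the \<open>U i\<close> may be empty and
  \<open>h (diameter {}) = h 0 = 0\<close>.
\<close>

definition hausdorff_premeasure :: "(real \<Rightarrow> real) \<Rightarrow> real \<Rightarrow> real set \<Rightarrow> ennreal" where
  "hausdorff_premeasure h \<delta> E =
     Inf {(\<Sum>i. ennreal (h (diameter (U i)))) | U :: nat \<Rightarrow> real set.
            E \<subseteq> (\<Union>i. U i) \<and> (\<forall>i. bounded (U i) \<and> diameter (U i) < \<delta>)}"

definition hausdorff_measure :: "(real \<Rightarrow> real) \<Rightarrow> real set \<Rightarrow> ennreal" where
  "hausdorff_measure h E = Lim (at_right 0) (\<lambda>\<delta>. hausdorff_premeasure h \<delta> E)"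

lemma hausdorff_premeasure_antimono:
  "\<delta> \<le> \<delta>' \<Longrightarrow> hausdorff_premeasure h \<delta>' E \<le> hausdorff_premeasure h \<delta> E"
  unfolding hausdorff_premeasure_def
  by (intro Inf_superset_mono Collect_mono impI, elim exE conjE, intro exI conjI)
    (assumption | blast intro: less_le_trans)+

text \<open>The limit always exists, so \<^const>\<open>Lim\<close> never returns an unspecified value.\<close>

lemma hausdorff_premeasure_tendsto:
  "((\<lambda>\<delta>. hausdorff_premeasure h \<delta> E) \<longlongrightarrow> hausdorff_measure h E) (at_right 0)"
proof -
  let ?f = "\<lambda>\<delta>. hausdorff_premeasure h \<delta> E"
  have "(?f \<longlongrightarrow> (SUP \<delta>\<in>{0<..}. ?f \<delta>)) (at_right 0)"
  proof (rule order_tendstoI)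
    fix a assume "a < (SUP \<delta>\<in>{0<..}. ?f \<delta>)"
    then obtain \<delta> where "\<delta> > 0" "a < ?f \<delta>" by (auto simp: less_SUP_iff)
    show "\<forall>\<^sub>F x in at_right 0. a < ?f x"
      unfolding eventually_at_right_field
    proof (intro exI[of _ \<delta>] conjI allI impI)
      fix x assume "x < \<delta>"
      then have "?f \<delta> \<le> ?f x" by (intro hausdorff_premeasure_antimono) simp
      with \<open>a < ?f \<delta>\<close> show "a < ?f x" by (rule less_le_trans)
    qed fact
  next
    fix a assume a: "(SUP \<delta>\<in>{0<..}. ?f \<delta>) < a"
    show "\<forall>\<^sub>F x in at_right 0. ?f x < a"
      using eventually_at_right_less
    proof eventually_elim
      case (elim x)
      then have "?f x \<le> (SUP \<delta>\<in>{0<..}. ?f \<delta>)" by (intro SUP_upper) simp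
      with a show ?case by simp
    qed
  qed
  then show ?thesis
    unfolding hausdorff_measure_def by (simp add: tendsto_Lim)
qed

text \<open>
  \<open>convergent_cf n c\<close> is the finite continued fraction \<open>[c 0; c 1, \<dots>, c n]\<close>.  The limit in
  \<open>cfrac\<close> exists whenever \<open>c i > 0\<close> for all \<open>i \<ge> 1\<close>.
\<close>

primrec convergent_cf :: "nat \<Rightarrow> (nat \<Rightarrow> nat) \<Rightarrow> real" where
  "convergent_cf 0 c = real (c 0)"
| "convergent_cf (Suc n) c = real (c 0) + 1 / convergent_cf n (\<lambda>i. c (Suc i))"

definition cfrac :: "(nat \<Rightarrow> nat) \<Rightarrow> real" where
  "cfrac c = lim (\<lambda>n. convergent_cf n c)"

text \<open>
  The two sequences fed to \<^const>\<open>cfrac\<close> in the inequality encode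
  \<open>[a k; a (k+1), a (k+2), \<dots>]\<close> and \<open>[0; a (k-1), a (k-2), \<dots>]\<close>.
\<close>

definition K3 :: "real set" where
  "K3 = {x. \<exists>a :: int \<Rightarrow> nat. (\<forall>n. a n > 0) \<and>
              x = cfrac (case_nat 0 (\<lambda>i. a (1 + int i))) \<and>
              (\<forall>k. cfrac (\<lambda>i. a (k + int i)) + cfrac (case_nat 0 (\<lambda>i. a (k - 1 - int i))) \<le> 3)}"

end

theory Submission
  imports Defs "HOL-Real_Asymp.Real_Asymp"
begin

text \<open>
  A bi-infinite sequence whose Markov values are at most \<open>3\<close> consists of the blocks \<open>a = 22\<close> and
  \<open>b = 11\<close> (the letters \<open>0\<close> and \<open>1\<close> below), and as a word in \<open>a\<close>, \<open>b\<close> it is balanced; conversely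
  every balanced word gives such a sequence.  A point of \<open>K3\<close> is thus described by a slope \<open>\<alpha>\<close> and an
  offset \<open>\<rho>\<close>, and an interval of length \<open>\<epsilon>\<close> fixes about \<open>n = |log \<epsilon>|\<close> letters.

  Upper bound: only \<open>O(n)\<close> balanced words of length \<open>n\<close> have a slope within \<open>1 / (q n)\<close> of \<open>p / q\<close>.  For
  \<open>n = q T\<close> this beats the average count by the factor \<open>T\<close>, and with \<open>T\<close> about \<open>log N / log log N\<close>
  all slopes have such an approximation with \<open>N \<le> q \<le> N\<^sup>2\<close>, except for those whose partial quotients stay
  below a multiple of \<open>T\<close> throughout that range; they are so few that the words of length \<open>N\<^sup>2\<close> suffice
  for them.

  Lower bound: for slopes with \<open>|\<alpha> - p / q| \<ge> c / (q log q)\<^sup>2\<close>, a set of positive measure, the pairs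
  \<open>(\<alpha>, \<rho>)\<close> sharing a word of length \<open>n\<close> lie in a rectangle of area \<open>n\<close> to the power \<open>-3\<close>, up to powers
  of \<open>log n\<close>.  Hence planar Lebesgue measure bounds the cost of every cover from below.
\<close>

section \<open>Continued fractions with digits 1 and 2\<close>

text \<open>There are of the order of n^3 balanced words of length n, so a cover by all of them
  costs about n^3 g(e^(-n)) = log n / log log n for the first gauge: this is the factor to be
  gained. With lengths n = q T, the words around p/q cost about n g(e^(-n)), which is of order
  1/(q^2 T), just the length of the set of slopes they serve. Taking all fractions with q between N
  and N^2 would still sum to log N / T, so a disjoint family has to be selected first.

  For the remaining slopes, the denominators of the convergents in the critical range form a
  Euclidean chain with quotients at most A = 10 T. Leaving out the larger quotients saves a factor
  N^(-s) with s of order 1/T, and the demand s log N >= 2 log log N is what limits T.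

  In the lower bound the only losses are powers of log n, which come from the gaps between the
  multiples of a typical slope; exp(C sqrt(log n)) outgrows them.\<close>

lemma convergent_cf_ge:
  assumes "\<And>i. c i \<ge> 1"
  shows "convergent_cf n c \<ge> real (c 0)"
  using assms
proof (induction n arbitrary: c)
  case (Suc n)
  have "convergent_cf n (\<lambda>i. c (Suc i)) \<ge> real (c (Suc 0))"
    using Suc.IH[of "\<lambda>i. c (Suc i)"] Suc.prems by simp
  then have "convergent_cf n (\<lambda>i. c (Suc i)) \<ge> 0" by linarith
  then show ?case by simp
qed simp

lemma convergent_cf_ge_1:
  assumes "\<And>i. c i \<ge> 1"
  shows "convergent_cf n c \<ge> 1"
  using convergent_cf_ge[of c n, OF assms] assms[of 0] by linarith

lemma convergent_cf_le:
  assumes "\<And>i. c i \<ge> 1"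
  shows "convergent_cf n c \<le> real (c 0) + 1"
  using convergent_cf_ge_1[of "\<lambda>i. c (Suc i)" "n - 1"] assms by (cases n) auto

text \<open>A single step X -> b + 1/X has derivative of size 1 at X = 1 and is no uniform
  contraction. Two steps gain a factor 4 because b X and b Y are at least 1.\<close>

lemma cf_two_step:
  fixes X Y b :: real
  assumes "X \<ge> 1" "Y \<ge> 1" "b \<ge> 1"
  shows "\<bar>1 / (b + 1 / X) - 1 / (b + 1 / Y)\<bar> \<le> \<bar>X - Y\<bar> / 4"
proof -
  have bX: "b * X \<ge> 1" and bY: "b * Y \<ge> 1"
    using mult_mono[of 1 b 1 X] mult_mono[of 1 b 1 Y] assms by auto
  have "1 / (b + 1 / X) - 1 / (b + 1 / Y) = (X - Y) / ((b * X + 1) * (b * Y + 1))"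
    using assms bX bY by (simp add: divide_simps) (simp add: algebra_simps)
  moreover have "(b * X + 1) * (b * Y + 1) \<ge> 2 * 2"
    using bX bY by (intro mult_mono) auto
  ultimately show ?thesis
    using bX bY by (simp only: abs_divide abs_mult) (intro divide_left_mono; simp add: mult_pos_pos)
qed

lemma convergent_cf_close:
  assumes "\<And>i. c i \<ge> 1" "n \<le> m" "n \<le> m'"
  shows "\<bar>convergent_cf m c - convergent_cf m' c\<bar> \<le> 2 * (1/2) ^ n"
  using assms
proof (induction n arbitrary: c m m' rule: nat_induct2)
  case 0
  show ?case
    using convergent_cf_le[of c] convergent_cf_ge[of c] 0(1) by (simp add: abs_le_iff) (smt (verit))
next
  case 1
  show ?case
    using convergent_cf_le[of c] convergent_cf_ge[of c] 1(1) by (simp add: abs_le_iff) (smt (verit))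
next
  case (step n)
  obtain j j' where j: "m = Suc (Suc j)" "m' = Suc (Suc j')" "n \<le> j" "n \<le> j'"
    using step.prems(2,3) by (metis Suc_le_D Suc_le_mono add_2_eq_Suc')
  let ?c = "\<lambda>i. c (Suc (Suc i))"
  have "\<bar>convergent_cf m c - convergent_cf m' c\<bar>
      \<le> \<bar>convergent_cf j ?c - convergent_cf j' ?c\<bar> / 4"
    using cf_two_step[OF convergent_cf_ge_1[of ?c j] convergent_cf_ge_1[of ?c j'], of "real (c (Suc 0))"]
      step.prems(1) by (simp add: j)
  also have "\<dots> \<le> (2 * (1/2) ^ n) / 4"
    using step.IH[of ?c j j'] step.prems(1) j by simp
  finally show ?case by simp
qed

lemma convergent_cf_tendsto:
  assumes "\<And>i. c i \<ge> 1"
  shows "(\<lambda>n. convergent_cf n c) \<longlonglongrightarrow> cfrac c"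
proof -
  have "Cauchy (\<lambda>n. convergent_cf n c)"
  proof (rule metric_CauchyI)
    fix e :: real assume "e > 0"
    then obtain n where n: "(1/2) ^ n < e / 2"
      using real_arch_pow_inv[of "e/2" "1/2"] by auto
    show "\<exists>M. \<forall>m\<ge>M. \<forall>n\<ge>M. dist (convergent_cf m c) (convergent_cf n c) < e"
    proof (intro exI[of _ n] allI impI)
      fix m m' assume "n \<le> m" "n \<le> m'"
      then show "dist (convergent_cf m c) (convergent_cf m' c) < e"
        using convergent_cf_close[of c n m m', OF assms] n by (simp add: dist_real_def)
    qed
  qed
  then show ?thesis
    unfolding cfrac_def using convergent_LIMSEQ_iff real_Cauchy_convergent by blast
qed

lemma cfrac_ge:
  assumes "\<And>i. c i \<ge> 1"
  shows "cfrac c \<ge> real (c 0)"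
  using tendsto_lowerbound[OF convergent_cf_tendsto[of c, OF assms], of "real (c 0)"]
    convergent_cf_ge[of c, OF assms] by simp

text \<open>This is [0; x 0, x 1, ...], the form in which both tails of a bi-infinite sequence enter
  a Markov value.\<close>

definition cfval :: "(nat \<Rightarrow> nat) \<Rightarrow> real" where
  "cfval x = 1 / cfrac x"

lemma cfrac_eq:
  assumes "\<And>i. c (Suc i) \<ge> 1"
  shows "cfrac c = real (c 0) + cfval (\<lambda>i. c (Suc i))"
proof -
  have "cfrac (\<lambda>i. c (Suc i)) \<noteq> 0"
    using cfrac_ge[of "\<lambda>i. c (Suc i)"] assms[of 0] assms by fastforce
  then have "(\<lambda>n. convergent_cf (Suc n) c) \<longlonglongrightarrow> real (c 0) + cfval (\<lambda>i. c (Suc i))"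
    unfolding cfval_def convergent_cf.simps
    using convergent_cf_tendsto[of "\<lambda>i. c (Suc i)"] assms by (intro tendsto_intros) auto
  then have "(\<lambda>n. convergent_cf n c) \<longlonglongrightarrow> real (c 0) + cfval (\<lambda>i. c (Suc i))"
    by (rule LIMSEQ_imp_Suc)
  then show ?thesis unfolding cfrac_def by (rule limI)
qed

lemma cfrac_case_nat_0:
  assumes "\<And>i. x i \<ge> 1"
  shows "cfrac (case_nat 0 x) = cfval x"
  using cfrac_eq[of "case_nat 0 x"] assms by simp

lemma cfval_eq:
  assumes "\<And>i. x i \<ge> 1"
  shows "cfval x = 1 / (real (x 0) + cfval (\<lambda>i. x (Suc i)))"
  using cfrac_eq[of x] assms unfolding cfval_def by simp

lemma cfval_pos:
  assumes "\<And>i. x i \<ge> 1"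
  shows "cfval x > 0"
  using cfrac_ge[of x] assms[of 0] assms unfolding cfval_def by fastforce

lemma cfval_le:
  assumes "\<And>i. x i \<ge> 1"
  shows "cfval x \<le> 1 / real (x 0)"
proof -
  have "real (x 0) \<ge> 1" "cfrac x \<ge> real (x 0)"
    using assms[of 0] cfrac_ge[of x, OF assms] by auto
  then show ?thesis unfolding cfval_def by (intro frac_le) auto
qed

section \<open>Size, separation and order of values with digits 1 and 2\<close>

definition digits12 :: "(nat \<Rightarrow> nat) \<Rightarrow> bool" where
  "digits12 x \<longleftrightarrow> (\<forall>i. x i = 1 \<or> x i = 2)"

lemma digits12_ge_1: "digits12 x \<Longrightarrow> x i \<ge> 1"
  unfolding digits12_def by (metis one_le_numeral order_refl)

lemma digits12_Suc: "digits12 x \<Longrightarrow> digits12 (\<lambda>i. x (Suc i))"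
  unfolding digits12_def by simp

lemma digits12_cases: "digits12 x \<Longrightarrow> x i = 1 \<or> x i = 2"
  unfolding digits12_def by simp

lemma cfval12_eq: "digits12 x \<Longrightarrow> cfval x = 1 / (real (x 0) + cfval (\<lambda>i. x (Suc i)))"
  by (rule cfval_eq) (rule digits12_ge_1)

text \<open>Every tail is at most 1, which gives 1/(2 + 1); one more expansion step gives 1/(1 +
  1/3) = 3/4.\<close>

lemma cfval12_bounds:
  assumes "digits12 x"
  shows "1/3 \<le> cfval x" "cfval x \<le> 3/4"
proof -
  have lo: "1/3 \<le> cfval y" if y: "digits12 y" for y
  proof -
    have pos: "cfval (\<lambda>i. y (Suc i)) > 0" and "cfval (\<lambda>i. y (Suc i)) \<le> 1 / real (y (Suc 0))"
      using cfval_pos[of "\<lambda>i. y (Suc i)"] cfval_le[of "\<lambda>i. y (Suc i)"] digits12_ge_1[OF y] by auto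
    then have "cfval (\<lambda>i. y (Suc i)) \<le> 1" using digits12_cases[OF y, of "Suc 0"] by auto
    moreover have "1 \<le> real (y 0)" "real (y 0) \<le> 2" using digits12_cases[OF y, of 0] by auto
    ultimately show ?thesis
      unfolding cfval12_eq[OF y] using pos by (intro frac_le) auto
  qed
  show "1/3 \<le> cfval x" by (rule lo[OF assms])
  show "cfval x \<le> 3/4"
  proof -
    have "real (x 0) \<ge> 1" using digits12_ge_1[OF assms, of 0] by simp
    then have "1 / (real (x 0) + cfval (\<lambda>i. x (Suc i))) \<le> 1 / (1 + 1/3)"
      using lo[OF digits12_Suc[OF assms]] by (intro frac_le) auto
    then show ?thesis using cfval12_eq[OF assms] by simp
  qed
qed

text \<open>Removing a common first digit reverses the sign. The factor is a product of two values
  in [1/3, 3/4], hence the rates 9/16 and 1/9 per digit in the next lemmas.\<close>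

lemma cfval12_diff:
  assumes "digits12 x" "digits12 y" "x 0 = y 0"
  shows "cfval x - cfval y = (cfval (\<lambda>i. y (Suc i)) - cfval (\<lambda>i. x (Suc i))) * (cfval x * cfval y)"
proof -
  have "cfval (\<lambda>i. x (Suc i)) > 0" "cfval (\<lambda>i. y (Suc i)) > 0"
    using cfval_pos[of "\<lambda>i. x (Suc i)"] cfval_pos[of "\<lambda>i. y (Suc i)"] digits12_ge_1 assms by auto
  moreover have "real (x 0) \<ge> 1" using digits12_ge_1[OF assms(1), of 0] by simp
  ultimately show ?thesis
    unfolding cfval12_eq[OF assms(1)] cfval12_eq[OF assms(2)] assms(3)[symmetric]
    by (simp add: divide_simps)
qed

lemma cfval12_close:
  assumes "digits12 x" "digits12 y" "\<And>i. i < n \<Longrightarrow> x i = y i"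
  shows "\<bar>cfval x - cfval y\<bar> \<le> (9/16) ^ n"
  using assms
proof (induction n arbitrary: x y)
  case 0
  then show ?case using cfval12_bounds[of x] cfval12_bounds[of y] by simp
next
  case (Suc n)
  have IH: "\<bar>cfval (\<lambda>i. y (Suc i)) - cfval (\<lambda>i. x (Suc i))\<bar> \<le> (9/16) ^ n"
    using Suc.IH[of "\<lambda>i. y (Suc i)" "\<lambda>i. x (Suc i)"] Suc.prems digits12_Suc by simp
  have b: "0 \<le> cfval x" "cfval x \<le> 3/4" "0 \<le> cfval y" "cfval y \<le> 3/4"
    using cfval12_bounds[of x] cfval12_bounds[of y] Suc.prems by auto
  have "cfval x * cfval y \<le> 3/4 * (3/4)" using b by (intro mult_mono) auto
  then have "\<bar>cfval (\<lambda>i. y (Suc i)) - cfval (\<lambda>i. x (Suc i))\<bar> * \<bar>cfval x * cfval y\<bar> \<le> (9/16) ^ n * (9/16)"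
    using IH b by (intro mult_mono) auto
  then show ?case
    unfolding cfval12_diff[OF Suc.prems(1,2) Suc.prems(3)[of 0, simplified]] abs_mult by simp
qed

text \<open>First digit 1 gives at least 1/(1 + 3/4) = 4/7 and first digit 2 at most 1/(2 + 1/3) =
  3/7.\<close>

lemma cfval12_digit_gap:
  assumes "digits12 x" "digits12 y" "x 0 < y 0"
  shows "cfval y + 1/14 \<le> cfval x"
proof -
  have "x 0 = 1" "y 0 = 2"
    using assms(3) digits12_cases[OF assms(1), of 0] digits12_cases[OF assms(2), of 0] by auto
  moreover have "1 / (1 + cfval (\<lambda>i. x (Suc i))) \<ge> 4/7" "1 / (2 + cfval (\<lambda>i. y (Suc i))) \<le> 3/7"
    using cfval12_bounds[OF digits12_Suc[OF assms(1)]] cfval12_bounds[OF digits12_Suc[OF assms(2)]]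
    by (auto simp: divide_simps)
  ultimately show ?thesis using cfval12_eq[OF assms(1)] cfval12_eq[OF assms(2)] by simp
qed

lemma cfval12_separated:
  assumes "digits12 x" "digits12 y" "\<And>i. i < n \<Longrightarrow> x i = y i" "x n \<noteq> y n"
  shows "\<bar>cfval x - cfval y\<bar> \<ge> (1/14) * (1/9) ^ n"
  using assms
proof (induction n arbitrary: x y)
  case 0
  then have "x 0 < y 0 \<or> y 0 < x 0" by linarith
  then show ?case
    using cfval12_digit_gap[of x y] cfval12_digit_gap[of y x] 0 by auto
next
  case (Suc n)
  have IH: "\<bar>cfval (\<lambda>i. y (Suc i)) - cfval (\<lambda>i. x (Suc i))\<bar> \<ge> (1/14) * (1/9) ^ n"
    using Suc.IH[of "\<lambda>i. y (Suc i)" "\<lambda>i. x (Suc i)"] Suc.prems digits12_Suc by simp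
  have b: "1/3 \<le> cfval x" "1/3 \<le> cfval y"
    using cfval12_bounds[of x] cfval12_bounds[of y] Suc.prems by auto
  have "1/3 * (1/3) \<le> cfval x * cfval y" using b by (intro mult_mono) auto
  then have "\<bar>cfval (\<lambda>i. y (Suc i)) - cfval (\<lambda>i. x (Suc i))\<bar> * \<bar>cfval x * cfval y\<bar> \<ge> ((1/14) * (1/9) ^ n) * (1/9)"
    using IH b by (intro mult_mono) auto
  then show ?case
    unfolding cfval12_diff[OF Suc.prems(1,2) Suc.prems(3)[of 0, simplified]] abs_mult by simp
qed

text \<open>Alternating lexicographic order: each common digit removed by
  \<open>cfval12_diff\<close> reverses the comparison.\<close>

lemma cfval12_less:
  assumes "digits12 x" "digits12 y" "\<And>i. i < n \<Longrightarrow> x i = y i"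
    "if even n then y n < x n else x n < y n"
  shows "cfval x < cfval y"
  using assms
proof (induction n arbitrary: x y)
  case 0
  then show ?case using cfval12_digit_gap[of y x] by auto
next
  case (Suc n)
  have "cfval (\<lambda>i. y (Suc i)) < cfval (\<lambda>i. x (Suc i))"
    using Suc.IH[of "\<lambda>i. y (Suc i)" "\<lambda>i. x (Suc i)"] Suc.prems digits12_Suc by auto
  moreover have "cfval x * cfval y > 0"
    using cfval12_bounds[of x] cfval12_bounds[of y] Suc.prems(1,2) by auto
  ultimately have "cfval x - cfval y < 0"
    unfolding cfval12_diff[OF Suc.prems(1,2) Suc.prems(3)[of 0, simplified]]
    by (intro mult_neg_pos) auto
  then show ?case by simp
qed

text \<open>This turns the Markov inequality at the middle \<open>2\<close> of \<open>\<dots> 1 1 2 2 \<dots>\<close> into a comparison of the two tails.\<close>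
lemma markov_inequality_iff:
  fixes L R :: real
  assumes "L > 0" "R > 0"
  shows "2 + 1 / (2 + R) + 1 / (1 + 1 / (1 + L)) \<le> 3 \<longleftrightarrow> L \<le> R"
proof -
  have "1 / (1 + 1 / (1 + L)) = 1 - 1 / (2 + L)"
    using assms by (simp add: divide_simps)
  then have "2 + 1 / (2 + R) + 1 / (1 + 1 / (1 + L)) \<le> 3 \<longleftrightarrow> 1 / (2 + R) \<le> 1 / (2 + L)"
    by linarith
  also have "\<dots> \<longleftrightarrow> L \<le> R" using assms by (simp add: divide_simps)
  finally show ?thesis .
qed

section \<open>The Markoff property implies balance\<close>

text \<open>Reading outwards from a boundary 1|0, the first difference has to be 0 on the left and 1
  on the right, so the factors 1 w^R 1 0 w 0 are forbidden. The second clause forbids 0 w^R 0 1 w 1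
  in the same way.\<close>

definition markoff :: "(int \<Rightarrow> int) \<Rightarrow> bool" where
  "markoff s \<longleftrightarrow>
     (\<forall>k n. s (k - 1) = 1 \<longrightarrow> s k = 0 \<longrightarrow> (\<forall>i<n. s (k + 1 + int i) = s (k - 2 - int i)) \<longrightarrow>
        s (k - 2 - int n) \<le> s (k + 1 + int n)) \<and>
     (\<forall>k n. s (k - 1) = 0 \<longrightarrow> s k = 1 \<longrightarrow> (\<forall>i<n. s (k + 1 + int i) = s (k - 2 - int i)) \<longrightarrow>
        s (k + 1 + int n) \<le> s (k - 2 - int n))"

text \<open>Here \<open>h\<close> is a height function: \<open>h (i + int n) - h i\<close> counts
  the ones in a factor of length n. The length bound is strict, to express balance below a minimal
  counterexample.\<close>

definition balanced_upto :: "nat \<Rightarrow> (int \<Rightarrow> int) \<Rightarrow> bool" where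
  "balanced_upto l h \<longleftrightarrow> (\<forall>i j n. n < l \<longrightarrow> h (i + int n) - h i \<le> h (j + int n) - h j + 1)"

definition balanced :: "(int \<Rightarrow> int) \<Rightarrow> bool" where
  "balanced h \<longleftrightarrow> (\<forall>i j n. h (i + int n) - h i \<le> h (j + int n) - h j + 1)"

lemma balancedD: "balanced h \<Longrightarrow> h (i + int n) - h i \<le> h (j + int n) - h j + 1"
  unfolding balanced_def by blast

lemma periodic_shift:
  fixes s :: "int \<Rightarrow> 'a"
  assumes "\<And>i. a \<le> i \<Longrightarrow> i + l \<le> b \<Longrightarrow> s (i + l) = s i" "0 \<le> l"
    and "a \<le> i" "i + int m * l \<le> b"
  shows "s (i + int m * l) = s i"
  using assms(4)
proof (induction m)
  case (Suc m)
  have eq: "i + int (Suc m) * l = (i + int m * l) + l" by (simp add: algebra_simps)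
  have "0 \<le> int m * l" using assms(2) by simp
  then have "s ((i + int m * l) + l) = s (i + int m * l)"
    using assms Suc.prems eq by (intro assms(1)) linarith+
  also have "\<dots> = s i" using Suc eq assms(2) by (intro Suc.IH) linarith
  finally show ?case unfolding eq .
qed simp

text \<open>
  The factor at \<open>x\<close> is \<open>b w b\<close>, the one at \<open>y\<close> is \<open>a w a\<close> with \<open>w\<close> a palindrome.  By minimality of
  their distance everything in between has period \<open>l\<close>, so that the stretch from \<open>x\<close> to the end of the
  second factor reads \<open>b (w b a)\<^sup>m w a\<close>.
\<close>
lemma markoff_no_minimal_unbalanced:
  fixes h :: "int \<Rightarrow> int" and l d :: nat and x :: int
  defines "s \<equiv> \<lambda>i. h (i + 1) - h i" and "H \<equiv> \<lambda>i. h (i + int l) - h i"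
  assumes s01: "\<And>i. s i = 0 \<or> s i = 1"
    and M: "markoff s"
    and l_min: "balanced_upto l h"
    and d_min: "\<And>x d'. d' < d \<Longrightarrow> \<bar>H x - H (x + int d')\<bar> \<le> 1"
    and gap: "H (x + int d) + 2 \<le> H x"
  shows False
proof -
  define y where "y = x + int d"
  have Hstep: "H (i + 1) = H i + s (i + int l) - s i" for i
    unfolding H_def s_def by (simp add: algebra_simps)
  have Hstep1: "\<bar>H (i + 1) - H i\<bar> \<le> 1" for i
    using Hstep[of i] s01[of i] s01[of "i + int l"] by linarith
  have d2: "d \<ge> 2"
  proof (rule ccontr)
    assume "\<not> d \<ge> 2"
    then have "d = 0 \<or> d = 1" by linarith
    then show False using gap Hstep1[of x] by auto
  qed
  have mid: "H (x + int e) = H x - 1 \<and> H y = H x - 2" if "0 < e" "e < d" for e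
  proof -
    have "\<bar>H x - H (x + int e)\<bar> \<le> 1" using d_min that by blast
    moreover have "\<bar>H (x + int e) - H y\<bar> \<le> 1"
      using d_min[of "d - e" "x + int e"] that unfolding y_def by (simp add: of_nat_diff)
    ultimately show ?thesis using gap unfolding y_def by linarith
  qed
  define c where "c = H y"
  have Hx: "H x = c + 2" using mid[of 1] d2 unfolding c_def by auto
  have Hmid: "H i = c + 1" if "x < i" "i < y" for i
    using mid[of "nat (i - x)"] that unfolding c_def y_def by auto
  have yx: "y \<ge> x + 2" using d2 unfolding y_def by simp
  have sx: "s x = 1" "s (x + int l) = 0"
    using Hstep[of x] Hx Hmid[of "x + 1"] yx s01[of x] s01[of "x + int l"] by auto
  have sy1: "s (y - 1) = 1" "s (y - 1 + int l) = 0"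
    using Hstep[of "y - 1"] c_def Hmid[of "y - 1"] yx s01[of "y - 1"] s01[of "y - 1 + int l"] by auto
  \<comment> \<open>A constant \<open>H\<close> strictly between x and y means period l there. That
    this period starts only at x + 1 produces the final contradiction.\<close>
  have per: "s (i + int l) = s i" if "x + 1 \<le> i" "i + int l \<le> y + int l - 2" for i
    using Hstep[of i] Hmid[of i] Hmid[of "i + 1"] that by auto
  have perm: "s (i + int m * int l) = s i" if "x + 1 \<le> i" "i + int m * int l \<le> y + int l - 2" for i m
    using periodic_shift[of "x + 1" "int l" "y + int l - 2" s i m] per that by simp
  have l2: "l \<ge> 2"
  proof (rule ccontr)
    assume "\<not> l \<ge> 2"
    then have "l = 0 \<or> l = 1" by linarith
    then show False
      using gap s01[of x] s01[of y] unfolding H_def y_def s_def by auto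
  qed

  define A where "A = (\<lambda>i. h (x + int i) - h x)"
  define B where "B = (\<lambda>i. h (y + int i) - h y)"
  have Al: "A l = c + 2" and Bl: "B l = c" using Hx c_def unfolding A_def B_def H_def by auto
  \<comment> \<open>Proper prefixes and suffixes of both factors are shorter than l and hence
    balanced; since the totals differ by 2, all these inequalities are tight.\<close>
  have AB: "A i = B i + 1" "B i + B (l - i) = c" if i: "0 < i" "i < l" for i
  proof -
    have *: "A i \<le> B i + 1 \<and> A i \<le> (B l - B (l - i)) + 1 \<and> (A l - A (l - i)) \<le> B i + 1
        \<and> (A l - A (l - i)) \<le> (B l - B (l - i)) + 1" if i: "0 < i" "i < l" for i
    proof -
      have bal: "h (p + int i) - h p \<le> h (q + int i) - h q + 1" for p q
        using l_min i unfolding balanced_upto_def by blast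
      show ?thesis
        using bal[of x y] bal[of x "y + int (l - i)"] bal[of "x + int (l - i)" y]
          bal[of "x + int (l - i)" "y + int (l - i)"] i
        unfolding A_def B_def by (simp add: of_nat_diff)
    qed
    have "l - (l - i) = i" "0 < l - i" "l - i < l" using i by auto
    note j = *[OF this(2,3), unfolded this(1)]
    show "A i = B i + 1" "B i + B (l - i) = c"
      using *[OF i] j Al Bl by linarith+
  qed
  have sB: "s (y + int i) = B (Suc i) - B i" for i
    unfolding s_def B_def by (simp add: algebra_simps)
  have sA: "s (x + int i) = A (Suc i) - A i" for i
    unfolding s_def A_def by (simp add: algebra_simps)
  have palin: "s (y + int i) = s (y + int (l - 1 - i))" if "0 < i" "i < l - 1" for i
  proof -
    have idx: "Suc (l - 1 - i) = l - i" "l - Suc i = l - 1 - i" using that by auto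
    have "B i + B (l - i) = c" "B (Suc i) + B (l - Suc i) = c"
      using AB(2)[of i] AB(2)[of "Suc i"] that by auto
    then show ?thesis unfolding sB idx by linarith
  qed
  have same: "s (x + int i) = s (y + int i)" if "0 < i" "i < l - 1" for i
    using AB(1)[of i] AB(1)[of "Suc i"] that unfolding sA sB by simp
  have sylast: "s (y + int (l - 1)) = 0"
  proof -
    have eq: "y + int (l - 1) = y - 1 + int l" using l2 by (simp add: of_nat_diff)
    show ?thesis unfolding eq by (rule sy1(2))
  qed
  have Suc_l: "Suc (l - 1) = l" using l2 by simp
  have B0: "B 0 = 0" unfolding B_def by simp
  have B1: "B 1 + B (l - 1) = c" using AB(2)[of 1] l2 by simp
  have "B l - B (l - 1) = 0" using sB[of "l - 1"] sylast unfolding Suc_l by linarith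
  then have "B 1 = 0" using B1 Bl by linarith
  then have sy: "s y = 0" using sB[of 0] B0 by simp
  have "A (l - 1) = B (l - 1) + 1" using AB(1)[of "l - 1"] l2 by simp
  then have sxlast: "s (x + int (l - 1)) = 1"
    using sA[of "l - 1"] Al B1 \<open>B 1 = 0\<close> unfolding Suc_l by linarith

  define m e where "m = d div l" and "e = d mod l"
  have dme: "d = m * l + e" "e < l" using l2 unfolding m_def e_def by auto
  \<comment> \<open>If e were positive, the period would identify the 0 at y with the letter of
    index e in the factor at x, and the 1 ending that factor with the letter of index l - 1 - e in
    the factor at y. These indices are mirror images, so the palindrome, or \<open>s y = 0\<close>
    if e = l - 1, is violated.\<close>
  have "e = 0"
  proof (rule ccontr)
    assume "e \<noteq> 0"
    have shift: "s (y + int i) = s (x + int (e + i))" if "i + 2 \<le> l" for i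
      using perm[of "x + int e + int i" m] \<open>e \<noteq> 0\<close> that unfolding y_def dme(1)
      by (simp add: algebra_simps)
    have 0: "s (x + int e) = 0" using shift[of 0] sy l2 by simp
    have 1: "s (y + int (l - 1 - e)) = 1"
      using shift[of "l - 1 - e"] sxlast \<open>e \<noteq> 0\<close> dme(2) by simp
    show False
    proof (cases "e < l - 1")
      case True
      then show False using palin[of e] same[of e] 0 1 \<open>e \<noteq> 0\<close> by simp
    next
      case False
      then show False using 1 sy dme(2) by simp
    qed
  qed
  then have yxm: "y = x + int m * int l" using dme unfolding y_def by simp
  have "m \<noteq> 0" using yx yxm by (cases "m = 0") auto
  then have "1 * int l \<le> int m * int l" by (intro mult_right_mono) auto
  then have ygl: "y \<ge> x + int l" unfolding yxm by simp

  have M1: "s (k - 2 - int n) \<le> s (k + 1 + int n)"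
    if "s (k - 1) = 1" "s k = 0" "\<And>i. i < n \<Longrightarrow> s (k + 1 + int i) = s (k - 2 - int i)" for k n
    using M that unfolding markoff_def by blast
  have M2: "s (k + 1 + int n) \<le> s (k - 2 - int n)"
    if "s (k - 1) = 0" "s k = 1" "\<And>i. i < n \<Longrightarrow> s (k + 1 + int i) = s (k - 2 - int i)" for k n
    using M that unfolding markoff_def by blast

  have first: "s (y + 1 + int i) = s (y - 2 - int i)" if "i < l - 2" for i
  proof -
    have "s (y - 2 - int i + int l) = s (y - 2 - int i)"
      using per[of "y - 2 - int i"] ygl that by simp
    moreover have "y - 2 - int i + int l = y + int (l - 1 - Suc i)" using that by simp
    moreover have "y + 1 + int i = y + int (Suc i)" by simp
    moreover have "s (y + int (Suc i)) = s (y + int (l - 1 - Suc i))"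
      using that by (intro palin) auto
    ultimately show ?thesis by metis
  qed
  have ends: "y - 2 - int (l - 2) = y - int l" "y + 1 + int (l - 2) = y + int (l - 1)"
    using l2 by auto
  show False
  \<comment> \<open>For m = 1 the comparison outwards from y ends with the 1 at x against the 0
    closing the second factor. For larger m it runs past this place.\<close>
  proof (cases "m = 1")
    case True
    have "s (y - 2 - int (l - 2)) \<le> s (y + 1 + int (l - 2))"
      using M1[of y "l - 2"] first sy sy1 by blast
    then show False unfolding ends using sylast sx(1) yxm True by simp
  next
    case False
    then have "2 \<le> m" using \<open>m \<noteq> 0\<close> by linarith
    then have "2 * int l \<le> int m * int l" by (intro mult_right_mono) auto
    then have y2l: "y \<ge> x + 2 * int l" unfolding yxm by simp
    have left: "s (y - int l) = 0" "s (y - int l - 1) = 1"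
      using per[of "y - int l"] per[of "y - int l - 1"] y2l l2 sy sy1(1)
      by (auto simp: algebra_simps)
    have match1: "s (y + 1 + int i) = s (y - 2 - int i)" if "i < l - 1" for i
    proof (cases "i = l - 2")
      case True
      show ?thesis unfolding True ends left sylast ..
    next
      case False
      then show ?thesis using first that by simp
    qed
    \<comment> \<open>The comparison at y next meets the 1 at y - l - 1, so a 1 must follow the
      second factor. This creates a boundary of the opposite kind at y + l.\<close>
    have top: "s (y + int l) = 1"
    proof -
      have "s (y - 2 - int (l - 1)) \<le> s (y + 1 + int (l - 1))"
        using M1[of y "l - 1"] match1 sy sy1 by blast
      moreover have "y - 2 - int (l - 1) = y - int l - 1" "y + 1 + int (l - 1) = y + int l"
        using l2 by auto
      ultimately show ?thesis using left(2) s01[of "y + int l"] by simp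
    qed
    have per2: "s (i + 2 * int l) = s i" if "x + 1 \<le> i" "i + 2 * int l \<le> y + int l - 2" for i
      using perm[of i 2] that by simp
    define I where "I = nat (y - int l - 2 - x)"
    have I: "int I = y - int l - 2 - x" using y2l l2 unfolding I_def by simp
    have reach: "s (y + 1 + int i) = s (y - 2 - int i)"
      if "i < l + j" "\<And>j'. j' < j \<Longrightarrow> s (y + int l + 1 + int j') = s (y - int l - 2 - int j')" for i j
    proof (cases "i < l - 1")
      case True
      then show ?thesis by (rule match1)
    next
      case False
      then have "i = l - 1 \<or> (i = l + (i - l) \<and> i - l < j)" using that(1) by linarith
      then consider "i = l - 1" | j' where "i = l + j'" "j' < j" by blast
      then show ?thesis
      proof cases
        case 1
        then show ?thesis using top left(2) l2 by (simp add: algebra_simps)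
      next
        case 2
        then show ?thesis using that(2)[of j'] by (simp add: algebra_simps)
      qed
    qed
    \<comment> \<open>A squeeze: the boundary at y + l bounds the next letter from above, the one at
      y bounds it from below, and the period 2 l identifies the two bounds.\<close>
    have match2: "s (y + int l + 1 + int j) = s (y + int l - 2 - int j)
        \<and> s (y + int l + 1 + int j) = s (y - int l - 2 - int j)" if "j < I" for j
      using that
    proof (induction j rule: less_induct)
      case (less j)
      have p: "s (y + int l - 2 - int j) = s (y - int l - 2 - int j)"
        using per2[of "y - int l - 2 - int j"] less.prems I by (simp add: algebra_simps)
      have "s (y + int l + 1 + int j) \<le> s (y + int l - 2 - int j)"
        using M2[of "y + int l" j] top sy1(2) less by (simp add: algebra_simps)
      moreover have "s (y - 2 - int (l + j)) \<le> s (y + 1 + int (l + j))"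
      proof (intro M1 reach[of _ j] sy sy1)
        fix j' assume "j' < j"
        then show "s (y + int l + 1 + int j') = s (y - int l - 2 - int j')"
          using less.IH[of j'] less.prems by linarith
      qed
      ultimately show ?case
        using p by (auto simp: algebra_simps)
    qed
    \<comment> \<open>At index I the comparison from y reaches x itself, just before the period
      begins: the upper bound is 0, the lower bound 1.\<close>
    have "s (y + int l + 1 + int I) \<le> s (y + int l - 2 - int I)"
      using M2[of "y + int l" I] top sy1(2) match2 by (simp add: algebra_simps)
    moreover have "s (y + int l - 2 - int I) = 0"
    proof -
      have "y + int l - 2 - int I = x + int l + int l" using I by simp
      moreover have "s (x + int l + int l) = s (x + int l)" using y2l l2 by (intro per) auto
      ultimately show ?thesis using sx(2) by metis
    qed
    moreover have "s (y - 2 - int (l + I)) \<le> s (y + 1 + int (l + I))"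
    proof (intro M1 reach[of _ I] sy sy1)
      fix j' assume "j' < I"
      then show "s (y + int l + 1 + int j') = s (y - int l - 2 - int j')" using match2[of j'] by linarith
    qed
    moreover have "y - 2 - int (l + I) = x" using I by simp
    moreover have "y + 1 + int (l + I) = y + int l + 1 + int I" by simp
    ultimately show False using sx(1) by (metis not_one_le_zero order_trans)
  qed
qed

lemma markoff_complement:
  assumes "markoff s"
  shows "markoff (\<lambda>i. 1 - s i)"
proof -
  have 1: "s (k - 2 - int n) \<le> s (k + 1 + int n)"
    if "s (k - 1) = 1" "s k = 0" "\<forall>i<n. s (k + 1 + int i) = s (k - 2 - int i)" for k n
    using assms that unfolding markoff_def by blast
  have 2: "s (k + 1 + int n) \<le> s (k - 2 - int n)"
    if "s (k - 1) = 0" "s k = 1" "\<forall>i<n. s (k + 1 + int i) = s (k - 2 - int i)" for k n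
    using assms that unfolding markoff_def by blast
  show ?thesis
    unfolding markoff_def
  proof (intro conjI allI impI)
    fix k n
    assume "1 - s (k - 1) = 1" "1 - s k = 0"
      "\<forall>i<n. 1 - s (k + 1 + int i) = 1 - s (k - 2 - int i)"
    then show "1 - s (k - 2 - int n) \<le> 1 - s (k + 1 + int n)" using 2[of k n] by simp
  next
    fix k n
    assume "1 - s (k - 1) = 0" "1 - s k = 1"
      "\<forall>i<n. 1 - s (k + 1 + int i) = 1 - s (k - 2 - int i)"
    then show "1 - s (k + 1 + int n) \<le> 1 - s (k - 2 - int n)" using 1[of k n] by simp
  qed
qed

text \<open>A counterexample is taken with least length l and then with least distance d between the
  two factors. If the factor with more ones comes second, complementing the letters exchanges the
  roles.\<close>

lemma markoff_imp_balanced: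
  fixes h :: "int \<Rightarrow> int"
  assumes s01: "\<And>i. h (i + 1) - h i = 0 \<or> h (i + 1) - h i = 1"
    and M: "markoff (\<lambda>i. h (i + 1) - h i)"
  shows "balanced h"
proof (rule ccontr)
  define P where "P = (\<lambda>l. \<exists>i j. h (j + int l) - h j + 2 \<le> h (i + int l) - h i)"
  assume "\<not> balanced h"
  then obtain i j n where "\<not> h (i + int n) - h i \<le> h (j + int n) - h j + 1"
    unfolding balanced_def by blast
  then have "h (j + int n) - h j + 2 \<le> h (i + int n) - h i" by linarith
  then have "\<exists>l. P l" unfolding P_def by blast
  define l where "l = (LEAST l. P l)"
  have "P l" unfolding l_def using \<open>\<exists>l. P l\<close> by (metis LeastI_ex)
  have notP: "\<not> P n" if "n < l" for n using that not_less_Least unfolding l_def by blast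
  have bal: "balanced_upto l h"
    unfolding balanced_upto_def
  proof (intro allI impI, rule ccontr)
    fix i j n assume "n < l" "\<not> h (i + int n) - h i \<le> h (j + int n) - h j + 1"
    then have "h (j + int n) - h j + 2 \<le> h (i + int n) - h i" by linarith
    then show False using notP[OF \<open>n < l\<close>] unfolding P_def by blast
  qed
  define H where "H = (\<lambda>i. h (i + int l) - h i)"
  define Q where "Q = (\<lambda>d. \<exists>x. 2 \<le> \<bar>H x - H (x + int d)\<bar>)"
  obtain i j where ij: "H j + 2 \<le> H i" using \<open>P l\<close> unfolding P_def H_def by auto
  have "\<exists>d. Q d"
  proof (cases "i \<le> j")
    case True
    then have "Q (nat (j - i))" unfolding Q_def using ij by (intro exI[of _ i]) auto
    then show ?thesis ..
  next
    case False
    then have "Q (nat (i - j))" unfolding Q_def using ij by (intro exI[of _ j]) auto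
    then show ?thesis ..
  qed
  define d where "d = (LEAST d. Q d)"
  have "Q d" unfolding d_def using \<open>\<exists>d. Q d\<close> by (metis LeastI_ex)
  then obtain x where x: "2 \<le> \<bar>H x - H (x + int d)\<bar>" unfolding Q_def by blast
  have dmin: "\<bar>H x - H (x + int d')\<bar> \<le> 1" if "d' < d" for d' x
  proof -
    have "\<not> Q d'" using that not_less_Least unfolding d_def by blast
    then have "\<not> 2 \<le> \<bar>H x - H (x + int d')\<bar>" unfolding Q_def by blast
    then show ?thesis by linarith
  qed
  show False
  proof (cases "H (x + int d) + 2 \<le> H x")
    case True
    show False
      using markoff_no_minimal_unbalanced[of h l d x] s01 M bal dmin True unfolding H_def by blast
  next
    case False
    define h' where "h' = (\<lambda>i. i - h i)"
    have s': "h' (i + 1) - h' i = 1 - (h (i + 1) - h i)" for i unfolding h'_def by simp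
    show False
    proof (rule markoff_no_minimal_unbalanced[of h' l d x])
      show "h' (i + 1) - h' i = 0 \<or> h' (i + 1) - h' i = 1" for i using s01[of i] unfolding s' by auto
      show "markoff (\<lambda>i. h' (i + 1) - h' i)" unfolding s' by (rule markoff_complement[OF M])
      show "balanced_upto l h'"
        using bal unfolding balanced_upto_def h'_def by (force simp: algebra_simps)
      show "\<bar>h' (x + int l) - h' x - (h' (x + int d' + int l) - h' (x + int d'))\<bar> \<le> 1" if "d' < d" for x d'
        using dmin[OF that, of x] unfolding H_def h'_def by linarith
      show "h' (x + int d + int l) - h' (x + int d) + 2 \<le> h' (x + int l) - h' x"
        using False x unfolding H_def h'_def by linarith
    qed
  qed
qed

section \<open>Sequences with Markov values at most 3\<close>

definition right_tail :: "(int \<Rightarrow> nat) \<Rightarrow> int \<Rightarrow> nat \<Rightarrow> nat" where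
  "right_tail a k = (\<lambda>i. a (k + int i))"

definition left_tail :: "(int \<Rightarrow> nat) \<Rightarrow> int \<Rightarrow> nat \<Rightarrow> nat" where
  "left_tail a k = (\<lambda>i. a (k - int i))"

definition markov12 :: "(int \<Rightarrow> nat) \<Rightarrow> bool" where
  "markov12 a \<longleftrightarrow> (\<forall>i. a i = 1 \<or> a i = 2) \<and>
     (\<forall>k. real (a k) + cfval (right_tail a (k + 1)) + cfval (left_tail a (k - 1)) \<le> 3)"

lemma tail_Suc:
  "(\<lambda>i. right_tail a k (Suc i)) = right_tail a (k + 1)"
  "(\<lambda>i. left_tail a k (Suc i)) = left_tail a (k - 1)"
  unfolding right_tail_def left_tail_def by (auto simp: algebra_simps)

lemma markov_value:
  assumes "\<And>n. a n > 0"
  shows "cfrac (\<lambda>i. a (k + int i)) + cfrac (case_nat 0 (\<lambda>i. a (k - 1 - int i)))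
    = real (a k) + cfval (right_tail a (k + 1)) + cfval (left_tail a (k - 1))"
proof -
  have "cfrac (\<lambda>i. a (k + int i)) = real (a k) + cfval (right_tail a (k + 1))"
    using cfrac_eq[of "\<lambda>i. a (k + int i)"] assms
    unfolding right_tail_def by (simp add: Suc_le_eq algebra_simps)
  moreover have "cfrac (case_nat 0 (\<lambda>i. a (k - 1 - int i))) = cfval (left_tail a (k - 1))"
    using cfrac_case_nat_0[of "\<lambda>i. a (k - 1 - int i)"] assms
    unfolding left_tail_def by (simp add: Suc_le_eq)
  ultimately show ?thesis by simp
qed

text \<open>Both fractional parts in a Markov value are positive, so the bound 3 leaves only the
  digits 1 and 2.\<close>

lemma K3_iff:
  "x \<in> K3 \<longleftrightarrow> (\<exists>a. markov12 a \<and> x = cfval (right_tail a 1))"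
proof
  assume "x \<in> K3"
  then obtain a :: "int \<Rightarrow> nat" where a: "\<And>n. a n > 0" "x = cfrac (case_nat 0 (\<lambda>i. a (1 + int i)))"
    "\<And>k. cfrac (\<lambda>i. a (k + int i)) + cfrac (case_nat 0 (\<lambda>i. a (k - 1 - int i))) \<le> 3"
    unfolding K3_def by blast
  have le3: "real (a k) + cfval (right_tail a (k + 1)) + cfval (left_tail a (k - 1)) \<le> 3" for k
    using a(3)[of k] markov_value[of a k, OF a(1)] by linarith
  have "a k = 1 \<or> a k = 2" for k
  proof -
    have "cfval (right_tail a (k + 1)) > 0" "cfval (left_tail a (k - 1)) > 0"
      using cfval_pos[of "right_tail a (k + 1)"] cfval_pos[of "left_tail a (k - 1)"] a(1)
      unfolding right_tail_def left_tail_def by (auto simp: Suc_le_eq)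
    then have "real (a k) < 3" using le3[of k] by linarith
    then show ?thesis using a(1)[of k] by linarith
  qed
  then have "markov12 a" unfolding markov12_def using le3 by blast
  moreover have "x = cfval (right_tail a 1)"
    unfolding a(2) right_tail_def using a(1) by (intro cfrac_case_nat_0) (simp add: Suc_le_eq)
  ultimately show "\<exists>a. markov12 a \<and> x = cfval (right_tail a 1)" by blast
next
  assume "\<exists>a. markov12 a \<and> x = cfval (right_tail a 1)"
  then obtain a where a: "markov12 a" "x = cfval (right_tail a 1)" by blast
  have pos: "a n > 0" for n using a(1) unfolding markov12_def by (metis zero_less_one zero_less_numeral)
  have "x = cfrac (case_nat 0 (\<lambda>i. a (1 + int i)))"
    unfolding a(2) right_tail_def using pos by (intro cfrac_case_nat_0[symmetric]) (simp add: Suc_le_eq)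
  moreover have "cfrac (\<lambda>i. a (k + int i)) + cfrac (case_nat 0 (\<lambda>i. a (k - 1 - int i))) \<le> 3" for k
    using a(1) markov_value[of a k, OF pos] unfolding markov12_def by metis
  ultimately show "x \<in> K3" unfolding K3_def using pos by blast
qed

lemma digits12_tails:
  assumes "\<And>i. a i = 1 \<or> a i = 2"
  shows "digits12 (right_tail a k)" "digits12 (left_tail a k)"
  using assms unfolding digits12_def right_tail_def left_tail_def by auto

lemma cfval_right_tail:
  assumes "\<And>i. a i = 1 \<or> a i = 2"
  shows "cfval (right_tail a k) = 1 / (real (a k) + cfval (right_tail a (k + 1)))"
  using cfval12_eq[OF digits12_tails(1)[of a k, OF assms]] unfolding tail_Suc
  by (simp add: right_tail_def)

lemma cfval_left_tail:
  assumes "\<And>i. a i = 1 \<or> a i = 2"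
  shows "cfval (left_tail a k) = 1 / (real (a k) + cfval (left_tail a (k - 1)))"
  using cfval12_eq[OF digits12_tails(2)[of a k, OF assms]] unfolding tail_Suc
  by (simp add: left_tail_def)

text \<open>At a boundary 1 2 the crude bounds on the tails exclude 1 2 1, since 4/7 + 4/7 > 1, and
  2 1 2, since 7/10 + 4/11 > 1. What is left is 1 1 2 2, where \<open>markov_inequality_iff\<close>
  applies.\<close>

lemma markov12_boundary:
  assumes a: "markov12 a" and k: "a (k - 1) = 1" "a k = 2"
  shows "a (k - 2) = 1" "a (k + 1) = 2" "cfval (left_tail a (k - 3)) \<le> cfval (right_tail a (k + 2))"
proof -
  have d: "a i = 1 \<or> a i = 2" for i using a unfolding markov12_def by blast
  note R = cfval_right_tail[of a, OF d] and L = cfval_left_tail[of a, OF d]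
  note Rb = cfval12_bounds[OF digits12_tails(1)[of a, OF d]]
    and Lb = cfval12_bounds[OF digits12_tails(2)[of a, OF d]]
  have le3: "2 + cfval (right_tail a (k + 1)) + cfval (left_tail a (k - 1)) \<le> 3"
    using a k(2) unfolding markov12_def by (metis of_nat_numeral)
  have ge47: "1 / (1 + t) \<ge> 4/7" if "t \<le> 3/4" "0 \<le> t" for t :: real
    using that by (simp add: field_simps)
  have k1: "cfval (left_tail a (k - 1)) = 1 / (1 + cfval (left_tail a (k - 2)))"
    using L[of "k - 1"] k(1) by simp
  show r2: "a (k + 1) = 2"
  proof (rule ccontr)
    assume "a (k + 1) \<noteq> 2"
    then have "cfval (right_tail a (k + 1)) = 1 / (1 + cfval (right_tail a (k + 2)))"
      using R[of "k + 1"] d[of "k + 1"] by (simp add: add.assoc)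
    then show False
      using ge47[of "cfval (right_tail a (k + 2))"] ge47[of "cfval (left_tail a (k - 2))"]
        Rb[of "k + 2"] Lb[of "k - 2"] k1 le3 by linarith
  qed
  have R2: "cfval (right_tail a (k + 1)) = 1 / (2 + cfval (right_tail a (k + 2)))"
    using R[of "k + 1"] r2 by (simp add: add.assoc)
  show l1: "a (k - 2) = 1"
  proof (rule ccontr)
    assume "a (k - 2) \<noteq> 1"
    then have "cfval (left_tail a (k - 2)) = 1 / (2 + cfval (left_tail a (k - 3)))"
      using L[of "k - 2"] d[of "k - 2"] by simp
    also have "\<dots> \<le> 1 / (2 + 1/3)" using Lb[of "k - 3"] by (intro frac_le) auto
    finally have "1 / (1 + cfval (left_tail a (k - 2))) \<ge> 1 / (1 + 3/7)"
      using Lb[of "k - 2"] by (intro frac_le) auto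
    moreover have "1 / (2 + cfval (right_tail a (k + 2))) \<ge> 1 / (2 + 3/4)"
      using Rb[of "k + 2"] by (intro frac_le) auto
    ultimately show False using le3 k1 R2 by simp
  qed
  have "cfval (left_tail a (k - 2)) = 1 / (1 + cfval (left_tail a (k - 3)))"
    using L[of "k - 2"] l1 by simp
  then have "2 + 1 / (2 + cfval (right_tail a (k + 2)))
      + 1 / (1 + 1 / (1 + cfval (left_tail a (k - 3)))) \<le> 3"
    using le3 k1 R2 by simp
  then show "cfval (left_tail a (k - 3)) \<le> cfval (right_tail a (k + 2))"
    using Lb[of "k - 3"] Rb[of "k + 2"] by (subst (asm) markov_inequality_iff) auto
qed

section \<open>Reflection, runs of equal digits and the division into blocks\<close>

lemma markov12_reflect:
  assumes "markov12 a"
  shows "markov12 (\<lambda>i. a (c - i))"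
proof -
  have "right_tail (\<lambda>i. a (c - i)) k = left_tail a (c - k)" "left_tail (\<lambda>i. a (c - i)) k = right_tail a (c - k)" for k
    unfolding right_tail_def left_tail_def by (auto simp: algebra_simps)
  moreover have "real (a (c - k)) + cfval (left_tail a (c - (k + 1))) + cfval (right_tail a (c - (k - 1))) \<le> 3" for k
  proof -
    have eqs: "c - (k + 1) = (c - k) - 1" "c - (k - 1) = (c - k) + 1" by auto
    have "real (a (c - k)) + cfval (right_tail a ((c - k) + 1)) + cfval (left_tail a ((c - k) - 1)) \<le> 3"
      using assms unfolding markov12_def by blast
    then show ?thesis unfolding eqs by linarith
  qed
  ultimately show ?thesis using assms unfolding markov12_def by simp
qed

text \<open>The comparison of the two tails at a boundary 1 1 2 2, spelled out at the first
  differing digit. Boundaries 2 1 are reached by applying the condition to the reversed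
  sequence.\<close>

definition alternating_condition :: "(int \<Rightarrow> nat) \<Rightarrow> bool" where
  "alternating_condition a \<longleftrightarrow> (\<forall>i. a i = 1 \<or> a i = 2) \<and>
     (\<forall>k. a (k - 1) = 1 \<longrightarrow> a k = 2 \<longrightarrow> a (k - 2) = 1 \<and> a (k + 1) = 2 \<and>
       (\<forall>n. (\<forall>i<n. a (k - 3 - int i) = a (k + 2 + int i)) \<longrightarrow>
         (if even n then a (k + 2 + int n) \<le> a (k - 3 - int n)
          else a (k - 3 - int n) \<le> a (k + 2 + int n))))"

lemma markov12_alternating:
  assumes "markov12 a"
  shows "alternating_condition a"
  unfolding alternating_condition_def
proof (intro conjI allI impI)
  have d: "a i = 1 \<or> a i = 2" for i using assms unfolding markov12_def by blast
  then show "a i = 1 \<or> a i = 2" for i .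
  fix k assume k: "a (k - 1) = 1" "a k = 2"
  show "a (k - 2) = 1" "a (k + 1) = 2" using markov12_boundary[OF assms k] by auto
  fix n assume n: "\<forall>i<n. a (k - 3 - int i) = a (k + 2 + int i)"
  have "\<not> cfval (right_tail a (k + 2)) < cfval (left_tail a (k - 3))"
    using markov12_boundary(3)[OF assms k] by simp
  moreover have "cfval (right_tail a (k + 2)) < cfval (left_tail a (k - 3))"
    if "if even n then a (k - 3 - int n) < a (k + 2 + int n) else a (k + 2 + int n) < a (k - 3 - int n)"
    using cfval12_less[OF digits12_tails[of a, OF d], of n "k + 2" "k - 3"] n that
    unfolding right_tail_def left_tail_def by simp
  ultimately show "if even n then a (k + 2 + int n) \<le> a (k - 3 - int n)
          else a (k - 3 - int n) \<le> a (k + 2 + int n)"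
    by (metis linorder_not_le)
qed

text \<open>Reversal turns a boundary 1 2 into 2 1 and exchanging the digits turns it back. The
  tails trade places while the order of the digits is inverted, so every inequality reproduces
  itself. Facts about runs of ones thus carry over to runs of twos.\<close>

lemma alternating_condition_swap_reflect:
  assumes "alternating_condition a"
  shows "alternating_condition (\<lambda>i. 3 - a (- i))"
  unfolding alternating_condition_def
proof (intro conjI allI impI)
  have d: "a i = 1 \<or> a i = 2" for i using assms unfolding alternating_condition_def by blast
  show "3 - a (- i) = 1 \<or> 3 - a (- i) = 2" for i using d[of "- i"] by arith
  have flip: "3 - a i \<le> 3 - a j \<longleftrightarrow> a j \<le> a i" "3 - a i = 3 - a j \<longleftrightarrow> a i = a j" for i j
    using d[of i] d[of j] by auto
  fix k assume k: "3 - a (- (k - 1)) = 1" "3 - a (- k) = 2"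
  define K where "K = 1 - k"
  have K: "a (K - 1) = 1" "a K = 2" using k d[of "- k"] d[of "1 - k"] unfolding K_def by auto
  note A = assms[unfolded alternating_condition_def, THEN conjunct2, rule_format, OF K]
  have neg: "- (k - 2) = K + 1" "- (k + 1) = K - 2" "- (k - 3 - int i) = K + 2 + int i"
    "- (k + 2 + int i) = K - 3 - int i" for i
    unfolding K_def by auto
  show "3 - a (- (k - 2)) = 1" "3 - a (- (k + 1)) = 2" unfolding neg using A by auto
  fix n assume n: "\<forall>i<n. 3 - a (- (k - 3 - int i)) = 3 - a (- (k + 2 + int i))"
  then have "\<And>i. i < n \<Longrightarrow> a (K - 3 - int i) = a (K + 2 + int i)" unfolding neg flip by simp
  then show "if even n then 3 - a (- (k + 2 + int n)) \<le> 3 - a (- (k - 3 - int n))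
       else 3 - a (- (k - 3 - int n)) \<le> 3 - a (- (k + 2 + int n))"
    unfolding neg flip using A by blast
qed

text \<open>An odd run of ones forces a strictly shorter odd run of ones right after it.\<close>
lemma no_odd_run_of_ones:
  assumes "alternating_condition a"
    and "odd l" "a p = 2" "a (p + int l + 1) = 2" "\<And>i. p < i \<Longrightarrow> i \<le> p + int l \<Longrightarrow> a i = 1"
  shows False
  using assms(2-)
proof (induction l arbitrary: p rule: less_induct)
  case (less l)
  have d: "a i = 1 \<or> a i = 2" for i using assms unfolding alternating_condition_def by blast
  define k where "k = p + int l + 1"
  have "l \<noteq> 0" using less.prems(1) by (metis even_zero)
  have k: "a (k - 1) = 1" "a k = 2" using less.prems \<open>l \<noteq> 0\<close> unfolding k_def by auto
  note A = assms(1)[unfolded alternating_condition_def, THEN conjunct2, rule_format, OF k]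
  have "l \<noteq> 1"
  proof
    assume "l = 1"
    then have "a (k - 2) = 2" using less.prems(2) unfolding k_def by simp
    then show False using A by simp
  qed
  then have l3: "3 \<le> l" using less.prems(1) \<open>l \<noteq> 0\<close> by (cases "l = 2") auto
  \<comment> \<open>The left tail consists of ones up to the 2 at p, which has the odd index l - 2;
    the search stops there at the latest.\<close>
  define Q where "Q = (\<lambda>j. a (k + 2 + int j) = 2 \<or> j = l - 2)"
  define j where "j = (LEAST j. Q j)"
  have "Q (l - 2)" unfolding Q_def by simp
  then have Qj: "Q j" and jl: "j \<le> l - 2" unfolding j_def by (rule LeastI, rule Least_le)
  have before: "a (k + 2 + int i) = 1 \<and> i < l - 2" if "i < j" for i
    using not_less_Least[of i Q] that d[of "k + 2 + int i"] jl unfolding Q_def j_def by auto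
  have left: "a (k - 3 - int i) = 1" if "i < l - 2" for i
    using that less.prems(4) l3 unfolding k_def by auto
  have cond: "if even j then a (k + 2 + int j) \<le> a (k - 3 - int j)
      else a (k - 3 - int j) \<le> a (k + 2 + int j)"
    using A before left by simp
  \<comment> \<open>A 2 on the right against a 1 on the left is allowed at odd indices only, and at
    the odd index l - 2 the 2 at p forces a 2 on the right.\<close>
  have "odd j \<and> a (k + 2 + int j) = 2"
  proof (cases "j = l - 2")
    case True
    then have "odd j" using less.prems(1) l3 by simp
    moreover have "k - 3 - int j = p" using True l3 unfolding k_def by (simp add: of_nat_diff)
    ultimately show ?thesis using cond less.prems(2) d[of "k + 2 + int j"] by auto
  next
    case False
    then have "a (k + 2 + int j) = 2" "a (k - 3 - int j) = 1"
      using Qj left[of j] jl unfolding Q_def by auto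
    then show ?thesis using cond by (auto split: if_splits)
  qed
  moreover have "a i = 1" if i: "k + 1 < i" "i \<le> (k + 1) + int j" for i
  proof -
    have "i = k + 2 + int (nat (i - k - 2))" "nat (i - k - 2) < j" using i by auto
    then show ?thesis using before by metis
  qed
  moreover have "k + 1 + int j + 1 = k + 2 + int j" by simp
  moreover have "j < l" using jl l3 by linarith
  ultimately show False using less.IH[of j "k + 1"] A by metis
qed

text \<open>Intermediate changes split the distance into shorter ones; without any, the digits in
  between form a single run, which cannot be odd.\<close>

lemma changes_same_parity:
  assumes a: "alternating_condition a" "a (k - 1) \<noteq> a k" "a (k + int n - 1) \<noteq> a (k + int n)"
  shows "even n"
  using assms(2-)
proof (induction n arbitrary: k rule: less_induct)
  case (less n)
  have d: "a i = 1 \<or> a i = 2" for i using a unfolding alternating_condition_def by blast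
  show ?case
  proof (cases "\<exists>m. 0 < m \<and> m < n \<and> a (k + int m - 1) \<noteq> a (k + int m)")
    case True
    then obtain m where m: "0 < m" "m < n" "a (k + int m - 1) \<noteq> a (k + int m)" by blast
    have "even m" using less.IH[of m k] less.prems m by blast
    moreover have "even (n - m)" using less.IH[of "n - m" "k + int m"] less.prems m by (simp add: of_nat_diff)
    ultimately show ?thesis using m(2) by (metis dvd_add le_add_diff_inverse less_imp_le)
  next
    case False
    have const: "a (k + int m) = a k" if "m < n" for m
      using that
    proof (induction m)
      case (Suc m)
      then show ?case using False by (auto simp: algebra_simps dest: spec[of _ "Suc m"])
    qed simp
    show ?thesis
    proof (rule ccontr)
      assume "odd n"
      then have "n \<noteq> 0" by (metis even_zero)
      have run: "a i = a k" if "k - 1 < i" "i \<le> k - 1 + int n" for i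
        using const[of "nat (i - k)"] that by auto
      have last: "a (k + int n - 1) = a k" using run[of "k + int n - 1"] \<open>n \<noteq> 0\<close> by simp
      show False
      proof (cases "a k = 1")
        case True
        then show False
          using no_odd_run_of_ones[OF a(1) \<open>odd n\<close>, of "k - 1"] less.prems run last
            d[of "k - 1"] d[of "k + int n"] by auto
      next
        case False
        then have k2: "a k = 2" using d by blast
        let ?b = "\<lambda>i. 3 - a (- i)"
        have "a (k - 1) = 1" "a (int n + k) = 1"
          using less.prems last k2 d[of "k - 1"] d[of "k + int n"] by (auto simp: add.commute)
        moreover have "- (- (k + int n) + int n + 1) = k - 1" by simp
        moreover have "3 - a (- i) = 1" if "- (k + int n) < i" "i \<le> - (k + int n) + int n" for i
          using run[of "- i"] that k2 by simp
        ultimately show False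
          by (intro no_odd_run_of_ones[OF alternating_condition_swap_reflect[OF a(1)] \<open>odd n\<close>,
              of "- (k + int n)"]) simp_all
      qed
    qed
  qed
qed

text \<open>All digit changes have the same parity, and this fixes the phase q of the pairing 22 ->
  0, 11 -> 1. A first difference of blocks at n is one of digits at the even index 2 n, where the
  order of digits is opposite to that of letters.\<close>

lemma markov12_blocks:
  assumes "markov12 a"
  obtains q :: int and s :: "int \<Rightarrow> int"
  where "q = 0 \<or> q = 1" "\<And>i. s i = 0 \<or> s i = 1" "markoff s"
    "\<And>i. a (2 * i + q) = nat (2 - s i)" "\<And>i. a (2 * i + q + 1) = nat (2 - s i)"
proof -
  have alt: "alternating_condition a" by (rule markov12_alternating[OF assms])
  have altr: "alternating_condition (\<lambda>i. a (0 - i))"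
    by (rule markov12_alternating[OF markov12_reflect[OF assms]])
  have d: "a i = 1 \<or> a i = 2" for i using alt unfolding alternating_condition_def by blast
  have par: "even (k' - k)" if "a (k - 1) \<noteq> a k" "a (k' - 1) \<noteq> a k'" for k k'
  proof (cases "k \<le> k'")
    case True
    then show ?thesis using changes_same_parity[OF alt that(1), of "nat (k' - k)"] that(2)
      by (simp add: even_nat_iff)
  next
    case False
    then have "even (k - k')" using changes_same_parity[OF alt that(2), of "nat (k - k')"] that(1)
      by (simp add: even_nat_iff)
    then show ?thesis by (metis dvd_minus_iff minus_diff_eq)
  qed
  have "\<exists>q. (q = 0 \<or> q = 1) \<and> (\<forall>i. a (2 * i + q) = a (2 * i + q + 1))"
  proof (cases "\<exists>k. a (k - 1) \<noteq> a k")
    case True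
    then obtain k where k: "a (k - 1) \<noteq> a k" by blast
    have "a (2 * i + k mod 2) = a (2 * i + k mod 2 + 1)" for i
    proof (rule ccontr)
      assume "a (2 * i + k mod 2) \<noteq> a (2 * i + k mod 2 + 1)"
      then have "even ((2 * i + k mod 2 + 1) - k)" using par[OF k, of "2 * i + k mod 2 + 1"] by simp
      then show False by presburger
    qed
    moreover have "k mod 2 = 0 \<or> k mod 2 = 1" by presburger
    ultimately show ?thesis by (intro exI[of _ "k mod 2"]) simp
  next
    case False
    then have "a (2 * i + 0) = a (2 * i + 0 + 1)" for i by (metis add_diff_cancel_right')
    then show ?thesis by (intro exI[of _ 0]) simp
  qed
  then obtain q where q: "q = 0 \<or> q = 1" "\<And>i. a (2 * i + q) = a (2 * i + q + 1)" by blast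
  define s where "s = (\<lambda>i. 2 - int (a (2 * i + q)))"
  have s01: "s i = 0 \<or> s i = 1" for i using d[of "2 * i + q"] unfolding s_def by auto
  have a_s: "a (2 * i + q) = nat (2 - s i)" "a (2 * i + q + 1) = nat (2 - s i)" for i
    using q(2)[of i] unfolding s_def by auto
  have as1: "a j = nat (2 - s i)" if "j = 2 * i + q \<or> j = 2 * i + q + 1" for i j
    using a_s that by blast
  have digit_eq: "a (2 * k + q + 2 + int i) = a (2 * k + q - 3 - int i)"
    if "\<forall>i<n. s (k + 1 + int i) = s (k - 2 - int i)" "i < 2 * n" for k n i
  proof -
    have i2: "i div 2 < n" using that(2) by auto
    have "a (2 * k + q + 2 + int i) = nat (2 - s (k + 1 + int (i div 2)))"
      by (rule as1) presburger
    moreover have "a (2 * k + q - 3 - int i) = nat (2 - s (k - 2 - int (i div 2)))"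
      by (rule as1) presburger
    ultimately show ?thesis using that(1) i2 by simp
  qed
  have ends: "a (2 * k + q + 2 + int (2 * n)) = nat (2 - s (k + 1 + int n))"
    "a (2 * k + q - 3 - int (2 * n)) = nat (2 - s (k - 2 - int n))" for k n
    by (rule as1; simp)+
  have "markoff s"
    unfolding markoff_def
  proof (intro conjI allI impI)
    fix k n assume k: "s (k - 1) = 1" "s k = 0" and n: "\<forall>i<n. s (k + 1 + int i) = s (k - 2 - int i)"
    let ?K = "2 * k + q"
    have "a (?K - 1) = 1" "a ?K = 2" using as1[of "?K - 1" "k - 1"] as1[of "?K" k] k by auto
    note A = alt[unfolded alternating_condition_def, THEN conjunct2, rule_format, OF this]
    have "a (?K + 2 + int (2 * n)) \<le> a (?K - 3 - int (2 * n))"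
    proof -
      have "\<forall>i<2 * n. a (?K - 3 - int i) = a (?K + 2 + int i)" using digit_eq[OF n] by simp
      then have "if even (2 * n) then a (?K + 2 + int (2 * n)) \<le> a (?K - 3 - int (2 * n))
          else a (?K - 3 - int (2 * n)) \<le> a (?K + 2 + int (2 * n))" using A by blast
      then show ?thesis by simp
    qed
    then show "s (k - 2 - int n) \<le> s (k + 1 + int n)"
      unfolding ends[of k n] using s01[of "k - 2 - int n"] s01[of "k + 1 + int n"] by auto
  next
    fix k n assume k: "s (k - 1) = 0" "s k = 1" and n: "\<forall>i<n. s (k + 1 + int i) = s (k - 2 - int i)"
    let ?K = "2 * k + q"
    \<comment> \<open>A block boundary 0 1 is a digit boundary 2 1; in the reversed sequence it
      becomes the boundary 1 2 at 1 - ?K.\<close>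
    have idx: "0 - ((1 - ?K) - 1) = ?K" "0 - (1 - ?K) = ?K - 1" by auto
    have "a (0 - ((1 - ?K) - 1)) = 1" "a (0 - (1 - ?K)) = 2"
      unfolding idx using as1[of "?K - 1" "k - 1"] as1[of "?K" k] k by auto
    note A = altr[unfolded alternating_condition_def, THEN conjunct2, rule_format, OF this]
    have neg: "0 - (1 - ?K + 2 + int i) = ?K - 3 - int i" "0 - (1 - ?K - 3 - int i) = ?K + 2 + int i" for i
      by auto
    have "a (?K - 3 - int (2 * n)) \<le> a (?K + 2 + int (2 * n))"
    proof -
      have "\<forall>i<2 * n. a (?K + 2 + int i) = a (?K - 3 - int i)" using digit_eq[OF n] by simp
      then have "if even (2 * n) then a (?K - 3 - int (2 * n)) \<le> a (?K + 2 + int (2 * n))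
          else a (?K + 2 + int (2 * n)) \<le> a (?K - 3 - int (2 * n))" using A unfolding neg by blast
      then show ?thesis by simp
    qed
    then show "s (k + 1 + int n) \<le> s (k - 2 - int n)"
      unfolding ends[of k n] using s01[of "k - 2 - int n"] s01[of "k + 1 + int n"] by auto
  qed
  then show thesis using that q(1) s01 a_s by blast
qed

lemma exists_primitive:
  fixes s :: "int \<Rightarrow> int"
  obtains h where "\<And>i. h (i + 1) - h i = s i"
proof
  define h where "h = (\<lambda>i. if 0 \<le> i then (\<Sum>j<nat i. s (int j)) else - (\<Sum>j<nat (- i). s (- 1 - int j)))"
  show "h (i + 1) - h i = s i" for i
  proof (cases "0 \<le> i")
    case True
    then have "nat (i + 1) = Suc (nat i)" by simp
    then show ?thesis using True unfolding h_def by simp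
  next
    case False
    then have "nat (- i) = Suc (nat (- (i + 1)))" by simp
    then show ?thesis using False unfolding h_def by auto
  qed
qed

text \<open>Every letter of the word is written twice; \<open>r = 1\<close> starts in the middle of
  block 0.\<close>

definition word_digits :: "nat \<Rightarrow> (int \<Rightarrow> int) \<Rightarrow> nat \<Rightarrow> nat" where
  "word_digits r h = (\<lambda>i. nat (2 - (h (int ((i + r) div 2) + 1) - h (int ((i + r) div 2)))))"

lemma digits12_word_digits:
  assumes "\<And>i. h (i + 1) - h i = 0 \<or> h (i + 1) - h i = 1"
  shows "digits12 (word_digits r h)"
proof -
  have "nat (2 - t) = 1 \<or> nat (2 - t) = 2" if "t = 0 \<or> t = 1" for t using that by auto
  then show ?thesis unfolding digits12_def word_digits_def using assms by blast
qed

lemma K3_balanced: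
  assumes "x \<in> K3"
  obtains q :: nat and h :: "int \<Rightarrow> int"
  where "q = 0 \<or> q = 1" "\<And>i. h (i + 1) - h i = 0 \<or> h (i + 1) - h i = 1" "balanced h" "h 0 = 0"
    "x = cfval (word_digits q h)"
proof -
  obtain a where a: "markov12 a" "x = cfval (right_tail a 1)" using assms unfolding K3_iff by blast
  obtain q s where q: "q = 0 \<or> q = 1" and s: "\<And>i. s i = 0 \<or> s i = 1" "markoff s"
    "\<And>i. a (2 * i + q) = nat (2 - s i)" "\<And>i. a (2 * i + q + 1) = nat (2 - s i)"
    using markov12_blocks[OF a(1)] by metis
  obtain h0 where h0: "\<And>i. h0 (i + 1) - h0 i = s i" using exists_primitive by blast
  have bal: "balanced h0" using markoff_imp_balanced[of h0] s(1,2) unfolding h0 by blast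
  \<comment> \<open>The point starts at digit 1, not 0, and digit 1 + i lies in block (i + Q) div
    2.\<close>
  define Q where "Q = nat (1 - q)"
  have Q: "Q = 0 \<or> Q = 1" "q = 1 - int Q" using q unfolding Q_def by auto
  define h where "h = (\<lambda>i. h0 i - h0 0)"
  have hs: "h (i + 1) - h i = s i" for i unfolding h_def using h0[of i] by simp
  have "right_tail a 1 = (\<lambda>i. nat (2 - s (int ((i + Q) div 2))))"
  proof
    fix i
    have "1 + int i = 2 * int ((i + Q) div 2) + q \<or> 1 + int i = 2 * int ((i + Q) div 2) + q + 1"
      using Q by presburger
    then show "right_tail a 1 i = nat (2 - s (int ((i + Q) div 2)))"
      unfolding right_tail_def using s(3,4) by metis
  qed
  then have "x = cfval (word_digits Q h)" unfolding word_digits_def hs a(2) by simp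
  moreover have "balanced h" using bal unfolding balanced_def h_def by simp
  moreover have "h 0 = 0" unfolding h_def by simp
  ultimately show thesis using that[of Q h] Q(1) s(1) unfolding hs by blast
qed

text \<open>The converse direction needs only that balanced words avoid the factors \<open>b w\<^sup>R b a w a\<close>.\<close>
lemma balanced_markov_at_block_start:
  fixes h :: "int \<Rightarrow> int"
  assumes s01: "\<And>i. h (i + 1) - h i = 0 \<or> h (i + 1) - h i = 1"
    and bal: "balanced h"
    and a: "\<And>k. a k = nat (2 - (h ((k - 1) div 2 + 1) - h ((k - 1) div 2)))"
    and k: "k = 2 * i + 1" "a k = 2"
  shows "2 + cfval (right_tail a (k + 1)) + cfval (left_tail a (k - 1)) \<le> 3"
proof -
  define s where "s = (\<lambda>i. h (i + 1) - h i)"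
  have as: "a j = nat (2 - s m)" if "j = 2 * m + 1 \<or> j = 2 * m + 2" for j m
  proof -
    have "(j - 1) div 2 = m" using that by auto
    then show ?thesis unfolding a s_def by simp
  qed
  have s01': "s m = 0 \<or> s m = 1" for m using s01 unfolding s_def by blast
  have d: "a j = 1 \<or> a j = 2" for j using s01[of "(j - 1) div 2"] unfolding a by auto
  note R = cfval_right_tail[of a, OF d] and L = cfval_left_tail[of a, OF d]
  note Rb = cfval12_bounds[OF digits12_tails(1)[of a, OF d]]
    and Lb = cfval12_bounds[OF digits12_tails(2)[of a, OF d]]
  have si: "s i = 0" using as[of k i] k s01'[of i] by auto
  have "a (k + 1) = 2" using as[of "k + 1" i] k si by auto
  then have R1: "cfval (right_tail a (k + 1)) = 1 / (2 + cfval (right_tail a (k + 2)))"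
    using R[of "k + 1"] by (simp add: add.assoc)
  have L1: "cfval (left_tail a (k - 1)) = 1 / (real (a (k - 1)) + cfval (left_tail a (k - 2)))"
    using L[of "k - 1"] by simp
  show ?thesis
  proof (cases "a (k - 1) = 2")
    case True
    have "1 / (2 + cfval (right_tail a (k + 2))) \<le> 1 / 2" "1 / (2 + cfval (left_tail a (k - 2))) \<le> 1 / 2"
      using Rb[of "k + 2"] Lb[of "k - 2"] by (intro frac_le; simp)+
    then show ?thesis using R1 L1 True by simp
  next
    case False
    have si1: "s (i - 1) = 1" using as[of "k - 1" "i - 1"] False k s01'[of "i - 1"] by auto
    have "a (k - 1) = 1" "a (k - 2) = 1"
      using as[of "k - 1" "i - 1"] as[of "k - 2" "i - 1"] si1 k by auto
    then have L2: "cfval (left_tail a (k - 1)) = 1 / (1 + 1 / (1 + cfval (left_tail a (k - 3))))"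
      using L1 L[of "k - 2"] by simp
    have asR: "right_tail a (k + 2) j = nat (2 - s (i + 1 + int (j div 2)))" for j
      unfolding right_tail_def k(1) by (rule as) presburger
    have asL: "left_tail a (k - 3) j = nat (2 - s (i - 2 - int (j div 2)))" for j
      unfolding left_tail_def k(1) by (rule as) presburger
    have "cfval (left_tail a (k - 3)) \<le> cfval (right_tail a (k + 2))"
    proof (cases "\<exists>m. s (i + 1 + int m) \<noteq> s (i - 2 - int m)")
      case False
      then have "left_tail a (k - 3) = right_tail a (k + 2)" by (auto simp: asR asL)
      then show ?thesis by simp
    next
      case True
      define m where "m = (LEAST m. s (i + 1 + int m) \<noteq> s (i - 2 - int m))"
      have m: "s (i + 1 + int m) \<noteq> s (i - 2 - int m)"
        unfolding m_def using True by (rule LeastI_ex)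
      have before: "s (i + 1 + int j) = s (i - 2 - int j)" if "j < m" for j
        using not_less_Least that unfolding m_def by blast
      have sum: "h (i + 1 + int j) - h (i + 1) = h (i - 1) - h (i - 1 - int j)" if "j \<le> m" for j
        using that
      proof (induction j)
        case (Suc j)
        have "h (i + 1 + int (Suc j)) - h (i + 1 + int j) = s (i + 1 + int j)"
          unfolding s_def by (simp add: algebra_simps)
        moreover have "h (i - 1 - int j) - h (i - 1 - int (Suc j)) = s (i - 2 - int j)"
          unfolding s_def by (simp add: algebra_simps)
        ultimately show ?case using Suc before[of j] by simp
      qed simp
      \<comment> \<open>Otherwise the m + 2 letters before i form 1 w^R 1 and the m + 2 letters from
        i on form 0 w 0, so their numbers of ones differ by 2.\<close>
      have "\<not> (s (i + 1 + int m) = 0 \<and> s (i - 2 - int m) = 1)"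
      proof
        assume *: "s (i + 1 + int m) = 0 \<and> s (i - 2 - int m) = 1"
        have 1: "h (i + 2 + int m) - h (i + 1 + int m) = 0" using * unfolding s_def by (simp add: algebra_simps)
        have 2: "h (i - 1 - int m) - h (i - 2 - int m) = 1" using * unfolding s_def by (simp add: algebra_simps)
        have 3: "h i - h (i - 1) = 1" "h (i + 1) - h i = 0" using si si1 unfolding s_def by auto
        have eqs: "i - 2 - int m + int (m + 2) = i" "i + int (m + 2) = i + 2 + int m" by auto
        have "h (i - 2 - int m + int (m + 2)) - h (i - 2 - int m) \<le> h (i + int (m + 2)) - h i + 1"
          by (rule balancedD[OF bal])
        then have "h i - h (i - 2 - int m) \<le> h (i + 2 + int m) - h i + 1" unfolding eqs .
        then show False using 1 2 3 sum[of m] by linarith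
      qed
      then have sm: "s (i + 1 + int m) = 1" "s (i - 2 - int m) = 0"
        using m s01'[of "i + 1 + int m"] s01'[of "i - 2 - int m"] by auto
      have "cfval (left_tail a (k - 3)) < cfval (right_tail a (k + 2))"
      proof (rule cfval12_less[of _ _ "2 * m"])
        show "digits12 (left_tail a (k - 3))" "digits12 (right_tail a (k + 2))"
          using digits12_tails[of a, OF d] by auto
        show "left_tail a (k - 3) j = right_tail a (k + 2) j" if "j < 2 * m" for j
          using before[of "j div 2"] that unfolding asL asR by auto
        show "if even (2 * m) then right_tail a (k + 2) (2 * m) < left_tail a (k - 3) (2 * m)
           else left_tail a (k - 3) (2 * m) < right_tail a (k + 2) (2 * m)"
          unfolding asL asR using sm by simp
      qed
      then show ?thesis by simp
    qed
    then show ?thesis unfolding R1 L2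
      using Lb[of "k - 3"] Rb[of "k + 2"] by (subst markov_inequality_iff) auto
  qed
qed

text \<open>A digit 1 gives at most 1 + 3/4 + 3/4. A digit 2 opening its block is handled by
  \<open>balanced_markov_at_block_start\<close>, and one closing its block becomes an opening one
  when the word is reversed.\<close>

lemma balanced_imp_markov12:
  fixes h :: "int \<Rightarrow> int"
  assumes s01: "\<And>i. h (i + 1) - h i = 0 \<or> h (i + 1) - h i = 1"
    and bal: "balanced h"
    and a: "\<And>k. a k = nat (2 - (h ((k - 1) div 2 + 1) - h ((k - 1) div 2)))"
  shows "markov12 a"
  unfolding markov12_def
proof (intro conjI allI)
  show d: "a j = 1 \<or> a j = 2" for j using s01[of "(j - 1) div 2"] unfolding a by auto
  fix k
  show "real (a k) + cfval (right_tail a (k + 1)) + cfval (left_tail a (k - 1)) \<le> 3"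
  proof (cases "a k = 1")
    case True
    then show ?thesis
      using cfval12_bounds(2)[OF digits12_tails(1)[of a "k + 1", OF d]]
        cfval12_bounds(2)[OF digits12_tails(2)[of a "k - 1", OF d]] by simp
  next
    case False
    then have k2: "a k = 2" using d[of k] by blast
    show ?thesis
    proof (cases "odd k")
      case True
      then obtain i where "k = 2 * i + 1" by (elim oddE)
      then show ?thesis using balanced_markov_at_block_start[OF s01 bal a] k2 by simp
    next
      case False
      define h' where "h' = (\<lambda>i. - h (- i))"
      define a' where "a' = (\<lambda>j. a (1 - j))"
      have s': "h' (i + 1) - h' i = h (- i - 1 + 1) - h (- i - 1)" for i
      proof -
        have "- (i + 1) = - i - 1" "- i - 1 + 1 = - i" by auto
        then show ?thesis unfolding h'_def by (simp only:)
      qed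
      have "balanced h'"
        unfolding balanced_def
      proof (intro allI)
        fix i j n
        show "h' (i + int n) - h' i \<le> h' (j + int n) - h' j + 1"
          using balancedD[OF bal, of "- i - int n" n "- j - int n"] unfolding h'_def
          by (simp add: algebra_simps)
      qed
      moreover have "a' k = nat (2 - (h' ((k - 1) div 2 + 1) - h' ((k - 1) div 2)))" for k
      proof -
        have "- ((k - 1) div 2) - 1 = (1 - k - 1) div 2" by presburger
        then show ?thesis unfolding s' a'_def a by simp
      qed
      moreover have "1 - k = 2 * (- k div 2) + 1" using False by presburger
      moreover have "a' (1 - k) = 2" unfolding a'_def using k2 by simp
      moreover have "h' (i + 1) - h' i = 0 \<or> h' (i + 1) - h' i = 1" for i
        unfolding s' by (rule s01)
      ultimately have "2 + cfval (right_tail a' (1 - k + 1)) + cfval (left_tail a' (1 - k - 1)) \<le> 3"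
        using balanced_markov_at_block_start[of h' a' "1 - k" "- k div 2"] by blast
      moreover have "right_tail a' (1 - k + 1) = left_tail a (k - 1)"
        "left_tail a' (1 - k - 1) = right_tail a (k + 1)"
        unfolding right_tail_def left_tail_def a'_def by (auto simp: algebra_simps)
      ultimately show ?thesis using k2 by simp
    qed
  qed
qed

section \<open>Balanced words with a slope near a given fraction\<close>

text \<open>Cutting a factor of length m n into m pieces of length n, or into n pieces of length m,
  shows that every (W m i - 1)/m is at most every (W n j + 1)/n. The slope is a number separating
  these two families.\<close>

lemma balanced_slope:
  fixes h :: "int \<Rightarrow> int"
  assumes s01: "\<And>i. h (i + 1) - h i = 0 \<or> h (i + 1) - h i = 1" and bal: "balanced h"
  obtains \<alpha> :: real where "0 \<le> \<alpha>" "\<alpha> \<le> 1"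
    "\<And>i n. \<bar>real_of_int (h (i + int n) - h i) - real n * \<alpha>\<bar> \<le> 1"
proof -
  define W where "W = (\<lambda>n i. real_of_int (h (i + int n) - h i))"
  have W_le: "W n i \<le> W n j + 1" for n i j
    using balancedD[OF bal, of i n j] unfolding W_def by linarith
  have W_sum: "W (m * n) i = (\<Sum>k<m. W n (i + int (k * n)))" for m n i
  proof (induction m)
    case (Suc m)
    have eq: "i + int (Suc m * n) = i + int (m * n) + int n" by simp
    have "W (Suc m * n) i = W (m * n) i + W n (i + int (m * n))" unfolding W_def eq by simp
    then show ?case using Suc by simp
  qed (simp add: W_def)
  have upper: "W (m * n) i \<le> real m * (W n j + 1)" for m n i j
    unfolding W_sum using sum_bounded_above[of "{..<m}" "\<lambda>k. W n (i + int (k * n))" "W n j + 1"] W_le by simp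
  have lower: "real m * (W n j - 1) \<le> W (m * n) i" for m n i j
  proof -
    have "W n j - 1 \<le> W n k" for k using W_le[of n j k] by simp
    then show ?thesis
      unfolding W_sum using sum_bounded_below[of "{..<m}" "W n j - 1" "\<lambda>k. W n (i + int (k * n))"] by simp
  qed
  have compare: "(W m i - 1) / real m \<le> (W n j + 1) / real n" if "m > 0" "n > 0" for m n i j
  proof -
    have "real n * (W m i - 1) \<le> real m * (W n j + 1)"
      using lower[of n m i 0] upper[of m n 0 j] by (simp add: mult.commute)
    then show ?thesis using that by (simp add: field_simps)
  qed
  define S where "S = {(W m i - 1) / real m | m i. m > 0}"
  define \<alpha> where "\<alpha> = Sup S"
  have ne: "S \<noteq> {}" unfolding S_def by blast
  have bdd: "bdd_above S" unfolding S_def using compare[of _ 1] by (intro bdd_aboveI[of _ "(W 1 0 + 1) / real 1"]) auto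
  have lo: "(W m i - 1) / real m \<le> \<alpha>" if "m > 0" for m i
    unfolding \<alpha>_def using that by (intro cSup_upper bdd) (auto simp: S_def)
  have hi: "\<alpha> \<le> (W n j + 1) / real n" if "n > 0" for n j
    unfolding \<alpha>_def using compare that by (intro cSup_least ne) (auto simp: S_def)
  have slope: "\<bar>W n i - real n * \<alpha>\<bar> \<le> 1" for n i
  proof (cases "n = 0")
    case True
    then show ?thesis unfolding W_def by simp
  next
    case False
    then show ?thesis using lo[of n i] hi[of n i] by (simp add: field_simps abs_le_iff)
  qed
  have W01: "0 \<le> W n 0 \<and> W n 0 \<le> real n" for n
  proof (induction n)
    case (Suc n)
    have "W (Suc n) 0 = W n 0 + real_of_int (h (int n + 1) - h (int n))"
      unfolding W_def by (simp add: add.commute)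
    then show ?case using s01[of "int n"] Suc by auto
  qed (simp add: W_def)
  have "0 \<le> \<alpha>"
  proof (rule ccontr)
    assume "\<not> 0 \<le> \<alpha>"
    then have "0 < - \<alpha>" by simp
    then obtain n where n: "real n * (- \<alpha>) > 1" using reals_Archimedean3 by blast
    then show False using slope[of n 0] W01[of n] by (simp add: abs_le_iff)
  qed
  moreover have "\<alpha> \<le> 1"
  proof (rule ccontr)
    assume "\<not> \<alpha> \<le> 1"
    then have "0 < \<alpha> - 1" by simp
    then obtain n where n: "real n * (\<alpha> - 1) > 1" using reals_Archimedean3 by blast
    then show False using slope[of n 0] W01[of n] by (simp add: abs_le_iff algebra_simps)
  qed
  ultimately show thesis using that slope unfolding W_def by blast
qed

text \<open>Successive changes of a truth value alternate in direction, so if a rise and a fall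
  cannot both occur there is at most one change. The value u = K + 1 stands for none.\<close>

lemma one_change_threshold:
  fixes f :: "nat \<Rightarrow> bool"
  assumes "\<And>t t'. t < K \<Longrightarrow> t' < K \<Longrightarrow> f t \<Longrightarrow> \<not> f (Suc t) \<Longrightarrow> \<not> f t' \<Longrightarrow> f (Suc t') \<Longrightarrow> False"
  obtains u b where "u \<le> K + 1" "\<And>t. t \<le> K \<Longrightarrow> f t \<longleftrightarrow> ((t < u) = b)"
proof -
  define Q where "Q = (\<lambda>t. t = K + 1 \<or> f t \<noteq> f 0)"
  define u where "u = (LEAST t. Q t)"
  have "Q (K + 1)" unfolding Q_def by simp
  then have Qu: "Q u" and uK: "u \<le> K + 1" unfolding u_def by (rule LeastI, rule Least_le)
  have before: "f t = f 0" if "t < u" for t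
    using not_less_Least[of t Q] that unfolding Q_def u_def by blast
  have after: "f t \<noteq> f 0" if "u \<le> t" "t \<le> K" for t
    using that
  proof (induction t rule: dec_induct)
    case base
    then show ?case using Qu unfolding Q_def by auto
  next
    case (step t)
    have u0: "f u \<noteq> f 0" using Qu step unfolding Q_def by auto
    then have "u \<noteq> 0" by metis
    then obtain w where w: "u = Suc w" by (cases u) auto
    have fw: "f w = f 0" using before[of w] unfolding w by blast
    have ft: "f t \<noteq> f 0" using step.IH step.prems by linarith
    have "t < K" "w < K" using step.prems step.hyps w by linarith+
    moreover have "f (Suc w) \<noteq> f 0" using u0 unfolding w .
    ultimately show ?case using assms[of w t] assms[of t w] fw ft by metis
  qed
  have "f t \<longleftrightarrow> ((t < u) = f 0)" if "t \<le> K" for t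
    using before[of t] after[of t] that by (cases "t < u") auto
  then show thesis using that uK by blast
qed

text \<open>The window for q h(i) - i p starts at -c, and r is the position in it known modulo q.
  Where r = 0 both ends are possible: \<open>u\<close> is the moment of the switch, counted in
  periods of length q, and \<open>b\<close> says whether the upper end comes first. For n >= q this
  makes O(n) codes.\<close>

definition coded_height :: "int \<Rightarrow> nat \<Rightarrow> nat \<Rightarrow> nat \<Rightarrow> bool \<Rightarrow> nat \<Rightarrow> int" where
  "coded_height p q c u b i =
     (let r = (int c - int i * p) mod int q in
      (r - int c + (if r = 0 \<and> (i div q < u) = b then int q else 0) + int i * p) div int q)"

text \<open>
  With slope close to \<open>p / q\<close> the integers \<open>q h(i) - i p\<close> stay in a window of length \<open>q\<close> and are
  known modulo \<open>q\<close>, so only those at the two ends of the window are ambiguous.  They occur along one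
  residue class of \<open>i\<close> modulo \<open>q\<close>, and by balance there is at most one switch between the ends.
\<close>
lemma balanced_coded:
  fixes h :: "int \<Rightarrow> int" and \<alpha> :: real
  assumes bal: "balanced h" and h0: "h 0 = 0"
    and slope: "\<And>i n. \<bar>real_of_int (h (i + int n) - h i) - real n * \<alpha>\<bar> \<le> 1"
    and q: "q > 0" "coprime p (int q)"
    and close: "real n * \<bar>real q * \<alpha> - real_of_int p\<bar> < 1"
  obtains c u b where "c \<le> q" "u \<le> n div q + 1" "\<And>i. i \<le> n \<Longrightarrow> h (int i) = coded_height p q c u b i"
proof -
  define z where "z = (\<lambda>i. int q * h (int i) - int i * p)"
  have zdiff: "\<bar>z j - z i\<bar> \<le> int q" if "i \<le> j" "j \<le> n" for i j
  proof -
    have "\<bar>real_of_int (h (int i + int (j - i)) - h (int i)) - real (j - i) * \<alpha>\<bar> \<le> 1" by (rule slope)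
    then have 1: "\<bar>real q * (real_of_int (h (int j) - h (int i)) - real (j - i) * \<alpha>)\<bar> \<le> real q"
      using that q(1) by (simp add: of_nat_diff abs_mult mult_left_le)
    have "real_of_int (z j - z i) = real q * (real_of_int (h (int j) - h (int i)) - real (j - i) * \<alpha>)
        + real (j - i) * (real q * \<alpha> - real_of_int p)"
      using that(1) unfolding z_def by (simp add: of_nat_diff algebra_simps)
    moreover have "\<bar>real (j - i) * (real q * \<alpha> - real_of_int p)\<bar> < 1"
    proof -
      have "real (j - i) * \<bar>real q * \<alpha> - real_of_int p\<bar> \<le> real n * \<bar>real q * \<alpha> - real_of_int p\<bar>"
        using that by (intro mult_right_mono) auto
      then show ?thesis using close by (simp add: abs_mult)
    qed
    \<comment> \<open>Balance around the slope allows q, the drift away from p/q adds less than 1,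
      and the difference is an integer.\<close>
    ultimately have "\<bar>real_of_int (z j - z i)\<bar> < real q + 1" using 1 by linarith
    then show ?thesis by linarith
  qed
  have z0: "z 0 = 0" unfolding z_def using h0 by simp
  define mn where "mn = Min (z ` {..n})"
  have mn_le: "mn \<le> z i" if "i \<le> n" for i unfolding mn_def using that by (intro Min_le) auto
  have "mn \<in> z ` {..n}" unfolding mn_def by (rule Min_in) auto
  then obtain i0 where i0: "i0 \<le> n" "mn = z i0" by auto
  have mn_ge: "z i \<le> mn + int q" if "i \<le> n" for i
    using zdiff[of i i0] zdiff[of i0 i] that i0 by (cases "i \<le> i0") auto
  define c where "c = nat (- mn)"
  have c: "int c = - mn" using mn_le[of 0] z0 unfolding c_def by simp
  have cq: "c \<le> q" using mn_ge[of 0] z0 c by simp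
  have zc: "0 \<le> z i + int c" "z i + int c \<le> int q" if "i \<le> n" for i
    using mn_le[OF that] mn_ge[OF that] c by auto
  define res where "res = (\<lambda>i. (int c - int i * p) mod int q)"
  have zres: "(z i + int c) mod int q = res i" for i
  proof -
    have "z i + int c = (int c - int i * p) + int q * h (int i)" unfolding z_def by simp
    then show ?thesis unfolding res_def by (simp only: mod_mult_self2)
  qed
  have generic: "z i + int c = res i" if "i \<le> n" "res i \<noteq> 0" for i
  proof -
    have "z i + int c \<noteq> int q" using zres[of i] that(2) by auto
    then have "(z i + int c) mod int q = z i + int c" using zc[OF that(1)] by (intro mod_pos_pos_trivial) auto
    then show ?thesis using zres[of i] by simp
  qed
  have ends: "z i + int c = 0 \<or> z i + int c = int q" if "i \<le> n" "res i = 0" for i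
  proof -
    have "int q dvd z i + int c" using zres[of i] that(2) by (simp add: dvd_eq_mod_eq_0)
    then obtain t where t: "z i + int c = int q * t" by (elim dvdE)
    then have "0 \<le> t" "t \<le> 1"
      using zc[OF that(1)] q(1) by (auto simp: zero_le_mult_iff mult_le_cancel_left1 split: if_splits)
    then have "t = 0 \<or> t = 1" by linarith
    then show ?thesis using t by auto
  qed
  have result: "h (int i) = coded_height p q c u b i"
    if "i \<le> n" "res i = 0 \<Longrightarrow> (z i + int c = int q) \<longleftrightarrow> ((i div q < u) = b)" for i u b
  proof -
    have "z i = res i - int c + (if res i = 0 \<and> (i div q < u) = b then int q else 0)"
    proof (cases "res i = 0")
      case True
      then show ?thesis using ends[OF that(1) True] that(2)[OF True] by auto
    next
      case False
      then show ?thesis using generic[OF that(1) False] by simp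
    qed
    moreover have "h (int i) = (z i + int i * p) div int q" unfolding z_def using q(1) by simp
    ultimately show ?thesis unfolding coded_height_def Let_def res_def by simp
  qed
  show thesis
  proof (cases "\<exists>i\<le>n. res i = 0")
    case False
    then show thesis using that[of c 0 True] cq result[of _ 0 True] by auto
  next
    case True
    then obtain i1 where i1: "i1 \<le> n" "res i1 = 0" by blast
    define r0 where "r0 = i1 mod q"
    have r0: "r0 < q" unfolding r0_def using q(1) by simp
    have "r0 \<le> n" unfolding r0_def using i1(1) mod_less_eq_dividend[of i1 q] by (rule order_trans[rotated])
    note r0 = r0 this
    have class_iff: "res i = 0 \<longleftrightarrow> i mod q = r0" for i
    proof -
      have "res i = 0 \<longleftrightarrow> res i = res i1" using i1 by simp
      also have "\<dots> \<longleftrightarrow> int q dvd (int c - int i * p) - (int c - int i1 * p)"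
        unfolding res_def by (rule mod_eq_dvd_iff)
      also have "(int c - int i * p) - (int c - int i1 * p) = (int i1 - int i) * p"
        by (simp add: algebra_simps)
      also have "int q dvd (int i1 - int i) * p \<longleftrightarrow> int q dvd int i1 - int i"
        using q(2) by (metis coprime_commute coprime_dvd_mult_left_iff)
      also have "\<dots> \<longleftrightarrow> int i1 mod int q = int i mod int q" by (rule mod_eq_dvd_iff[symmetric])
      also have "\<dots> \<longleftrightarrow> i mod q = r0" unfolding r0_def zmod_int[symmetric] by auto
      finally show ?thesis .
    qed
    define K where "K = (n - r0) div q"
    have tK: "r0 + q * t \<le> n \<longleftrightarrow> t \<le> K" for t
      using r0 q(1) unfolding K_def by (simp add: less_eq_div_iff_mult_less_eq mult.commute le_diff_conv2 add.commute)
    define f where "f = (\<lambda>t. z (r0 + q * t) + int c = int q)"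
    have f_ends: "z (r0 + q * t) + int c = (if f t then int q else 0)" if "t \<le> K" for t
      using ends[of "r0 + q * t"] class_iff[of "r0 + q * t"] r0(1) that tK[of t] unfolding f_def by auto
    have step: "int q * (h (int (r0 + q * t) + int q) - h (int (r0 + q * t)))
        = int q * p + (if f (Suc t) then int q else 0) - (if f t then int q else 0)" if "t < K" for t
    proof -
      have "z (r0 + q * Suc t) - z (r0 + q * t)
          = int q * (h (int (r0 + q * Suc t)) - h (int (r0 + q * t))) - int q * p"
        unfolding z_def by (simp add: algebra_simps)
      moreover have eq: "int (r0 + q * Suc t) = int (r0 + q * t) + int q" by simp
      ultimately have "z (r0 + q * Suc t) - z (r0 + q * t)
          = int q * (h (int (r0 + q * t) + int q) - h (int (r0 + q * t))) - int q * p"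
        by metis
      moreover have "z (r0 + q * t) + int c = (if f t then int q else 0)"
        "z (r0 + q * Suc t) + int c = (if f (Suc t) then int q else 0)"
        using that by (intro f_ends; simp)+
      ultimately show ?thesis by linarith
    qed
    \<comment> \<open>A fall and a rise would yield two factors of length q with p - 1 and p + 1
      ones.\<close>
    have nochange: False
      if "t < K" "t' < K" "f t" "\<not> f (Suc t)" "\<not> f t'" "f (Suc t')" for t t'
    proof -
      have "int q * (h (int (r0 + q * t) + int q) - h (int (r0 + q * t))) = int q * (p - 1)"
        "int q * (h (int (r0 + q * t') + int q) - h (int (r0 + q * t'))) = int q * (p + 1)"
        using step[of t] step[of t'] that by (auto simp: algebra_simps)
      then have "h (int (r0 + q * t) + int q) - h (int (r0 + q * t)) = p - 1"
        "h (int (r0 + q * t') + int q) - h (int (r0 + q * t')) = p + 1"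
        using q(1) by auto
      then show False using balancedD[OF bal, of "int (r0 + q * t')" q "int (r0 + q * t)"] by linarith
    qed
    obtain u b where u: "u \<le> K + 1" "\<And>t. t \<le> K \<Longrightarrow> f t \<longleftrightarrow> ((t < u) = b)"
      using one_change_threshold[of K f] nochange by blast
    have "K \<le> n div q" unfolding K_def by (intro div_le_mono) simp
    then have un: "u \<le> n div q + 1" using u(1) by simp
    have "(z i + int c = int q) \<longleftrightarrow> ((i div q < u) = b)" if "i \<le> n" "res i = 0" for i
    proof -
      have i: "i = r0 + q * (i div q)" using class_iff[of i] that(2) by (metis mod_mult_div_eq)
      then have "i div q \<le> K" using tK[of "i div q"] that(1) by simp
      then show ?thesis using u(2)[of "i div q"] i unfolding f_def by simp
    qed
    then show thesis using that[of c u b] cq un result[of _ u b] by blast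
  qed
qed

section \<open>Fractions without large partial quotients\<close>

lemma abs_diff_fraction:
  fixes \<alpha> r q :: real
  assumes "0 < q"
  shows "\<bar>\<alpha> - r / q\<bar> = \<bar>q * \<alpha> - r\<bar> / q"
proof -
  have "\<alpha> - r / q = (q * \<alpha> - r) / q" using assms by (simp add: field_simps)
  then show ?thesis using assms by (simp add: abs_divide)
qed

lemma numerator_bounds:
  fixes \<alpha> :: real and p :: int and q :: nat
  assumes "0 \<le> \<alpha>" "\<alpha> \<le> 1" "\<bar>real q * \<alpha> - real_of_int p\<bar> < 1"
  shows "0 \<le> p" "p \<le> int q"
proof -
  have "0 \<le> real q * \<alpha>" "real q * \<alpha> \<le> real q" using assms(1,2) by (auto simp: mult_left_le)
  then have "real_of_int p > -1" "real_of_int p < real q + 1" using assms(3) by (auto simp: abs_less_iff)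
  then show "0 \<le> p" "p \<le> int q" by linarith+
qed

text \<open>Euclidean steps with quotients in 1..A lead from (x, y) to (u, v). The steps are
  appended at the end (u, v), so that all starts above a fixed end can be counted.\<close>

inductive euclid_chain :: "nat \<Rightarrow> nat \<Rightarrow> nat \<Rightarrow> nat \<Rightarrow> nat \<Rightarrow> bool" for A x y where
  chain_refl: "euclid_chain A x y x y"
| chain_step: "1 \<le> a \<Longrightarrow> a \<le> A \<Longrightarrow> euclid_chain A x y (a * u + v) u \<Longrightarrow> euclid_chain A x y u v"

lemma euclid_chain_extend:
  assumes "euclid_chain A y z u v" "1 \<le> a" "a \<le> A"
  shows "euclid_chain A (a * y + z) y u v"
  using assms(1)
proof induction
  case chain_refl
  show ?case by (rule euclid_chain.chain_step[OF assms(2,3)]) (rule euclid_chain.chain_refl)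
next
  case (chain_step b u v)
  then show ?case by (meson euclid_chain.chain_step)
qed

lemma euclid_chain_le:
  assumes "euclid_chain A x y u v"
  shows "u \<le> x \<and> (v \<le> u \<longrightarrow> y \<le> x)"
  using assms
proof induction
  case (chain_step a u v)
  have "u \<le> a * u" using chain_step(1) by (cases a) auto
  then have "u \<le> a * u + v" by (rule trans_le_add1)
  then show ?case using chain_step.IH by (meson le_trans)
qed simp

lemma finite_euclid_chain:
  assumes "v \<le> u"
  shows "finite {(x, y). euclid_chain A x y u v \<and> x \<le> M}"
proof (rule finite_subset)
  show "{(x, y). euclid_chain A x y u v \<and> x \<le> M} \<subseteq> {..M} \<times> {..M}"
    using euclid_chain_le assms by fastforce
qed simp

lemma one_plus_powr_le:
  fixes x s :: real
  assumes "0 \<le> x" "0 \<le> s" "s * x \<le> 1"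
  shows "(1 + x) powr s \<le> 1 + 2 * (s * x)"
proof -
  have "(1 + x) powr s = exp (s * ln (1 + x))" using assms by (simp add: powr_def)
  also have "\<dots> \<le> exp (s * x)" using assms ln_add_one_self_le_self[of x] by (simp add: mult_left_mono)
  also have "\<dots> \<le> 1 + s * x + (s * x)\<^sup>2" using assms by (intro exp_bound) auto
  also have "(s * x)\<^sup>2 \<le> s * x" using assms by (simp add: power2_eq_square mult_left_le)
  finally show ?thesis by simp
qed

text \<open>For s = 0 this is 1/(t (t + 1)) = 1/t - 1/(t + 1); the perturbation by s costs the
  factor 1 - 2 s.\<close>

lemma powr_telescope_ge:
  fixes t s :: real
  assumes "1 \<le> t" "0 \<le> s" "s \<le> 1"
  shows "(1 - 2 * s) * (t powr (s - 1) / (t + 1)) \<le> t powr (s - 1) - (t + 1) powr (s - 1)"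
proof -
  have "s * (1 / t) \<le> 1 * 1" using assms by (intro mult_mono) auto
  then have "(1 + 1 / t) powr s \<le> 1 + 2 * (s * (1 / t))" using assms by (intro one_plus_powr_le) auto
  then have "t powr s * (1 + 1 / t) powr s \<le> t powr s * (1 + 2 * (s * (1 / t)))"
    by (intro mult_left_mono) auto
  moreover have "t powr s * (1 + 1 / t) powr s = (t + 1) powr s"
  proof -
    have "t * (1 + 1 / t) = t + 1" using assms by (simp add: field_simps)
    then show ?thesis using powr_mult[of t "1 + 1 / t" s] by simp
  qed
  ultimately have "(t + 1) powr s / (t + 1) \<le> t powr s * (1 + 2 * (s * (1 / t))) / (t + 1)"
    using assms by (intro divide_right_mono) auto
  moreover have "(t + 1) powr s / (t + 1) = (t + 1) powr (s - 1)" "t powr s = t powr (s - 1) * t"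
    using assms by (auto simp: powr_diff)
  ultimately have "(t + 1) powr (s - 1) \<le> t powr (s - 1) * (t + 2 * s) / (t + 1)"
    using assms by (simp add: algebra_simps)
  also have "\<dots> = t powr (s - 1) - (1 - 2 * s) * (t powr (s - 1) / (t + 1))"
    using assms by (simp add: field_simps)
  finally show ?thesis by simp
qed

text \<open>
  The weight \<open>u\<^sup>s / (u (u + v))\<close> perturbs the length of a continued fraction cylinder; because
  quotients above \<open>A\<close> are missing it still loses a definite proportion at every step.
\<close>
definition cylinder_weight :: "real \<Rightarrow> real \<Rightarrow> real \<Rightarrow> real" where
  "cylinder_weight s u v = u powr s / (u * (u + v))"

text \<open>By homogeneity the weight of the preceding pair (a u + v, u) depends on a only through t
  = a + v/u, which makes the sum over a telescope.\<close>

lemma cylinder_weight_scale: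
  assumes "u > 0" "t > 0"
  shows "cylinder_weight s (t * u) u = u powr (s - 2) * (t powr (s - 1) / (t + 1))"
proof -
  have "(t * u) powr s = t powr s * u powr s" by (rule powr_mult)
  moreover have "u powr s = u powr (s - 2) * u\<^sup>2" "t powr s = t powr (s - 1) * t"
    using assms by (auto simp: powr_diff powr_numeral)
  ultimately have "(t * u) powr s = (t * u * u) * (u powr (s - 2) * t powr (s - 1))"
    by (simp add: power2_eq_square)
  moreover have "t * u * (t * u + u) = (t * u * u) * (t + 1)" by (simp add: algebra_simps)
  ultimately have "cylinder_weight s (t * u) u
      = ((t * u * u) * (u powr (s - 2) * t powr (s - 1))) / ((t * u * u) * (t + 1))"
    unfolding cylinder_weight_def by metis
  also have "\<dots> = (u powr (s - 2) * t powr (s - 1)) / (t + 1)"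
    using assms by (intro mult_divide_mult_cancel_left) simp
  finally show ?thesis by simp
qed

text \<open>For s = 0 the sum over all quotients would return the full weight, and those above A
  carry a proportion of at least 1/(A + 2) = 5 s. Of this, 2 s pay for (1 + r)^s and 2 s for the
  telescoping inequality; s remains, which explains the 5.\<close>

lemma cylinder_weight_sum:
  fixes u v s :: real and A :: nat
  assumes "0 < u" "0 \<le> v" "v \<le> u" and s: "s = 1 / (5 * (real A + 2))"
  shows "(\<Sum>a=1..A. cylinder_weight s (real a * u + v) u) \<le> (1 - s) * cylinder_weight s u v"
proof -
  define r where "r = v / u"
  have r: "0 \<le> r" "r \<le> 1" using assms unfolding r_def by auto
  have v: "v = r * u" using assms unfolding r_def by simp
  have s01: "0 < s" "s \<le> 1/10" unfolding s by (simp, intro frac_le, auto)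
  define B where "B = u powr (s - 2)"
  have "B > 0" unfolding B_def using assms by simp
  have term_le: "cylinder_weight s (real a * u + v) u
      \<le> B / (1 - 2 * s) * ((real a + r) powr (s - 1) - (real (Suc a) + r) powr (s - 1))" if "1 \<le> a" for a
  proof -
    have "(1 - 2 * s) * ((real a + r) powr (s - 1) / (real a + r + 1))
        \<le> (real a + r) powr (s - 1) - (real a + r + 1) powr (s - 1)"
      using that r s01 by (intro powr_telescope_ge) auto
    then have "(real a + r) powr (s - 1) / (real a + r + 1)
        \<le> ((real a + r) powr (s - 1) - (real (Suc a) + r) powr (s - 1)) / (1 - 2 * s)"
      using s01 by (simp add: field_simps)
    then have "B * ((real a + r) powr (s - 1) / (real a + r + 1))
        \<le> B * (((real a + r) powr (s - 1) - (real (Suc a) + r) powr (s - 1)) / (1 - 2 * s))"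
      using \<open>B > 0\<close> by (intro mult_left_mono) auto
    moreover have "cylinder_weight s (real a * u + v) u = B * ((real a + r) powr (s - 1) / (real a + r + 1))"
      using cylinder_weight_scale[of u "real a + r" s] assms(1) r that unfolding B_def v
      by (simp add: algebra_simps)
    ultimately show ?thesis by simp
  qed
  have tele: "(\<Sum>a=1..A. (real a + r) powr (s - 1) - (real (Suc a) + r) powr (s - 1))
      = (1 + r) powr (s - 1) - (real A + 1 + r) powr (s - 1)"
    by (induction A) (auto simp: algebra_simps)
  have "(\<Sum>a=1..A. cylinder_weight s (real a * u + v) u)
      \<le> (\<Sum>a=1..A. B / (1 - 2 * s) * ((real a + r) powr (s - 1) - (real (Suc a) + r) powr (s - 1)))"
    using term_le by (intro sum_mono) auto
  also have "\<dots> = B / (1 - 2 * s) * ((1 + r) powr (s - 1) - (real A + 1 + r) powr (s - 1))"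
    unfolding sum_distrib_left[symmetric] tele ..
  also have "\<dots> \<le> B / (1 - 2 * s) * ((1 - s) * (1 - 2 * s) / (1 + r))"
  proof (intro mult_left_mono)
    have 1: "(1 + r) powr (s - 1) = (1 + r) powr s / (1 + r)" using r by (simp add: powr_diff)
    have "s * r \<le> s" using s01 r by (simp add: mult_left_le)
    then have 2: "(1 + r) powr s \<le> 1 + 2 * s" using one_plus_powr_le[of r s] s01 r by linarith
    have "(real A + 1 + r) powr (s - 1) \<ge> (real A + 1 + r) powr (- 1)"
      using r s01 by (intro powr_mono) auto
    then have "(real A + 1 + r) powr (s - 1) \<ge> 1 / (real A + 1 + r)"
      using r by (simp add: powr_minus_divide)
    also have "1 / (real A + 1 + r) \<ge> 1 / (real A + 2) / (1 + r)"
    proof -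
      have "real A + 1 + r \<le> real A + 2" using r by simp
      also have "\<dots> \<le> (real A + 2) * (1 + r)" using r by (simp add: mult_le_cancel_left1)
      finally show ?thesis using r by (simp add: frac_le)
    qed
    finally have 3: "(real A + 1 + r) powr (s - 1) \<ge> 1 / (real A + 2) / (1 + r)" .
    have "1 / (real A + 2) = 5 * s" using s by (simp add: field_simps)
    then have "(1 + r) powr s - 1 / (real A + 2) \<le> 1 - 3 * s" using 2 by simp
    also have "\<dots> \<le> (1 - s) * (1 - 2 * s)" by (simp add: algebra_simps)
    finally have "((1 + r) powr s - 1 / (real A + 2)) / (1 + r) \<le> (1 - s) * (1 - 2 * s) / (1 + r)"
      using r by (intro divide_right_mono) auto
    then show "(1 + r) powr (s - 1) - (real A + 1 + r) powr (s - 1) \<le> (1 - s) * (1 - 2 * s) / (1 + r)"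
      using 1 3 by (simp add: diff_divide_distrib)
  qed (use \<open>B > 0\<close> s01 in auto)
  also have "\<dots> = (1 - s) * (B / (1 + r))" using s01 by simp
  also have "B / (1 + r) = cylinder_weight s u v"
  proof -
    have "u powr s = u * u * B" unfolding B_def using assms(1)
      by (simp add: powr_diff powr_numeral power2_eq_square)
    moreover have "u * (u + r * u) = (u * u) * (1 + r)" by (simp add: algebra_simps)
    ultimately have "cylinder_weight s u v = (u * u * B) / ((u * u) * (1 + r))"
      unfolding cylinder_weight_def v by metis
    also have "\<dots> = B / (1 + r)" using assms(1) by (intro mult_divide_mult_cancel_left) simp
    finally show ?thesis ..
  qed
  finally show ?thesis .
qed

text \<open>Induction from large u downwards. Every start other than (u, v) itself passes through
  some (a u + v, u), and the proportion s lost by the weights pays for this one extra pair.\<close>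

lemma card_euclid_chain:
  fixes A M u v :: nat and s :: real
  assumes "1 \<le> v" "v \<le> u" and s: "s = 1 / (5 * (real A + 2))"
  shows "real (card {(x, y). euclid_chain A x y u v \<and> x \<le> M})
    \<le> 2 / s * real M powr (2 - s) * cylinder_weight s u v"
  using assms(1,2)
proof (induction "Suc M - u" arbitrary: u v rule: less_induct)
  case less
  define S where "S = (\<lambda>u v. {(x, y). euclid_chain A x y u v \<and> x \<le> M})"
  have s01: "0 < s" "s \<le> 1/10" unfolding s by (simp, intro frac_le, auto)
  have fin: "finite (S u v)" if "v \<le> u" for u v
    unfolding S_def by (rule finite_euclid_chain[OF that])
  have wpos: "0 \<le> cylinder_weight s x y" if "0 \<le> x" "0 \<le> y" for x y
    unfolding cylinder_weight_def using that by simp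
  define D where "D = 2 / s * real M powr (2 - s)"
  have "D \<ge> 0" unfolding D_def using s01 by simp
  show ?case
  proof (cases "u \<le> M")
    case False
    then have "S u v = {}" unfolding S_def using euclid_chain_le by fastforce
    moreover have "0 \<le> D * cylinder_weight s u v" using wpos[of u v] \<open>D \<ge> 0\<close> by simp
    ultimately show ?thesis unfolding S_def D_def by (simp only: card.empty)
  next
    case True
    have M1: "1 \<le> M" "1 \<le> u" using True less.prems by auto
    have sub: "S u v \<subseteq> insert (u, v) (\<Union>a\<in>{1..A}. S (a * u + v) u)"
    proof
      fix z assume "z \<in> S u v"
      then obtain x y where z: "z = (x, y)" "euclid_chain A x y u v" "x \<le> M" unfolding S_def by auto
      from z(2) show "z \<in> insert (u, v) (\<Union>a\<in>{1..A}. S (a * u + v) u)"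
        by cases (use z in \<open>auto simp: S_def\<close>)
    qed
    have gt: "u < a * u + v" if "1 \<le> a" for a
    proof -
      have "u \<le> a * u" using that by (cases a) auto
      then show ?thesis using less.prems(1) by linarith
    qed
    have "card (S u v) \<le> card (insert (u, v) (\<Union>a\<in>{1..A}. S (a * u + v) u))"
      using gt[THEN less_imp_le] by (intro card_mono sub finite.insertI finite_UN_I fin) auto
    also have "\<dots> \<le> 1 + card (\<Union>a\<in>{1..A}. S (a * u + v) u)"
      by (simp add: card_insert_le_m1)
    also have "\<dots> \<le> 1 + (\<Sum>a=1..A. card (S (a * u + v) u))"
      using card_UN_le[of "{1..A}" "\<lambda>a. S (a * u + v) u"] by simp
    finally have "real (card (S u v)) \<le> real (1 + (\<Sum>a=1..A. card (S (a * u + v) u)))"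
      by (rule of_nat_mono)
    also have "\<dots> = 1 + (\<Sum>a=1..A. real (card (S (a * u + v) u)))" by simp
    also have "(\<Sum>a=1..A. real (card (S (a * u + v) u)))
        \<le> (\<Sum>a=1..A. D * cylinder_weight s (real a * real u + real v) u)"
    proof (intro sum_mono)
      fix a assume "a \<in> {1..A}"
      then have "u < a * u + v" using gt by simp
      then have "Suc M - (a * u + v) < Suc M - u" "u \<le> a * u + v" using True by linarith+
      then show "real (card (S (a * u + v) u)) \<le> D * cylinder_weight s (real a * real u + real v) u"
        using less.hyps[of "a * u + v" u] M1 True unfolding S_def D_def by simp
    qed
    also have "\<dots> = D * (\<Sum>a=1..A. cylinder_weight s (real a * real u + real v) u)"
      by (simp add: sum_distrib_left)
    also have "\<dots> \<le> D * ((1 - s) * cylinder_weight s u v)"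
      using less.prems \<open>D \<ge> 0\<close> by (intro mult_left_mono cylinder_weight_sum s) auto
    also have "1 + D * ((1 - s) * cylinder_weight s u v) \<le> D * cylinder_weight s u v"
    proof -
      have "1 = real M powr (2 - s) * real M powr (s - 2)" using M1 by (simp flip: powr_add)
      also have "\<dots> \<le> real M powr (2 - s) * real u powr (s - 2)"
        using True M1 s01 by (intro mult_left_mono powr_mono2') auto
      also have "real u powr (s - 2) = real u powr s / (real u * real u)"
        using M1 by (simp add: powr_diff powr_numeral power2_eq_square)
      also have "\<dots> \<le> 2 * cylinder_weight s u v"
      proof -
        have "real u powr s / (real u * real u) = 2 * (real u powr s / (real u * (2 * real u)))"
          by simp
        also have "\<dots> \<le> 2 * (real u powr s / (real u * (real u + real v)))"
          using less.prems M1 by (intro mult_left_mono divide_left_mono) auto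
        finally show ?thesis unfolding cylinder_weight_def .
      qed
      finally have "1 \<le> real M powr (2 - s) * (2 * cylinder_weight s u v)" by (simp add: mult_left_mono)
      also have "\<dots> = s * (D * cylinder_weight s u v)" unfolding D_def using s01 by simp
      finally show ?thesis by (simp add: algebra_simps)
    qed
    finally show ?thesis unfolding S_def D_def by simp
  qed
qed

text \<open>Up to the constant this is M^2 (N/M)^s; with s = 1/(5 (A + 2)) the factor 40 (A + 2) is
  8/s.\<close>

definition exceptional_bound :: "nat \<Rightarrow> nat \<Rightarrow> nat \<Rightarrow> real \<Rightarrow> real" where
  "exceptional_bound N M A s = 40 * (real A + 2) * (real M powr (2 - s) * real N powr s)"

text \<open>\<open>card_euclid_chain\<close> is summed over the pair (u, v) at which the chain
  crosses N: fewer than N values of v, and the sum of u^(s - 2) over u >= N is of order N^(s -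
  1).\<close>

lemma card_bad_pairs:
  fixes A M N :: nat and s :: real
  assumes "1 \<le> N" and s: "s = 1 / (5 * (real A + 2))"
  defines "P \<equiv> {(x, y). x \<le> M \<and> (\<exists>u v. 1 \<le> v \<and> v < N \<and> N \<le> u \<and> euclid_chain A x y u v)}"
  shows "finite P" "real (card P) \<le> exceptional_bound N M A s"
proof -
  define S where "S = (\<lambda>u v. {(x, y). euclid_chain A x y u v \<and> x \<le> M})"
  have s01: "0 < s" "s \<le> 1/10" unfolding s by (simp, intro frac_le, auto)
  have fin: "finite (S u v)" if "v \<le> u" for u v
    unfolding S_def by (rule finite_euclid_chain[OF that])
  have sub: "P \<subseteq> (\<Union>v\<in>{1..<N}. \<Union>u\<in>{N..M}. S u v)"
    unfolding P_def S_def using euclid_chain_le by fastforce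
  have finU: "finite (\<Union>v\<in>{1..<N}. \<Union>u\<in>{N..M}. S u v)"
    by (intro finite_UN_I fin) auto
  show "finite P" by (rule finite_subset[OF sub finU])
  define D where "D = 2 / s * real M powr (2 - s)"
  have "D \<ge> 0" unfolding D_def using s01 by simp
  have each: "real (card (S u v)) \<le> D * real u powr (s - 2)" if "1 \<le> v" "v < N" "N \<le> u" for u v
  proof -
    have "real (card (S u v)) \<le> D * cylinder_weight s u v"
      using card_euclid_chain[of v u s A M] that s unfolding S_def D_def by simp
    also have "\<dots> \<le> D * real u powr (s - 2)"
    proof (rule mult_left_mono)
      have "real u powr s / (real u * (real u + real v)) \<le> real u powr s / (real u * real u)"
        using that by (intro divide_left_mono mult_left_mono mult_pos_pos) auto
      then show "cylinder_weight s u v \<le> real u powr (s - 2)"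
        unfolding cylinder_weight_def using that by (simp add: powr_diff powr_numeral power2_eq_square)
    qed (rule \<open>D \<ge> 0\<close>)
    finally show ?thesis .
  qed
  have inner: "(\<Sum>u=N..M. real u powr (s - 2)) \<le> 4 * real N powr (s - 1)"
  proof (cases "N \<le> M")
    case True
    have term_le: "real u powr (s - 2) \<le> 4 * (real u powr (s - 1) - real (Suc u) powr (s - 1))" if "N \<le> u" for u
    proof -
      have u: "real u \<ge> 1" using that assms(1) by simp
      have "real u powr (s - 2) = real u powr (s - 1) / real u"
        using u by (simp add: powr_diff powr_numeral power2_eq_square)
      also have "\<dots> \<le> real u powr (s - 1) / ((real u + 1) / 2)"
        using u by (intro divide_left_mono) auto
      also have "\<dots> = 2 * (real u powr (s - 1) / (real u + 1))" by simp
      also have "\<dots> \<le> 2 * (2 * ((1 - 2 * s) * (real u powr (s - 1) / (real u + 1))))"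
      proof -
        have "1 * (real u powr (s - 1) / (real u + 1)) \<le> (2 * (1 - 2 * s)) * (real u powr (s - 1) / (real u + 1))"
          using s01 by (intro mult_right_mono) auto
        from mult_left_mono[OF this, of 2] show ?thesis by (simp only: mult.assoc mult_1_left)
      qed
      also have "\<dots> \<le> 4 * (real u powr (s - 1) - (real u + 1) powr (s - 1))"
      proof -
        have "(1 - 2 * s) * (real u powr (s - 1) / (real u + 1)) \<le> real u powr (s - 1) - (real u + 1) powr (s - 1)"
          using u s01 by (intro powr_telescope_ge) auto
        from mult_left_mono[OF this, of 4] show ?thesis by simp
      qed
      finally show ?thesis by (simp add: add.commute)
    qed
    have "(\<Sum>u=N..M. real u powr (s - 2)) \<le> (\<Sum>u=N..M. 4 * (real u powr (s - 1) - real (Suc u) powr (s - 1)))"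
      using term_le by (intro sum_mono) auto
    also have "\<dots> = 4 * (real N powr (s - 1) - real (Suc M) powr (s - 1))"
    proof -
      have "(\<Sum>u=N..M. real u powr (s - 1) - real (Suc u) powr (s - 1))
          = - (\<Sum>u=N..M. real (Suc u) powr (s - 1) - real u powr (s - 1))"
        by (simp add: sum_negf[symmetric])
      also have "\<dots> = - (real (Suc M) powr (s - 1) - real N powr (s - 1))"
        using True by (subst sum_Suc_diff) auto
      finally have eq: "(\<Sum>u=N..M. real u powr (s - 1) - real (Suc u) powr (s - 1))
          = - (real (Suc M) powr (s - 1) - real N powr (s - 1))" .
      show ?thesis unfolding sum_distrib_left[symmetric] eq by simp
    qed
    also have "\<dots> \<le> 4 * real N powr (s - 1)" by simp
    finally show ?thesis .
  qed simp
  have "card P \<le> card (\<Union>v\<in>{1..<N}. \<Union>u\<in>{N..M}. S u v)" by (rule card_mono[OF finU sub])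
  also have "\<dots> \<le> (\<Sum>v\<in>{1..<N}. card (\<Union>u\<in>{N..M}. S u v))" by (rule card_UN_le) simp
  also have "\<dots> \<le> (\<Sum>v\<in>{1..<N}. \<Sum>u\<in>{N..M}. card (S u v))" by (intro sum_mono card_UN_le) simp
  finally have "real (card P) \<le> real (\<Sum>v\<in>{1..<N}. \<Sum>u\<in>{N..M}. card (S u v))" by (rule of_nat_mono)
  also have "\<dots> = (\<Sum>v\<in>{1..<N}. \<Sum>u\<in>{N..M}. real (card (S u v)))" by simp
  also have "\<dots> \<le> (\<Sum>v\<in>{1..<N}. \<Sum>u\<in>{N..M}. D * real u powr (s - 2))"
    using each by (intro sum_mono) auto
  also have "\<dots> = real (N - 1) * (D * (\<Sum>u\<in>{N..M}. real u powr (s - 2)))"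
    by (simp add: sum_distrib_left)
  also have "\<dots> \<le> real N * (D * (4 * real N powr (s - 1)))"
    using inner \<open>D \<ge> 0\<close> by (intro mult_mono mult_left_mono mult_nonneg_nonneg sum_nonneg) auto
  also have "\<dots> = 4 * D * real N powr s"
    using assms(1) by (simp add: powr_diff)
  also have "\<dots> = exceptional_bound N M A s"
  proof -
    have "1 / s = 5 * (real A + 2)" unfolding s by simp
    moreover have "4 * D * real N powr s = 8 * (1 / s) * (real M powr (2 - s) * real N powr s)"
      unfolding D_def by simp
    ultimately show ?thesis unfolding exceptional_bound_def by simp
  qed
  finally show "real (card P) \<le> exceptional_bound N M A s" .
qed

text \<open>
  Running the Euclidean algorithm on \<open>q\<close> and the inverse of \<open>p\<close> modulo \<open>q\<close> lists the denominators of
  the convergents of \<open>p / q\<close>; a large quotient would produce an approximation of \<open>\<alpha>\<close> that is too good.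
\<close>
lemma badly_approximable_chain:
  fixes \<alpha> :: real and A M N q X Y :: nat and p PX PY :: int
  assumes bad: "\<And>p' q'. N \<le> q' \<Longrightarrow> q' \<le> M \<Longrightarrow> coprime p' (int q') \<Longrightarrow>
      2 / (real A * (real q')\<^sup>2) \<le> \<bar>\<alpha> - of_int p' / real q'\<bar>"
    and A: "A > 0" and N: "2 \<le> N" and q: "q \<le> M" "0 < q"
    and pq: "\<bar>\<alpha> - of_int p / real q\<bar> < 1 / (real q * real M)"
    and XY: "N \<le> X" "X \<le> q" "Y < X" "\<bar>PX * int Y - PY * int X\<bar> = 1"
      "(PX * int q - p * int X) * (PY * int q - p * int Y) \<le> 0"
  shows "\<exists>u v. 1 \<le> v \<and> v < N \<and> N \<le> u \<and> euclid_chain A X Y u v"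
  using XY
proof (induction Y arbitrary: X PX PY rule: less_induct)
  case (less Y)
  show ?case
  proof (cases "Y < N")
    case True
    have "Y \<noteq> 0"
    proof
      assume "Y = 0"
      then have "\<bar>PY\<bar> * int X = 1" using less.prems(4) by (simp add: abs_mult)
      then have "int X dvd 1" by (metis dvd_triv_right)
      then show False using less.prems(1) N by simp
    qed
    then show ?thesis using True less.prems(1) by (intro exI[of _ X] exI[of _ Y]) (auto intro: euclid_chain.chain_refl)
  next
    case False
    then have YN: "N \<le> Y" "0 < Y" using N by auto
    define dX dY where "dX = PX * int q - p * int X" and "dY = PY * int q - p * int Y"
    have cop: "coprime PY (int Y)"
    proof (rule coprimeI)
      fix d assume "d dvd PY" "d dvd int Y"
      then have "d dvd PX * int Y - PY * int X" by simp
      then have "d dvd \<bar>PX * int Y - PY * int X\<bar>" by (simp only: dvd_abs_iff)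
      then show "is_unit d" unfolding less.prems(4) .
    qed
    have det: "\<bar>dY * int X - dX * int Y\<bar> = int q"
    proof -
      have "dY * int X - dX * int Y = - (int q * (PX * int Y - PY * int X))"
        unfolding dX_def dY_def by (simp add: algebra_simps)
      then show ?thesis using less.prems(4) by (simp add: abs_mult)
    qed
    have opp: "dX * dY \<le> 0" using less.prems(5) unfolding dX_def dY_def .
    \<comment> \<open>For opposite signs the determinant identity becomes |dY| X + |dX| Y = q, which
      puts PY/Y as close to p/q as a convergent.\<close>
    have "\<bar>dY\<bar> * int X \<le> \<bar>dY * int X - dX * int Y\<bar>"
    proof -
      consider "dY \<ge> 0" "dX \<le> 0" | "dY \<le> 0" "dX \<ge> 0"
        using opp by (auto simp: mult_le_0_iff)
      then show ?thesis
      proof cases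
        case 1
        then have "dX * int Y \<le> 0" "0 \<le> dY * int X" by (auto simp: mult_le_0_iff)
        moreover have "\<bar>dY\<bar> * int X = dY * int X" using 1 by simp
        ultimately show ?thesis by linarith
      next
        case 2
        then have "0 \<le> dX * int Y" "dY * int X \<le> 0" by (auto simp: mult_le_0_iff)
        moreover have "\<bar>dY\<bar> * int X = - (dY * int X)" using 2 by simp
        ultimately show ?thesis by linarith
      qed
    qed
    then have dYX: "\<bar>dY\<bar> * int X \<le> int q" using det by simp
    have Xpos: "0 < X" using less.prems by simp
    have "2 / (real A * (real Y)\<^sup>2) \<le> \<bar>\<alpha> - real_of_int PY / real Y\<bar>"
      using bad[of Y PY] YN less.prems q cop by simp
    also have "\<dots> \<le> \<bar>\<alpha> - of_int p / real q\<bar> + \<bar>of_int p / real q - real_of_int PY / real Y\<bar>"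
      by linarith
    also have "\<dots> < 1 / (real q * real M) + 1 / (real X * real Y)"
    proof -
      have "of_int p / real q - real_of_int PY / real Y = - real_of_int dY / (real q * real Y)"
        unfolding dY_def using q YN by (simp add: field_simps)
      then have "\<bar>of_int p / real q - real_of_int PY / real Y\<bar> = real_of_int \<bar>dY\<bar> / (real q * real Y)"
        by (simp add: abs_divide abs_mult)
      also have "\<dots> \<le> 1 / (real X * real Y)"
      proof -
        have "real_of_int (\<bar>dY\<bar> * int X) \<le> real_of_int (int q)" using dYX by (simp only: of_int_le_iff)
        then have "real_of_int \<bar>dY\<bar> * real X \<le> real q" by simp
        then show ?thesis using q YN Xpos by (simp add: field_simps)
      qed
      finally show ?thesis using pq by linarith
    qed
    also have "\<dots> \<le> 2 / (real X * real Y)"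
    proof -
      have "real X * real Y \<le> real M * real q" using less.prems q by (intro mult_mono) auto
      then have "1 / (real q * real M) \<le> 1 / (real X * real Y)"
        using Xpos YN q by (intro divide_left_mono) (auto simp: mult.commute[of "real q"])
      then show ?thesis by simp
    qed
    \<comment> \<open>Bad approximability of the slope by PY/Y, whose distance is below 2/(X Y),
      limits the next quotient X div Y.\<close>
    finally have "2 * (real X * real Y) < 2 * (real A * (real Y)\<^sup>2)"
      using A YN Xpos by (simp add: field_simps)
    then have "real X < real A * real Y" using YN by (simp add: power2_eq_square)
    then have XAY: "X < A * Y" by (metis of_nat_less_iff of_nat_mult)
    define a Z where "a = X div Y" and "Z = X mod Y"
    have X: "X = a * Y + Z" unfolding a_def Z_def by simp
    have a: "1 \<le> a" "a \<le> A"
      using less.prems(3) YN XAY unfolding a_def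
      by (auto simp: Suc_le_eq div_greater_zero_iff less_mult_imp_div_less less_imp_le)
    have Z: "Z < Y" unfolding Z_def using YN by simp
    \<comment> \<open>Numerators follow the recurrence of the denominators, which preserves the
      determinant and the alternation of sides.\<close>
    define PZ where "PZ = PX - int a * PY"
    have "\<bar>PY * int Z - PZ * int Y\<bar> = 1"
    proof -
      have "PY * int Z - PZ * int Y = - (PX * int Y - PY * int X)"
        unfolding PZ_def X by (simp add: algebra_simps)
      then show ?thesis using less.prems(4) by simp
    qed
    moreover have "(PY * int q - p * int Y) * (PZ * int q - p * int Z) \<le> 0"
    proof -
      have "PZ * int q - p * int Z = dX - int a * dY"
        unfolding PZ_def dX_def dY_def X by (simp add: algebra_simps)
      then have "(PY * int q - p * int Y) * (PZ * int q - p * int Z) = dX * dY - int a * (dY * dY)"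
        unfolding dY_def[symmetric] by (simp only:) (simp add: algebra_simps)
      moreover have "0 \<le> int a * (dY * dY)" by simp
      ultimately show ?thesis using opp by linarith
    qed
    moreover have "Y \<le> q" using less.prems by simp
    ultimately obtain u v where "1 \<le> v" "v < N" "N \<le> u" "euclid_chain A Y Z u v"
      using less.IH[of Z Y PY PZ] Z YN less.prems(3) by blast
    then show ?thesis using euclid_chain_extend[of A Y Z u v a] a unfolding X by blast
  qed
qed

definition bad_fractions :: "nat \<Rightarrow> nat \<Rightarrow> nat \<Rightarrow> (int \<times> nat) set" where
  "bad_fractions N M A = {(p, q). N \<le> q \<and> q \<le> M \<and> 0 \<le> p \<and> p \<le> int q \<and> coprime p (int q) \<and>
    (\<exists>\<alpha>. \<bar>\<alpha> - of_int p / real q\<bar> < 1 / (real q * real M) \<and>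
      (\<forall>p' q'. N \<le> q' \<longrightarrow> q' \<le> M \<longrightarrow> coprime p' (int q') \<longrightarrow>
        2 / (real A * (real q')\<^sup>2) \<le> \<bar>\<alpha> - of_int p' / real q'\<bar>))}"

text \<open>A fraction p/q is encoded injectively by (q, y), where y inverts p modulo q.
  \<open>badly_approximable_chain\<close> starts from p/q itself and t/y with p y - t q = 1; its
  sign condition holds because the first factor vanishes.\<close>

lemma card_bad_fractions:
  fixes A M N :: nat and s :: real
  assumes "2 \<le> N" "0 < A" and s: "s = 1 / (5 * (real A + 2))"
  shows "finite (bad_fractions N M A)" "real (card (bad_fractions N M A)) \<le> exceptional_bound N M A s"
proof -
  define B where "B = bad_fractions N M A"
  note B_def = B_def[unfolded bad_fractions_def]
  define P where "P = {(x, y). x \<le> M \<and> (\<exists>u v. 1 \<le> v \<and> v < N \<and> N \<le> u \<and> euclid_chain A x y u v)}"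
  have inv: "\<exists>y<q. int q dvd p * int y - 1" if "coprime p (int q)" "2 \<le> q" for p :: int and q :: nat
  proof -
    have "gcd p (int q) = 1" using that(1) by simp
    then obtain w t where w: "w * p + t * int q = 1"
      using bezout_int[of p "int q"] by auto
    define y where "y = nat (w mod int q)"
    have "0 \<le> w mod int q" using that(2) by (intro pos_mod_sign) linarith
    then have y: "int y = w mod int q" unfolding y_def by (rule nat_0_le)
    have "p * int y - 1 = - int q * (t + p * (w div int q))"
      unfolding y minus_mult_div_eq_mod[symmetric] w[symmetric] by (simp add: algebra_simps)
    then have "int q dvd p * int y - 1" by simp
    moreover have "int y < int q" unfolding y using that(2) by simp
    ultimately show ?thesis by auto
  qed
  define f where "f = (\<lambda>(p, q). (q, SOME y. y < q \<and> int q dvd p * int y - 1))"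
  have f: "f (p, q) = (q, snd (f (p, q))) \<and> snd (f (p, q)) < q \<and> int q dvd p * int (snd (f (p, q))) - 1"
    if "coprime p (int q)" "2 \<le> q" for p q
    using someI_ex[of "\<lambda>y. y < q \<and> int q dvd p * int y - 1"] inv[OF that] unfolding f_def by auto
  have inj: "inj_on f B"
  proof (rule inj_onI, clarify)
    fix p q p' q' assume *: "(p, q) \<in> B" "(p', q') \<in> B" "f (p, q) = f (p', q')"
    then have q': "q' = q" unfolding f_def by auto
    have B: "N \<le> q" "0 \<le> p" "p \<le> int q" "coprime p (int q)" "0 \<le> p'" "p' \<le> int q" "coprime p' (int q)"
      using * unfolding B_def q' by auto
    have q2: "2 \<le> q" using B assms(1) by simp
    define y where "y = snd (f (p, q))"
    have y: "int q dvd p * int y - 1" "int q dvd p' * int y - 1"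
      using f[OF B(4) q2] f[OF B(7) q2] *(3) unfolding q' y_def by auto
    have "int q dvd p' * (p * int y - 1) - p * (p' * int y - 1)"
      by (intro dvd_diff dvd_mult y)
    then have dvd: "int q dvd p - p'" by (simp add: algebra_simps)
    have ne: "x \<noteq> 0 \<and> x \<noteq> int q" if "coprime x (int q)" for x
      using that q2 by (auto simp: coprime_iff_gcd_eq_1)
    have "\<bar>p - p'\<bar> < int q" using ne[OF B(4)] ne[OF B(7)] B by linarith
    then have "p = p'" using dvd_imp_le_int[OF _ dvd] by force
    then show "p = p' \<and> q = q'" using q' by simp
  qed
  have sub: "f ` B \<subseteq> P"
  proof (rule image_subsetI, clarify)
    fix p q assume "(p, q) \<in> B"
    then obtain \<alpha> where B: "N \<le> q" "q \<le> M" "coprime p (int q)"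
      and \<alpha>: "\<bar>\<alpha> - of_int p / real q\<bar> < 1 / (real q * real M)"
      "\<And>p' q'. N \<le> q' \<Longrightarrow> q' \<le> M \<Longrightarrow> coprime p' (int q') \<Longrightarrow>
        2 / (real A * (real q')\<^sup>2) \<le> \<bar>\<alpha> - of_int p' / real q'\<bar>"
      unfolding B_def by auto
    define y where "y = snd (f (p, q))"
    have q2: "2 \<le> q" using B assms(1) by simp
    have y: "f (p, q) = (q, y)" "y < q" "int q dvd p * int y - 1"
      using f[OF B(3) q2] unfolding y_def by auto
    obtain t where t: "p * int y - 1 = int q * t" using y(3) by (elim dvdE)
    have "p * int y - t * int q = 1" using t by (simp add: algebra_simps)
    then have "\<exists>u v. 1 \<le> v \<and> v < N \<and> N \<le> u \<and> euclid_chain A q y u v"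
      using B q2 y(2) assms(1,2)
      by (intro badly_approximable_chain[of N M A \<alpha> q p q y p t] \<alpha>) auto
    then show "f (p, q) \<in> P" unfolding y(1) P_def using B by blast
  qed
  have finP: "finite P" unfolding P_def using card_bad_pairs(1)[of N s A M] assms(1) s by simp
  have "finite B" using finite_subset[OF sub finP] finite_imageD[OF _ inj] by blast
  then show "finite (bad_fractions N M A)" unfolding B_def bad_fractions_def .
  have "card B \<le> card P" by (rule card_inj_on_le[OF inj sub finP])
  then show "real (card (bad_fractions N M A)) \<le> exceptional_bound N M A s"
    using card_bad_pairs(2)[of N s A M] assms(1) s unfolding P_def B_def bad_fractions_def by simp
qed

section \<open>The upper bound\<close>

lemma hausdorff_premeasure_finite_cover:
  assumes g: "dimension_function g" and F: "finite F" and "\<delta> > 0"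
    and cover: "E \<subseteq> (\<Union>f\<in>F. V f)"
    and V: "\<And>f. f \<in> F \<Longrightarrow> bounded (V f) \<and> diameter (V f) \<le> d f \<and> 0 < d f \<and> d f < \<delta>"
  shows "hausdorff_premeasure g \<delta> E \<le> ennreal (\<Sum>f\<in>F. g (d f))"
proof -
  obtain e where e: "bij_betw e {..<card F} F"
    using ex_bij_betw_nat_finite[OF F] by (metis atLeast0LessThan)
  define U where "U = (\<lambda>i. if i < card F then V (e i) else {})"
  have eF: "e i \<in> F" if "i < card F" for i using e that unfolding bij_betw_def by auto
  have g0: "g 0 = 0" and gpos: "\<And>r. r > 0 \<Longrightarrow> g r > 0" and gmono: "mono_on {0<..} g"
    using g unfolding dimension_function_def by auto
  have "E \<subseteq> (\<Union>i. U i)"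
  proof
    fix x assume "x \<in> E"
    then obtain f where f: "f \<in> F" "x \<in> V f" using cover by blast
    then obtain i where "i < card F" "e i = f" using e unfolding bij_betw_def by (metis imageE lessThan_iff)
    then show "x \<in> (\<Union>i. U i)" using f unfolding U_def by auto
  qed
  moreover have "\<forall>i. bounded (U i) \<and> diameter (U i) < \<delta>"
    using V eF \<open>\<delta> > 0\<close> unfolding U_def by (auto intro: order_le_less_trans)
  ultimately have "hausdorff_premeasure g \<delta> E \<le> (\<Sum>i. ennreal (g (diameter (U i))))"
    unfolding hausdorff_premeasure_def by (intro Inf_lower) auto
  also have "\<dots> = (\<Sum>i<card F. ennreal (g (diameter (U i))))"
    by (intro suminf_finite) (auto simp: U_def g0)
  also have "\<dots> \<le> (\<Sum>i<card F. ennreal (g (d (e i))))"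
  proof (intro sum_mono)
    fix i assume "i \<in> {..<card F}"
    then have i: "e i \<in> F" "U i = V (e i)" using eF unfolding U_def by auto
    show "ennreal (g (diameter (U i))) \<le> ennreal (g (d (e i)))"
    \<comment> \<open>Monotonicity starts above 0, so sets of diameter 0 are treated through
      \<open>g 0 = 0\<close>.\<close>
    proof (cases "diameter (U i) = 0")
      case True
      then show ?thesis using g0 by simp
    next
      case False
      then have "diameter (U i) > 0" using diameter_ge_0 V i by (metis less_eq_real_def)
      then show ?thesis using V[OF i(1)] i(2) by (intro ennreal_leI mono_onD[OF gmono]) auto
    qed
  qed
  also have "\<dots> = ennreal (\<Sum>i<card F. g (d (e i)))"
    using gpos V eF by (intro sum_ennreal) (auto intro: less_imp_le)
  also have "(\<Sum>i<card F. g (d (e i))) = (\<Sum>f\<in>F. g (d f))"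
    by (rule sum.reindex_bij_betw[OF e])
  finally show ?thesis .
qed

definition cell :: "nat \<Rightarrow> int \<Rightarrow> nat \<Rightarrow> nat \<Rightarrow> nat \<Rightarrow> nat \<Rightarrow> bool \<Rightarrow> real set" where
  "cell o' p q n c u b = {x. \<exists>h. (\<forall>i. h (i + 1) - h i = 0 \<or> h (i + 1) - h i = 1) \<and>
     x = cfval (word_digits o' h) \<and> (\<forall>i\<le>n. h (int i) = coded_height p q c u b i)}"

text \<open>Heights up to n determine 2 n - 1 digits, one being lost to the phase. Two digits
  contract by 81/256 < 1/e, and n >= 4 makes up for the missing digit.\<close>

lemma cell_diff:
  assumes "x \<in> cell o' p q n c u b" "y \<in> cell o' p q n c u b" "o' \<le> 1" "4 \<le> n"
  shows "\<bar>x - y\<bar> \<le> exp (- real n)"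
proof -
  obtain h where h: "\<And>i. h (i + 1) - h i = 0 \<or> h (i + 1) - h i = 1" "x = cfval (word_digits o' h)"
    "\<And>i. i \<le> n \<Longrightarrow> h (int i) = coded_height p q c u b i" using assms(1) unfolding cell_def by auto
  obtain k where k: "\<And>i. k (i + 1) - k i = 0 \<or> k (i + 1) - k i = 1" "y = cfval (word_digits o' k)"
    "\<And>i. i \<le> n \<Longrightarrow> k (int i) = coded_height p q c u b i" using assms(2) unfolding cell_def by auto
  have "\<bar>x - y\<bar> \<le> (9/16) ^ (2 * n - 1)"
    unfolding h(2) k(2)
  proof (rule cfval12_close[OF digits12_word_digits[of h, OF h(1)] digits12_word_digits[of k, OF k(1)]])
    fix i assume "i < 2 * n - 1"
    then have "Suc ((i + o') div 2) \<le> n" "(i + o') div 2 \<le> n" using assms(3) by linarith+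
    then have "h (int ((i + o') div 2)) = k (int ((i + o') div 2))"
      "h (int ((i + o') div 2) + 1) = k (int ((i + o') div 2) + 1)"
      using h(3) k(3) by (metis, metis int_Suc)
    then show "word_digits o' h i = word_digits o' k i" unfolding word_digits_def by simp
  qed
  also have "(9/16 :: real) ^ (2 * n - 1) \<le> exp (- real n)"
  proof -
    have e: "exp (1 :: real) \<le> 272/100" using e_less_272 by simp
    have "(9/16 :: real) ^ (2 * n) = (81/256) ^ n" by (simp add: power_mult power2_eq_square)
    moreover have "(9/16 :: real) ^ (2 * n) = (9/16) ^ (2 * n - 1) * (9/16)"
      using assms(4) by (cases n) auto
    moreover have "(81/256 * (272/100)) ^ n \<le> (81/256 * (272/100) :: real) ^ 4"
      using assms(4) by (intro power_decreasing) auto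
    moreover have "(81/256 * (272/100) :: real) ^ 4 \<le> 9/16" by (simp add: power_divide)
    moreover have "(81/256 * exp 1 :: real) ^ n \<le> (81/256 * (272/100)) ^ n"
      using e by (intro power_mono mult_left_mono) auto
    ultimately have "(9/16 :: real) ^ (2 * n - 1) * (9/16) = (81/256) ^ n" "(81/256 * exp 1 :: real) ^ n \<le> 9/16"
      by linarith+
    then have "(9/16) ^ (2 * n - 1) * (9/16) * exp 1 ^ n \<le> (9/16 :: real)"
      by (simp only: power_mult_distrib)
    then have "(9/16) ^ (2 * n - 1) * exp (real n) \<le> (1 :: real)"
      by (simp add: exp_of_nat_mult[symmetric] mult.commute)
    then show ?thesis by (simp add: exp_minus field_simps)
  qed
  finally show ?thesis .
qed

text \<open>The slope of a point selects a triple in \<open>P\<close>, and then the point lies in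
  one of its cells. The coefficient counts two phases, two values of b, q + 1 values of c and n div
  q + 2 values of u.\<close>

lemma K3_cell_cover:
  assumes g: "dimension_function g" and P: "finite P" and \<delta>: "exp (- real n0) < \<delta>" "4 \<le> n0"
    and P_cover: "\<And>\<alpha>. 0 \<le> \<alpha> \<Longrightarrow> \<alpha> \<le> 1 \<Longrightarrow>
      \<exists>(p, q, n)\<in>P. coprime p (int q) \<and> real n * \<bar>real q * \<alpha> - real_of_int p\<bar> < 1"
    and P_n: "\<And>p q n. (p, q, n) \<in> P \<Longrightarrow> 0 < q \<and> n0 \<le> n"
  shows "hausdorff_premeasure g \<delta> K3
    \<le> ennreal (\<Sum>(p, q, n)\<in>P. 4 * (real q + 1) * (real (n div q) + 2) * g (exp (- real n)))"
proof -
  define I where "I = (\<lambda>(p :: int, q :: nat, n :: nat). {0..1::nat} \<times> {0..q} \<times> {0..n div q + 1} \<times> (UNIV :: bool set))"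
  define V where "V = (\<lambda>((p, q, n), o', c, u, b). cell o' p q n c u b)"
  define d where "d = (\<lambda>((p :: int, q :: nat, n), o' :: nat, c :: nat, u :: nat, b :: bool). exp (- real n))"
  have finI: "finite (I t)" for t
  proof -
    obtain p q n where t: "t = (p, q, n)" by (cases t)
    show ?thesis unfolding t I_def prod.case by (intro finite_cartesian_product; simp)
  qed
  have cover: "K3 \<subseteq> (\<Union>f\<in>Sigma P I. V f)"
  proof
    fix x assume "x \<in> K3"
    then obtain o' h where oh: "o' = 0 \<or> o' = 1" "\<And>i. h (i + 1) - h i = 0 \<or> h (i + 1) - h i = 1"
      "balanced h" "h 0 = 0" "x = cfval (word_digits o' h)"
      by (rule K3_balanced) (rule that; assumption)
    obtain \<alpha> where \<alpha>: "0 \<le> \<alpha>" "\<alpha> \<le> 1"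
      "\<And>i n. \<bar>real_of_int (h (i + int n) - h i) - real n * \<alpha>\<bar> \<le> 1"
      using balanced_slope[OF oh(2,3)] by blast
    obtain p q n where pqn: "(p, q, n) \<in> P" "coprime p (int q)" "real n * \<bar>real q * \<alpha> - real_of_int p\<bar> < 1"
      using P_cover[OF \<alpha>(1,2)] by auto
    have "0 < q" using P_n pqn(1) by blast
    then obtain c u b where cub: "c \<le> q" "u \<le> n div q + 1"
      "\<And>i. i \<le> n \<Longrightarrow> h (int i) = coded_height p q c u b i"
      by (rule balanced_coded[OF oh(3,4) \<alpha>(3) _ pqn(2,3)]) (rule that; assumption)
    have "x \<in> V ((p, q, n), o', c, u, b)" unfolding V_def cell_def using oh cub by auto
    moreover have "((p, q, n), o', c, u, b) \<in> Sigma P I"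
      unfolding I_def using pqn cub oh(1) by auto
    ultimately show "x \<in> (\<Union>f\<in>Sigma P I. V f)" by blast
  qed
  have "0 < \<delta>" using \<delta>(1) exp_gt_zero less_trans by blast
  have "hausdorff_premeasure g \<delta> K3 \<le> ennreal (\<Sum>f\<in>Sigma P I. g (d f))"
  proof (rule hausdorff_premeasure_finite_cover[OF g _ \<open>0 < \<delta>\<close> cover])
    show "finite (Sigma P I)" using P finI by (intro finite_SigmaI)
    fix f assume "f \<in> Sigma P I"
    then obtain p q n o' c u b where f: "f = ((p, q, n), o', c, u, b)" "(p, q, n) \<in> P" "o' \<le> 1"
      unfolding I_def by auto
    have n: "4 \<le> n" "n0 \<le> n" using P_n[OF f(2)] \<delta>(2) by auto
    have diff: "\<bar>x - y\<bar> \<le> exp (- real n)" if "x \<in> V f" "y \<in> V f" for x y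
      using cell_diff[of x o' p q n c u b y] that f n unfolding V_def by simp
    have "bounded (V f)"
    proof (cases "V f = {}")
      case False
      then obtain x where "x \<in> V f" by blast
      then show ?thesis unfolding bounded_def dist_real_def using diff by blast
    qed simp
    moreover have "diameter (V f) \<le> exp (- real n)"
      using diff by (intro diameter_le) auto
    moreover have "exp (- real n) < \<delta>" using \<delta>(1) n(2) by (smt (verit) exp_le_cancel_iff of_nat_mono)
    ultimately show "bounded (V f) \<and> diameter (V f) \<le> d f \<and> 0 < d f \<and> d f < \<delta>"
      unfolding d_def f(1) by simp
  qed
  also have "(\<Sum>f\<in>Sigma P I. g (d f)) = (\<Sum>t\<in>P. \<Sum>i\<in>I t. g (d (t, i)))"
    using P finI by (subst sum.Sigma) auto
  also have "\<dots> = (\<Sum>(p, q, n)\<in>P. 4 * (real q + 1) * (real (n div q) + 2) * g (exp (- real n)))"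
  proof (rule sum.cong[OF refl])
    fix t assume "t \<in> P"
    obtain p q n where t: "t = (p, q, n)" by (cases t)
    have "(\<Sum>i\<in>I (p, q, n). g (d ((p, q, n), i))) = (\<Sum>i\<in>I (p, q, n). g (exp (- real n)))"
      unfolding d_def by (intro sum.cong) auto
    also have "\<dots> = real (card (I (p, q, n))) * g (exp (- real n))" by simp
    also have "real (card (I (p, q, n))) = 4 * (real q + 1) * (real (n div q) + 2)"
      unfolding I_def by (simp add: card_cartesian_product algebra_simps)
    finally show "(\<Sum>i\<in>I t. g (d (t, i)))
        = (case t of (p, q, n) \<Rightarrow> 4 * (real q + 1) * (real (n div q) + 2) * g (exp (- real n)))"
      unfolding t prod.case .
  qed
  finally show ?thesis .
qed

text \<open>Summing over all fractions with N <= q <= M would give the order log(M/N)/A. The Vitali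
  covering lemma selects disjoint balls inside [-1, 2], of total length at most 3, at the price of
  radii five times larger, hence 10 against 2.\<close>

lemma fraction_cover:
  fixes N M A :: nat
  assumes "1 \<le> N" "4 \<le> A"
  obtains C :: "(int \<times> nat) set"
  where "finite C" "C \<subseteq> {(p, q). N \<le> q \<and> q \<le> M \<and> coprime p (int q)}"
    "\<And>\<alpha> p q. 0 \<le> \<alpha> \<Longrightarrow> \<alpha> \<le> 1 \<Longrightarrow> N \<le> q \<Longrightarrow> q \<le> M \<Longrightarrow> coprime p (int q) \<Longrightarrow>
       \<bar>\<alpha> - of_int p / real q\<bar> < 2 / (real A * (real q)\<^sup>2) \<Longrightarrow>
       \<exists>(p', q')\<in>C. \<bar>\<alpha> - of_int p' / real q'\<bar> < 10 / (real A * (real q')\<^sup>2)"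
    "(\<Sum>(p, q)\<in>C. 4 / (real A * (real q)\<^sup>2)) \<le> 3"
proof -
  define K where "K = {(p, q). N \<le> q \<and> q \<le> M \<and> coprime p (int q) \<and> 0 \<le> p \<and> p \<le> int q}"
  define a where "a = (\<lambda>(p, q). of_int p / real q)"
  define r where "r = (\<lambda>(p :: int, q). 2 / (real A * (real q)\<^sup>2))"
  have finK: "finite K"
  proof (rule finite_subset)
    show "K \<subseteq> {0..int M} \<times> {0..M}" unfolding K_def by auto
  qed simp
  have r: "0 < r i \<and> r i \<le> 1/2" if iK: "i \<in> K" for i
  proof -
    obtain p q where i: "i = (p, q)" "N \<le> q" using iK unfolding K_def by auto
    have q: "1 \<le> real q" using i assms(1) by simp
    then have "1 \<le> (real q)\<^sup>2" by (rule one_le_power)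
    then have "4 * 1 \<le> real A * (real q)\<^sup>2" using assms(2) by (intro mult_mono) auto
    then show ?thesis unfolding r_def i using q by (auto simp: field_simps)
  qed
  obtain C where C: "C \<subseteq> K" "pairwise (\<lambda>i j. disjnt (ball (a i) (r i)) (ball (a j) (r j))) C"
    "(\<Union>i\<in>K. ball (a i) (r i)) \<subseteq> (\<Union>i\<in>C. ball (a i) (5 * r i))"
    using Vitali_covering_lemma_balls[where S = "\<Union>i\<in>K. ball (a i) (r i)" and K = K and a = a
        and r = r and B = "1/2"] r by auto
  have finC: "finite C" using C(1) finK finite_subset by blast
  have sub: "C \<subseteq> {(p, q). N \<le> q \<and> q \<le> M \<and> coprime p (int q)}" using C(1) unfolding K_def by auto
  have "(\<Sum>i\<in>C. 2 * r i) \<le> 3"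
  proof -
    have "(\<Sum>i\<in>C. 2 * r i) = (\<Sum>i\<in>C. measure lborel (ball (a i) (r i)))"
      using r C(1) by (intro sum.cong) (auto simp: ball_eq_greaterThanLessThan less_imp_le subset_iff)
    also have "\<dots> = measure lborel (\<Union>i\<in>C. ball (a i) (r i))"
    proof (rule measure_finite_Union[symmetric])
      show "disjoint_family_on (\<lambda>i. ball (a i) (r i)) C"
        using C(2) unfolding disjoint_family_on_def pairwise_def disjnt_def by blast
      show "emeasure lborel (ball (a i) (r i)) \<noteq> \<infinity>" for i
        using emeasure_lborel_ball_finite[of "a i" "r i"] by (rule less_imp_neq)
    qed (use finC in auto)
    also have "\<dots> \<le> measure lborel {-1..2::real}"
    proof (rule measure_mono_fmeasurable)
      show "(\<Union>i\<in>C. ball (a i) (r i)) \<subseteq> {-1..2}"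
      proof (intro UN_least)
        fix i assume i: "i \<in> C"
        then obtain p q where pq: "i = (p, q)" "0 \<le> p" "p \<le> int q" "N \<le> q" using C(1) unfolding K_def by auto
        have "0 \<le> a i" "a i \<le> 1" unfolding a_def pq(1) using pq assms(1) by (auto simp: field_simps)
        then show "ball (a i) (r i) \<subseteq> {-1..2}"
          using r[of i] C(1) i unfolding ball_eq_greaterThanLessThan by auto
      qed
    qed (use finC in \<open>auto intro!: fmeasurableI\<close>)
    finally show ?thesis by simp
  qed
  then have sum_le: "(\<Sum>(p, q)\<in>C. 4 / (real A * (real q)\<^sup>2)) \<le> 3"
    unfolding r_def by (simp add: case_prod_beta)
  have approx: "\<exists>(p', q')\<in>C. \<bar>\<alpha> - of_int p' / real q'\<bar> < 10 / (real A * (real q')\<^sup>2)"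
    if \<alpha>: "0 \<le> \<alpha>" "\<alpha> \<le> 1" and q: "N \<le> q" "q \<le> M" "coprime p (int q)"
      and close: "\<bar>\<alpha> - of_int p / real q\<bar> < 2 / (real A * (real q)\<^sup>2)" for \<alpha> p q
  proof -
    have q1: "1 \<le> real q" using q assms(1) by simp
    have "2 / (real A * (real q)\<^sup>2) \<le> 1 / real q"
    proof -
      have "4 * (real q * 1) \<le> real A * (real q * real q)"
        using assms(2) q1 by (intro mult_mono) auto
      then have "2 * real q \<le> real A * (real q)\<^sup>2" using q1 by (simp add: power2_eq_square)
      then show ?thesis using q1 assms(2) by (simp add: field_simps)
    qed
    then have "real q * \<bar>\<alpha> - of_int p / real q\<bar> < 1" using close q1 by (simp add: field_simps)
    then have "\<bar>real q * \<alpha> - real_of_int p\<bar> < 1" using q1 by (simp add: abs_diff_fraction)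
    then have "0 \<le> p" "p \<le> int q" using numerator_bounds[OF \<alpha>] by auto
    then have K: "(p, q) \<in> K" unfolding K_def using q by simp
    have "\<alpha> \<in> ball (a (p, q)) (r (p, q))"
      unfolding a_def r_def using close by (simp add: dist_real_def abs_minus_commute)
    then obtain j where "j \<in> C" "\<alpha> \<in> ball (a j) (5 * r j)" using C(3) K by blast
    then show ?thesis
      by (intro bexI[of _ j]) (auto simp: a_def r_def dist_real_def abs_minus_commute split: prod.splits)
  qed
  show thesis by (rule that[OF finC sub approx sum_le])
qed

text \<open>Words of length q T serve the selected fractions; words of length M serve the at most
  N^2 fractions with q < N and the bad ones. The 24 bounds 4 (q + 1) (T + 2) by 4 (2 q) (3
  T).\<close>

definition cover_cost :: "(real \<Rightarrow> real) \<Rightarrow> (int \<times> nat) set \<Rightarrow> nat \<Rightarrow> nat \<Rightarrow> nat \<Rightarrow> nat \<Rightarrow> real \<Rightarrow> real" where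
  "cover_cost g C N M T A s = 24 *
      ((\<Sum>(p, q)\<in>C. real (q * T) * g (exp (- real (q * T)))) +
       ((real N)\<^sup>2 + exceptional_bound N M A s) * (real M * g (exp (- real M))))"

text \<open>A = 10 T turns the radius 10/(A q^2) of \<open>fraction_cover\<close> into 1/(q (q T)),
  the closeness that words of length q T demand. A slope without such an approximation takes its
  fraction from the Dirichlet theorem for M: either q < N, or the fraction is a bad one.\<close>

lemma K3_premeasure_bound:
  fixes N M T A :: nat and s :: real
  assumes g: "dimension_function g" and \<delta>: "exp (- real N) < \<delta>" and N: "4 \<le> N" "N \<le> M"
    and T: "1 \<le> T" and A: "A = 10 * T" and s: "s = 1 / (5 * (real A + 2))"
  obtains C :: "(int \<times> nat) set"
  where "finite C" "C \<subseteq> {(p, q). N \<le> q \<and> q \<le> M}" "(\<Sum>(p, q)\<in>C. 1 / ((real q)\<^sup>2 * real T)) \<le> 15 / 2"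
    "hausdorff_premeasure g \<delta> K3 \<le> ennreal (cover_cost g C N M T A s)"
proof -
  have gpos: "\<And>r. r > 0 \<Longrightarrow> g r > 0" using g unfolding dimension_function_def by auto
  obtain C where C: "finite C" "C \<subseteq> {(p, q). N \<le> q \<and> q \<le> M \<and> coprime p (int q)}"
    "\<And>\<alpha> p q. 0 \<le> \<alpha> \<Longrightarrow> \<alpha> \<le> 1 \<Longrightarrow> N \<le> q \<Longrightarrow> q \<le> M \<Longrightarrow> coprime p (int q) \<Longrightarrow>
       \<bar>\<alpha> - of_int p / real q\<bar> < 2 / (real A * (real q)\<^sup>2) \<Longrightarrow>
       \<exists>(p', q')\<in>C. \<bar>\<alpha> - of_int p' / real q'\<bar> < 10 / (real A * (real q')\<^sup>2)"
    "(\<Sum>(p, q)\<in>C. 4 / (real A * (real q)\<^sup>2)) \<le> 3"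
  proof -
    have "1 \<le> N" "4 \<le> A" using N T A by auto
    from fraction_cover[OF this, of M] that show thesis by blast
  qed
  define B where "B = bad_fractions N M A"
  have B: "finite B" "real (card B) \<le> exceptional_bound N M A s"
    unfolding B_def using card_bad_fractions[of N A s M] N T A s by auto
  note B_def = B_def[unfolded bad_fractions_def]
  define S where "S = {(p, q). 1 \<le> q \<and> q < N \<and> 0 \<le> p \<and> p \<le> int q}"
  have S_sub: "S \<subseteq> {0..<int N} \<times> {0..<N}" unfolding S_def by auto
  have finS: "finite S" by (rule finite_subset[OF S_sub]) simp
  have "card S \<le> card ({0..<int N} \<times> {0..<N})" by (rule card_mono[OF _ S_sub]) simp
  then have "card S \<le> N * N" by (simp add: card_cartesian_product)
  then have cardS: "real (card S) \<le> (real N)\<^sup>2"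
    by (metis of_nat_le_iff of_nat_mult power2_eq_square)
  define P1 where "P1 = (\<lambda>(p, q). (p, q, q * T)) ` C"
  define P2 where "P2 = (\<lambda>(p, q). (p, q, M)) ` (S \<union> B)"
  have M0: "0 < M" using N by simp
  have fin: "finite P1" "finite P2" unfolding P1_def P2_def using C(1) finS B(1) by auto
  have pre: "hausdorff_premeasure g \<delta> K3
    \<le> ennreal (\<Sum>(p, q, n)\<in>P1 \<union> P2. 4 * (real q + 1) * (real (n div q) + 2) * g (exp (- real n)))"
  proof (rule K3_cell_cover[OF g _ \<delta> N(1)])
    show "finite (P1 \<union> P2)" using fin by simp
    show "0 < q \<and> N \<le> n" if "(p, q, n) \<in> P1 \<union> P2" for p q n
    proof -
      have "N \<le> q * T" if "N \<le> q" for q using that T by (metis mult_le_mono mult.right_neutral)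
      then show ?thesis using that C(2) N unfolding P1_def P2_def S_def B_def by auto
    qed
    fix \<alpha> :: real assume \<alpha>: "0 \<le> \<alpha>" "\<alpha> \<le> 1"
    show "\<exists>(p, q, n)\<in>P1 \<union> P2. coprime p (int q) \<and> real n * \<bar>real q * \<alpha> - real_of_int p\<bar> < 1"
    proof (cases "\<exists>p q. N \<le> q \<and> q \<le> M \<and> coprime p (int q) \<and>
        \<bar>\<alpha> - of_int p / real q\<bar> < 2 / (real A * (real q)\<^sup>2)")
      case True
      then obtain p q where pq: "(p, q) \<in> C" "\<bar>\<alpha> - of_int p / real q\<bar> < 10 / (real A * (real q)\<^sup>2)"
        using C(3)[OF \<alpha>] by fast
      have q: "0 < real q" "coprime p (int q)" using pq(1) C(2) N by auto
      have "real (q * T) * \<bar>real q * \<alpha> - real_of_int p\<bar>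
          = real (q * T) * (real q * \<bar>\<alpha> - of_int p / real q\<bar>)"
        using q(1) by (simp add: abs_diff_fraction)
      also have "\<dots> < real (q * T) * (real q * (10 / (real A * (real q)\<^sup>2)))"
        using pq(2) q T by (intro mult_strict_left_mono) auto
      also have "\<dots> = 1" using q T unfolding A by (simp add: field_simps power2_eq_square)
      finally have "real (q * T) * \<bar>real q * \<alpha> - real_of_int p\<bar> < 1" .
      moreover have "(p, q, q * T) \<in> P1 \<union> P2" unfolding P1_def using pq(1) by force
      ultimately show ?thesis using q(2) by blast
    next
      case False
      obtain p k where pk: "coprime p k" "0 < k" "k \<le> int M" "\<bar>of_int k * \<alpha> - of_int p\<bar> < 1 / real M"
        using Dirichlet_approx_coprime[OF M0, of \<alpha>] by metis
      define q where "q = nat k"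
      have q: "coprime p (int q)" "0 < q" "q \<le> M" "\<bar>real q * \<alpha> - real_of_int p\<bar> < 1 / real M"
        using pk unfolding q_def by auto
      have lt: "real M * \<bar>real q * \<alpha> - real_of_int p\<bar> < 1" using q(4) M0 by (simp add: field_simps)
      have "1 / real M \<le> 1" using M0 by simp
      then have "\<bar>real q * \<alpha> - real_of_int p\<bar> < 1" using q(4) by linarith
      then have p: "0 \<le> p" "p \<le> int q" using numerator_bounds[OF \<alpha>] by auto
      have "(p, q) \<in> S \<union> B"
      proof (cases "q < N")
        case True
        then show ?thesis unfolding S_def using p q(2) by simp
      next
        case qN: False
        have "\<bar>\<alpha> - of_int p / real q\<bar> = \<bar>real q * \<alpha> - real_of_int p\<bar> / real q"
          using q(2) by (intro abs_diff_fraction) simp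
        also have "\<dots> < (1 / real M) / real q" using q by (intro divide_strict_right_mono) auto
        finally have "\<bar>\<alpha> - of_int p / real q\<bar> < 1 / (real q * real M)" by (simp add: mult.commute)
        moreover have "2 / (real A * (real q')\<^sup>2) \<le> \<bar>\<alpha> - of_int p' / real q'\<bar>"
          if "N \<le> q'" "q' \<le> M" "coprime p' (int q')" for p' q'
          using False that by (meson not_le)
        ultimately show ?thesis unfolding B_def using qN q p by auto
      qed
      then have "(p, q, M) \<in> P1 \<union> P2" unfolding P2_def by force
      then show ?thesis using q(1) lt by blast
    qed
  qed
  define cost where "cost = (\<lambda>(p :: int, q, n). 4 * (real q + 1) * (real (n div q) + 2) * g (exp (- real n)))"
  have cost_nonneg: "0 \<le> cost t" for t unfolding cost_def using gpos by (auto simp: less_imp_le split: prod.splits)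
  have g0: "0 \<le> g (exp t)" for t using gpos[of "exp t"] by simp
  have "(\<Sum>t\<in>P1 \<union> P2. cost t) \<le> (\<Sum>t\<in>P1. cost t) + (\<Sum>t\<in>P2. cost t)"
    using sum_Un2[of P1 P2 cost] sum_nonneg[of "P1 \<inter> P2" cost] sum.union_inter[OF fin, of cost] cost_nonneg by simp
  also have "(\<Sum>t\<in>P1. cost t) \<le> (\<Sum>(p, q)\<in>C. 24 * (real (q * T) * g (exp (- real (q * T)))))"
  proof -
    have "(\<Sum>t\<in>P1. cost t) = (\<Sum>i\<in>C. cost (case i of (p, q) \<Rightarrow> (p, q, q * T)))"
      unfolding P1_def by (subst sum.reindex) (auto simp: inj_on_def)
    also have "\<dots> \<le> (\<Sum>(p, q)\<in>C. 24 * (real (q * T) * g (exp (- real (q * T)))))"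
    proof (intro sum_mono, clarify)
      fix p q assume "(p, q) \<in> C"
      then have q: "1 \<le> real q" using C(2) N by auto
      then have "q * T div q = T" by simp
      moreover have "4 * (real q + 1) * (real T + 2) \<le> 4 * (2 * real q) * (3 * real T)"
        using q T by (intro mult_mono) auto
      then have "4 * (real q + 1) * (real T + 2) * g (exp (- real (q * T)))
          \<le> 24 * real (q * T) * g (exp (- real (q * T)))"
        using g0 by (intro mult_right_mono) auto
      ultimately show "cost (p, q, q * T) \<le> 24 * (real (q * T) * g (exp (- real (q * T))))"
        unfolding cost_def by (simp only: prod.case mult.assoc)
    qed
    finally show ?thesis .
  qed
  also have "(\<Sum>t\<in>P2. cost t) \<le> (\<Sum>(p, q)\<in>S \<union> B. 24 * (real M * g (exp (- real M))))"
  proof -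
    have "(\<Sum>t\<in>P2. cost t) = (\<Sum>i\<in>S \<union> B. cost (case i of (p, q) \<Rightarrow> (p, q, M)))"
      unfolding P2_def by (subst sum.reindex) (auto simp: inj_on_def)
    also have "\<dots> \<le> (\<Sum>(p, q)\<in>S \<union> B. 24 * (real M * g (exp (- real M))))"
    proof (intro sum_mono, clarify)
      fix p q assume "(p, q) \<in> S \<union> B"
      then have q: "1 \<le> real q" "q \<le> M" using N unfolding S_def B_def by auto
      have "real (M div q) \<le> real M / real q"
        by (metis floor_divide_of_nat_eq of_int_floor_le of_int_of_nat_eq)
      moreover have "1 \<le> real M / real q" using q by (simp add: field_simps)
      ultimately have "real (M div q) + 2 \<le> 3 * (real M / real q)" by linarith
      then have "4 * (real q + 1) * (real (M div q) + 2) \<le> 4 * (2 * real q) * (3 * (real M / real q))"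
        using q by (intro mult_mono) auto
      also have "\<dots> = 24 * real M" using q by simp
      finally have "4 * (real q + 1) * (real (M div q) + 2) * g (exp (- real M)) \<le> 24 * real M * g (exp (- real M))"
        using g0 by (intro mult_right_mono) auto
      then show "cost (p, q, M) \<le> 24 * (real M * g (exp (- real M)))"
        unfolding cost_def by (simp only: prod.case mult.assoc)
    qed
    finally show ?thesis .
  qed
  also have "(\<Sum>(p, q)\<in>S \<union> B. 24 * (real M * g (exp (- real M))))
      = real (card (S \<union> B)) * (24 * (real M * g (exp (- real M))))" by (simp add: case_prod_beta)
  also have "\<dots> \<le> ((real N)\<^sup>2 + exceptional_bound N M A s)
      * (24 * (real M * g (exp (- real M))))"
  proof (rule mult_right_mono)
    have "real (card (S \<union> B)) \<le> real (card S) + real (card B)"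
      using card_Un_le[of S B] by (metis of_nat_add of_nat_le_iff)
    then show "real (card (S \<union> B)) \<le> (real N)\<^sup>2 + exceptional_bound N M A s"
      using cardS B(2) by linarith
  qed (use g0 in auto)
  also have "(\<Sum>(p, q)\<in>C. 24 * (real (q * T) * g (exp (- real (q * T)))))
      = 24 * (\<Sum>(p, q)\<in>C. real (q * T) * g (exp (- real (q * T))))"
    by (simp add: sum_distrib_left case_prod_beta)
  finally have total: "(\<Sum>t\<in>P1 \<union> P2. cost t) \<le> cover_cost g C N M T A s"
    by (simp add: cover_cost_def algebra_simps)
  show thesis
  proof (rule that[OF C(1)])
    show "C \<subseteq> {(p, q). N \<le> q \<and> q \<le> M}" using C(2) by auto
    have "(\<Sum>(p, q)\<in>C. 4 / (real A * (real q)\<^sup>2)) = (2 / 5) * (\<Sum>(p, q)\<in>C. 1 / ((real q)\<^sup>2 * real T))"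
      unfolding A by (simp add: sum_distrib_left case_prod_beta field_simps)
    then show "(\<Sum>(p, q)\<in>C. 1 / ((real q)\<^sup>2 * real T)) \<le> 15 / 2" using C(4) by simp
    show "hausdorff_premeasure g \<delta> K3 \<le> ennreal (cover_cost g C N M T A s)"
      using order_trans[OF pre[folded cost_def] ennreal_leI[OF total]] .
  qed
qed

lemma hausdorff_measure_le:
  assumes "\<And>\<delta>. 0 < \<delta> \<Longrightarrow> hausdorff_premeasure h \<delta> E \<le> c"
  shows "hausdorff_measure h E \<le> c"
proof (rule tendsto_upperbound[OF hausdorff_premeasure_tendsto])
  show "\<forall>\<^sub>F \<delta> in at_right 0. hausdorff_premeasure h \<delta> E \<le> c"
    using eventually_at_right_less by eventually_elim (rule assms)
qed simp

lemma K3_measure_finite: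
  assumes "dimension_function_given_by g (\<lambda>\<epsilon>. ln \<bar>ln \<epsilon>\<bar> / (\<bar>ln \<epsilon>\<bar> ^ 3 * ln (ln \<bar>ln \<epsilon>\<bar>)))"
  shows "hausdorff_measure g K3 < \<infinity>"
proof -
  have g: "dimension_function g" using assms unfolding dimension_function_given_by_def by simp
  obtain b where b: "b > 0" "\<And>\<epsilon>. 0 < \<epsilon> \<Longrightarrow> \<epsilon> < b \<Longrightarrow>
      g \<epsilon> = ln \<bar>ln \<epsilon>\<bar> / (\<bar>ln \<epsilon>\<bar> ^ 3 * ln (ln \<bar>ln \<epsilon>\<bar>))"
    using assms unfolding dimension_function_given_by_def eventually_at_right_field by auto
  \<comment> \<open>With A + 2 <= 12 T and T <= L/(c ln L), the choice 120 = 5 * 12 * 2 makes s L at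
    least 2 ln L.\<close>
  define c :: real where "c = 120"
  define K where "K = 24 * (45 * c + 3 + 1440)"
  have "hausdorff_premeasure g \<delta> K3 \<le> ennreal K" if "0 < \<delta>" for \<delta>
  proof -
    have "\<forall>\<^sub>F N in sequentially. exp (- real N) < b \<and> exp (- real N) < \<delta> \<and> 4 \<le> N \<and>
        1 \<le> ln (ln (real N)) \<and> c * ln (ln (real N)) \<le> ln (real N)"
    proof (intro eventually_conj)
      have lim: "((\<lambda>N. exp (- real N)) \<longlongrightarrow> 0) sequentially" by real_asymp
      show "\<forall>\<^sub>F N in sequentially. exp (- real N) < b" by (rule order_tendstoD(2)[OF lim b(1)])
      show "\<forall>\<^sub>F N in sequentially. exp (- real N) < \<delta>" by (rule order_tendstoD(2)[OF lim that])
      show "\<forall>\<^sub>F N in sequentially. 1 \<le> ln (ln (real N))" by real_asymp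
      show "\<forall>\<^sub>F N in sequentially. c * ln (ln (real N)) \<le> ln (real N)"
        unfolding c_def by real_asymp
    qed (rule eventually_ge_at_top)
    then obtain N :: nat where N: "exp (- real N) < b" "exp (- real N) < \<delta>" "4 \<le> N"
      "1 \<le> ln (ln (real N))" "c * ln (ln (real N)) \<le> ln (real N)"
      by (auto simp: eventually_sequentially)
    define L where "L = ln (real N)"
    have L: "1 \<le> ln L" "c * ln L \<le> L" using N unfolding L_def by auto
    have L1: "120 \<le> L" using L unfolding c_def by simp
    have LN: "L \<le> real N" unfolding L_def using N(3) ln_le_minus_one[of "real N"] by simp
    define M where "M = N * N"
    define T where "T = nat \<lfloor>L / (c * ln L)\<rfloor>"
    have quot: "1 \<le> L / (c * ln L)" using L unfolding c_def by (simp add: field_simps)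
    have "1 \<le> T" unfolding T_def using quot by (intro le_nat_floor) simp
    moreover have "real T = real_of_int \<lfloor>L / (c * ln L)\<rfloor>" unfolding T_def using quot by simp
    ultimately have T: "1 \<le> T" "real T \<le> L / (c * ln L)" "L / (c * ln L) \<le> 2 * real T"
      by linarith+
    have TL: "real T \<le> L"
    proof -
      have "L / (c * ln L) \<le> L / 1" using L L1 unfolding c_def by (intro divide_left_mono) auto
      then show ?thesis using T(2) by simp
    qed
    define A where "A = 10 * T"
    define s where "s = 1 / (5 * (real A + 2))"
    have MN: "N \<le> M" unfolding M_def by simp
    have g_val: "g (exp (- real n)) = ln (real n) / (real n ^ 3 * ln (ln (real n)))" if "N \<le> n" for n
    proof -
      have "exp (- real n) \<le> exp (- real N)" using that by simp
      then have "exp (- real n) < b" using N(1) by linarith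
      then show ?thesis using b(2)[of "exp (- real n)"] by simp
    qed
    \<comment> \<open>All word lengths lie between N and M N = N^3, where the two logarithms in the
      gauge are bounded by multiples of L and ln L.\<close>
    have g_le: "g (exp (- real n)) \<le> 3 * L / (real n ^ 3 * ln L)" if "N \<le> n" "n \<le> N ^ 3" for n
    proof -
      have n: "0 < real n" "real N \<le> real n" using that N(3) by auto
      have "ln (real n) \<le> ln (real N ^ 3)" using that n by (metis ln_le_cancel_iff less_le_trans of_nat_le_iff of_nat_power)
      then have "ln (real n) \<le> 3 * L" unfolding L_def using N(3) by (simp add: ln_realpow)
      moreover have "L \<le> ln (real n)" unfolding L_def using n N(3) by simp
      then have "ln L \<le> ln (ln (real n))" using L1 by simp
      ultimately show ?thesis
        unfolding g_val[OF that(1)] using n L L1 by (intro frac_le mult_left_mono mult_pos_pos) auto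
    qed
    obtain C :: "(int \<times> nat) set" where C: "finite C" "C \<subseteq> {(p, q). N \<le> q \<and> q \<le> M}"
      "(\<Sum>(p, q)\<in>C. 1 / ((real q)\<^sup>2 * real T)) \<le> 15 / 2"
      "hausdorff_premeasure g \<delta> K3 \<le> ennreal (cover_cost g C N M T A s)"
      by (rule K3_premeasure_bound[OF g N(2,3) MN T(1) A_def s_def]) (rule that; assumption)
    have "(\<Sum>(p, q)\<in>C. real (q * T) * g (exp (- real (q * T)))) \<le> (\<Sum>(p, q)\<in>C. 6 * c * (1 / ((real q)\<^sup>2 * real T)))"
    proof (intro sum_mono, clarify)
      fix p q assume "(p, q) \<in> C"
      then have q: "N \<le> q" "q \<le> M" using C(2) by auto
      have pos: "0 < real q" "0 < real T" using q N(3) T(1) by auto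
      have qT: "N \<le> q * T" using q T(1) by (metis mult_le_mono mult.right_neutral)
      have "real T \<le> real N" using TL LN by simp
      then have "T \<le> N" by simp
      then have "q * T \<le> M * N" using q by (intro mult_le_mono) auto
      then have "q * T \<le> N ^ 3" unfolding M_def by (simp add: power3_eq_cube)
      then have "real (q * T) * g (exp (- real (q * T))) \<le> real (q * T) * (3 * L / (real (q * T) ^ 3 * ln L))"
        using g_le[OF qT] by (intro mult_left_mono) auto
      \<comment> \<open>The factor L / ln L of the gauge is at most 2 c T. It cancels one power of
        T, and the cost becomes a multiple of the length 1/(q^2 T).\<close>
      also have "\<dots> = 3 * c * (L / (c * ln L)) / (real (q * T))\<^sup>2"
        using pos L unfolding c_def by (simp add: field_simps power2_eq_square power3_eq_cube)
      also have "\<dots> \<le> 3 * c * (2 * real T) / (real (q * T))\<^sup>2"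
        using T(3) unfolding c_def by (intro divide_right_mono mult_left_mono) auto
      also have "\<dots> = 6 * c * (1 / ((real q)\<^sup>2 * real T))"
        using pos by (simp add: field_simps power2_eq_square)
      finally show "real (q * T) * g (exp (- real (q * T))) \<le> 6 * c * (1 / ((real q)\<^sup>2 * real T))" .
    qed
    also have "\<dots> = 6 * c * (\<Sum>(p, q)\<in>C. 1 / ((real q)\<^sup>2 * real T))"
      by (simp add: sum_distrib_left case_prod_beta)
    also have "\<dots> \<le> 6 * c * (15 / 2)" using C(3) unfolding c_def by (intro mult_left_mono) auto
    finally have good: "(\<Sum>(p, q)\<in>C. real (q * T) * g (exp (- real (q * T)))) \<le> 45 * c" by simp
    have Npos: "0 < real N" using N(3) by simp
    have "M \<le> N ^ 3"
    proof -
      have "N * N * 1 \<le> N * N * N" using N(3) by (intro mult_le_mono) auto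
      then show ?thesis unfolding M_def by (simp add: power3_eq_cube)
    qed
    then have "real M * g (exp (- real M)) \<le> real M * (3 * L / (real M ^ 3 * ln L))"
      using g_le[OF MN] by (intro mult_left_mono) auto
    also have "\<dots> \<le> real M * (3 * L / (real M ^ 3 * 1))"
      using L L1 MN N(3) by (intro mult_left_mono divide_left_mono) auto
    also have "\<dots> = 3 * L / (real M)\<^sup>2" using MN N(3) by (simp add: field_simps power2_eq_square power3_eq_cube)
    finally have gM: "real M * g (exp (- real M)) \<le> 3 * L / (real M)\<^sup>2" .
    have part1: "(real N)\<^sup>2 * (3 * L / (real M)\<^sup>2) \<le> 3"
    proof -
      have "(real N)\<^sup>2 * (3 * L / (real M)\<^sup>2) = 3 * L / (real N)\<^sup>2"
        unfolding M_def using Npos by (simp add: field_simps power2_eq_square)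
      also have "\<dots> \<le> 3"
      proof -
        have "L * 1 \<le> real N * real N" using LN L1 N(3) by (intro mult_mono) auto
        then show ?thesis using Npos by (simp add: field_simps power2_eq_square)
      qed
      finally show ?thesis .
    qed
    have A2: "0 < real A + 2" "real A + 2 \<le> 12 * real T" unfolding A_def using T(1) by auto
    have part2: "exceptional_bound N M A s * (3 * L / (real M)\<^sup>2) \<le> 1440"
    proof -
      have "real M powr (2 - s) = (real M)\<^sup>2 * real M powr (- s)"
        using MN N(3) by (simp add: powr_diff powr_minus_divide powr_numeral)
      moreover have "real M powr (- s) = real N powr (- s) * real N powr (- s)"
        unfolding M_def by (simp add: powr_mult)
      moreover have "real N powr (- s) * real N powr s = 1" using Npos by (simp flip: powr_add)
      ultimately have eq: "real M powr (2 - s) * real N powr s = (real M)\<^sup>2 * real N powr (- s)"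
        by (metis (no_types, lifting) mult.assoc mult.right_neutral)
      \<comment> \<open>This gives N^(-s) <= 1/L^2, which cancels one L from the gauge and another
        from A + 2.\<close>
      have "2 * ln L \<le> s * L"
      proof -
        have "real A + 2 \<le> 12 * (L / (c * ln L))" using A2 T(2) by linarith
        then have "(real A + 2) * (10 * ln L) \<le> L" using L unfolding c_def by (simp add: field_simps)
        then show ?thesis unfolding s_def using A2 by (simp add: field_simps)
      qed
      then have "real N powr (- s) \<le> exp (- 2 * ln L)"
        using Npos unfolding powr_def L_def[symmetric] by simp
      also have "\<dots> = 1 / L\<^sup>2"
      proof -
        have "exp (2 * ln L) = L\<^sup>2" using L1 by (simp add: exp_double)
        then show ?thesis by (simp add: exp_minus inverse_eq_divide)
      qed
      finally have Ns: "real N powr (- s) \<le> 1 / L\<^sup>2" .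
      have "exceptional_bound N M A s * (3 * L / (real M)\<^sup>2)
          = 120 * L * ((real A + 2) * real N powr (- s))"
        unfolding exceptional_bound_def eq using MN N(3) by simp
      also have "\<dots> \<le> 120 * L * ((12 * L) * (1 / L\<^sup>2))"
        using Ns A2 TL L1 by (intro mult_left_mono mult_mono) auto
      also have "\<dots> = 1440" using L1 by (simp add: power2_eq_square)
      finally show ?thesis .
    qed
    have "((real N)\<^sup>2 + exceptional_bound N M A s) * (real M * g (exp (- real M)))
        \<le> ((real N)\<^sup>2 + exceptional_bound N M A s) * (3 * L / (real M)\<^sup>2)"
      using gM A2 by (intro mult_left_mono) (auto simp: exceptional_bound_def)
    also have "\<dots> \<le> 3 + 1440"
      unfolding distrib_right by (rule add_mono[OF part1 part2])
    finally have "cover_cost g C N M T A s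
      \<le> 24 * (45 * c + (3 + 1440))"
      unfolding cover_cost_def by (intro mult_left_mono add_mono[OF good]) auto
    then have "cover_cost g C N M T A s \<le> K"
      unfolding K_def by (simp only: add.assoc)
    then show ?thesis by (rule order_trans[OF C(4) ennreal_leI])
  qed
  then have "hausdorff_measure g K3 \<le> ennreal K" by (rule hausdorff_measure_le)
  then show ?thesis using le_less_trans ennreal_less_top by (metis infinity_ennreal_def)
qed

section \<open>The lower bound\<close>

text \<open>Chosen so that the excluded lengths telescope to at most 1/(4 ln 2) <= 1/2. The shift q
  + 2 keeps the logarithms away from 0.\<close>

definition excluded_radius :: "nat \<Rightarrow> real" where
  "excluded_radius q = 1 / (16 * real q * (real q + 2) * (ln (real q + 2))\<^sup>2)"

definition excluded_balls :: "nat \<Rightarrow> real set" where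
  "excluded_balls q = (\<Union>p\<in>{0..q}. ball (real p / real q) (excluded_radius q))"

definition slope_set :: "real set" where
  "slope_set = {0..1} - (\<Union>k. excluded_balls (Suc k))"

lemma ln_ge_half: "2 \<le> x \<Longrightarrow> 1/2 \<le> ln (x :: real)"
  using ln2_ge_two_thirds ln_mono[of 2 x] by linarith

text \<open>Discrete form of the derivative of -1/ln; it rests on ln (m + 1) - ln m >= 1/(m +
  1).\<close>

lemma inverse_ln_telescope:
  fixes m :: real
  assumes "2 \<le> m"
  shows "1 / ((m + 1) * (ln (m + 1))\<^sup>2) \<le> 1 / ln m - 1 / ln (m + 1)"
proof -
  have pos: "0 < ln m" "0 < ln (m + 1)" "ln m \<le> ln (m + 1)" using assms by auto
  have "ln (m / (m + 1)) \<le> m / (m + 1) - 1" using assms by (intro ln_le_minus_one) auto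
  then have diff: "1 / (m + 1) \<le> ln (m + 1) - ln m" using assms by (simp add: ln_div field_simps)
  have "1 / ((m + 1) * (ln (m + 1))\<^sup>2) = (1 / (m + 1)) / (ln (m + 1) * ln (m + 1))"
    by (simp add: power2_eq_square)
  also have "\<dots> \<le> (ln (m + 1) - ln m) / (ln m * ln (m + 1))"
    using diff pos assms by (intro frac_le mult_right_mono) auto
  also have "\<dots> = 1 / ln m - 1 / ln (m + 1)" using pos by (simp add: field_simps)
  finally show ?thesis .
qed

lemma excluded_radius_pos: "0 < q \<Longrightarrow> 0 < excluded_radius q"
  unfolding excluded_radius_def by auto

lemma emeasure_excluded_balls:
  "emeasure lborel (excluded_balls (Suc k))
     \<le> ennreal (1/4 * (1 / ln (real k + 2) - 1 / ln (real (Suc k) + 2)))"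
proof -
  define q where "q = Suc k"
  have r: "0 < excluded_radius q" using excluded_radius_pos[of q] unfolding q_def by simp
  have "emeasure lborel (excluded_balls q) \<le> (\<Sum>p\<in>{0..q}. emeasure lborel (ball (real p / real q) (excluded_radius q)))"
    unfolding excluded_balls_def by (intro emeasure_subadditive_finite) auto
  also have "\<dots> = (\<Sum>p\<in>{0..q}. ennreal (2 * excluded_radius q))"
    using r by (intro sum.cong) (auto simp: ball_eq_greaterThanLessThan)
  also have "\<dots> = ennreal (\<Sum>p\<in>{0..q}. 2 * excluded_radius q)"
    using r by (intro sum_ennreal) auto
  also have "(\<Sum>p\<in>{0..q}. 2 * excluded_radius q) = (real q + 1) * (2 * excluded_radius q)" by simp
  also have "\<dots> \<le> (2 * real q) * (2 * excluded_radius q)"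
    using r unfolding q_def by (intro mult_right_mono) auto
  also have "\<dots> = 1/4 * (1 / ((real q + 2) * (ln (real q + 2))\<^sup>2))"
  proof -
    have "2 * x * (2 * (1 / (x * (16 * y)))) = 1/4 * (1 / y)" if "0 < x" "0 < y" for x y :: real
      using that by (simp add: field_simps)
    moreover have "0 < real q" "0 < (real q + 2) * (ln (real q + 2))\<^sup>2" unfolding q_def by auto
    moreover have "excluded_radius q = 1 / (real q * (16 * ((real q + 2) * (ln (real q + 2))\<^sup>2)))"
      unfolding excluded_radius_def by (simp only: mult.assoc mult.left_commute)
    ultimately show ?thesis by metis
  qed
  also have "\<dots> \<le> 1/4 * (1 / ln (real k + 2) - 1 / ln (real (Suc k) + 2))"
    using inverse_ln_telescope[of "real k + 2"] unfolding q_def by (simp add: add.commute)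
  finally show ?thesis unfolding q_def by (simp add: ennreal_leI)
qed

lemma slope_set_measurable: "slope_set \<in> sets lborel"
  unfolding slope_set_def excluded_balls_def by auto

lemma emeasure_slope_set: "ennreal (1/2) \<le> emeasure lborel slope_set"
proof -
  define U where "U = (\<Union>k. excluded_balls (Suc k))"
  have meas: "excluded_balls k \<in> sets lborel" for k unfolding excluded_balls_def by auto
  have "emeasure lborel U \<le> (\<Sum>k. emeasure lborel (excluded_balls (Suc k)))"
    unfolding U_def using meas by (intro emeasure_subadditive_countably) auto
  also have "\<dots> \<le> ennreal (1/2)"
  proof (rule suminf_le_const)
    fix n
    have "(\<Sum>k<n. emeasure lborel (excluded_balls (Suc k)))
        \<le> (\<Sum>k<n. ennreal (1/4 * (1 / ln (real k + 2) - 1 / ln (real (Suc k) + 2))))"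
      by (intro sum_mono emeasure_excluded_balls)
    also have "\<dots> = ennreal (\<Sum>k<n. 1/4 * (1 / ln (real k + 2) - 1 / ln (real (Suc k) + 2)))"
    proof (rule sum_ennreal)
      fix k
      have "1 / ln (real (Suc k) + 2) \<le> 1 / ln (real k + 2)"
        by (intro divide_left_mono) (auto intro!: mult_pos_pos)
      then show "0 \<le> 1/4 * (1 / ln (real k + 2) - 1 / ln (real (Suc k) + 2))" by simp
    qed
    also have "(\<Sum>k<n. 1/4 * (1 / ln (real k + 2) - 1 / ln (real (Suc k) + 2)))
        = 1/4 * (\<Sum>k<n. 1 / ln (real k + 2) - 1 / ln (real (Suc k) + 2))"
      by (simp only: sum_distrib_left)
    also have "(\<Sum>k<n. 1 / ln (real k + 2) - 1 / ln (real (Suc k) + 2)) = 1 / ln 2 - 1 / ln (real n + 2)"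
      by (subst sum_lessThan_telescope') simp
    also have "1/4 * (1 / ln 2 - 1 / ln (real n + 2)) \<le> 1/2"
    proof -
      have "1 / ln 2 \<le> (2 :: real)" using ln_ge_half[of 2] by (simp add: field_simps)
      moreover have "0 \<le> 1 / ln (real n + 2)" by simp
      moreover have "1/4 * (x - y) \<le> 1/2" if "x \<le> 2" "0 \<le> y" for x y :: real using that by simp
      ultimately show ?thesis by blast
    qed
    finally show "(\<Sum>k<n. emeasure lborel (excluded_balls (Suc k))) \<le> ennreal (1/2)"
      by (simp add: ennreal_leI)
  qed simp
  finally have U: "emeasure lborel U \<le> ennreal (1/2)" .
  have "ennreal 1 = emeasure lborel {0..1::real}" by simp
  also have "\<dots> \<le> emeasure lborel (slope_set \<union> U)"
    using meas slope_set_measurable unfolding U_def slope_set_def by (intro emeasure_mono) auto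
  also have "\<dots> \<le> emeasure lborel slope_set + emeasure lborel U"
    using meas slope_set_measurable unfolding U_def by (intro emeasure_subadditive) auto
  also have "\<dots> \<le> emeasure lborel slope_set + ennreal (1/2)" using U by (intro add_left_mono)
  finally have le: "ennreal 1 \<le> emeasure lborel slope_set + ennreal (1/2)" .
  show ?thesis
  proof (cases "emeasure lborel slope_set")
    case (real r)
    have "ennreal r + ennreal (1/2) = ennreal (r + 1/2)" using \<open>0 \<le> r\<close> by (intro ennreal_plus[symmetric]) auto
    then have "ennreal 1 \<le> ennreal (r + 1/2)" using le real by metis
    then have "1/2 \<le> r" using \<open>0 \<le> r\<close> by (subst (asm) ennreal_le_iff) auto
    then show ?thesis using real by (metis ennreal_leI)
  qed simp
qed

text \<open>Bounds the gaps modulo 1 between n consecutive multiples of a slope in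
  \<open>slope_set\<close>. The 50 is 48 + 2: 48 from 1/q and 2 from twice the error 1/n.\<close>

definition gap_bound :: "nat \<Rightarrow> real" where
  "gap_bound n = 50 * (ln (real n + 2))\<^sup>2 / real n"

text \<open>The Dirichlet theorem gives p/q with q <= n and error below 1/n, and the excluded balls
  prevent q from being much smaller than n. Over q consecutive indices the multiples of p/q meet
  every multiple of 1/q modulo 1, and those of the slope deviate by at most 1/n.\<close>

lemma slope_set_dense_orbit:
  fixes \<alpha> \<tau> :: real and n i0 :: nat
  assumes \<alpha>: "\<alpha> \<in> slope_set" and n: "1 \<le> n"
  obtains i :: nat and m :: int where "i0 \<le> i" "i < i0 + n"
    "\<tau> \<le> real i * \<alpha> - real_of_int m" "real i * \<alpha> - real_of_int m < \<tau> + gap_bound n"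
proof -
  have a01: "0 \<le> \<alpha>" "\<alpha> \<le> 1" using \<alpha> unfolding slope_set_def by auto
  obtain p k where pk: "coprime p k" "0 < k" "k \<le> int n" "\<bar>of_int k * \<alpha> - of_int p\<bar> < 1 / real n"
    using Dirichlet_approx_coprime[of n \<alpha>] n by (metis less_le_trans zero_less_one)
  define q where "q = nat k"
  have q: "coprime p (int q)" "0 < q" "q \<le> n" "\<bar>real q * \<alpha> - real_of_int p\<bar> < 1 / real n"
    using pk unfolding q_def by auto
  have n1: "1 / real n \<le> 1" using n by simp
  then have "\<bar>real q * \<alpha> - real_of_int p\<bar> < 1" using q(4) by linarith
  then have p: "0 \<le> p" "p \<le> int q" using numerator_bounds[OF a01] by auto
  define w where "w = (ln (real n + 2))\<^sup>2"
  have ln1: "1 \<le> ln (real n + 2)"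
  proof -
    have "exp 1 \<le> real n + 2" using e_less_272 n by linarith
    then show ?thesis using ln_ge_iff[of "real n + 2" 1] by simp
  qed
  then have w1: "1 \<le> w" unfolding w_def by (rule one_le_power)
  have dist_eq: "\<bar>\<alpha> - of_int p / real q\<bar> = \<bar>real q * \<alpha> - real_of_int p\<bar> / real q"
    using q(2) by (intro abs_diff_fraction) simp
  have "\<alpha> \<notin> excluded_balls q"
    using \<alpha> q(2) unfolding slope_set_def by (metis DiffD2 Suc_pred UN_I UNIV_I)
  moreover have "nat p \<in> {0..q}" using p by auto
  ultimately have "\<alpha> \<notin> ball (real (nat p) / real q) (excluded_radius q)"
    unfolding excluded_balls_def by blast
  then have "excluded_radius q \<le> \<bar>\<alpha> - of_int p / real q\<bar>"
    using p by (simp add: dist_real_def abs_minus_commute not_less)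
  then have "excluded_radius q * real q \<le> \<bar>real q * \<alpha> - real_of_int p\<bar>"
    unfolding dist_eq using q(2) by (simp add: field_simps)
  then have less: "excluded_radius q * real q < 1 / real n" using q(4) by linarith
  \<comment> \<open>The 48 is 16 * 3, as q + 2 <= 3 q.\<close>
  have inv_q: "1 / real q \<le> 48 * w / real n"
  proof -
    have "1 \<le> real q" using q(2) by simp
    have "1 / (48 * real q * w) \<le> 1 / (16 * (real q + 2) * (ln (real q + 2))\<^sup>2)"
    proof (intro divide_left_mono)
      have "(ln (real q + 2))\<^sup>2 \<le> w" unfolding w_def using q by (intro power_mono) auto
      then have "16 * (real q + 2) * (ln (real q + 2))\<^sup>2 \<le> (48 * real q) * w"
        using \<open>1 \<le> real q\<close> by - (rule mult_mono, auto)
      then show "16 * (real q + 2) * (ln (real q + 2))\<^sup>2 \<le> 48 * real q * w" .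
    qed (use q w1 in auto)
    also have "\<dots> = excluded_radius q * real q"
      unfolding excluded_radius_def using q(2) by simp
    finally have "1 / (48 * real q * w) < 1 / real n" using less by linarith
    then show ?thesis using q(2) n w1 by (simp add: field_simps)
  qed
  have "2 / real n + 1 / real q \<le> gap_bound n"
  proof -
    have "2 * 1 / real n \<le> 2 * w / real n" using w1 by (intro divide_right_mono mult_left_mono) auto
    then show ?thesis using inv_q unfolding gap_bound_def w_def by simp
  qed
  note width = this
  \<comment> \<open>Aiming 1/n above the target absorbs an error of either sign.\<close>
  define y where "y = real q * (\<tau> + 1 / real n - real i0 * \<alpha>)"
  define t where "t = \<lceil>y\<rceil>"
  have t: "y \<le> real_of_int t" "real_of_int t < y + 1" unfolding t_def by linarith+
  obtain u v where uv: "u * p + v * int q = 1"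
    using bezout_int[of p "int q"] q(1) coprime_imp_gcd_eq_1[OF q(1)] by auto
  \<comment> \<open>Since u inverts p modulo q, this j satisfies j p = t modulo q.\<close>
  define j where "j = nat ((t * u) mod int q)"
  have j: "int j = (t * u) mod int q"
    unfolding j_def using q(2) by (intro nat_0_le pos_mod_sign) simp
  have "int j < int q" unfolding j using q(2) by (intro pos_mod_bound) simp
  then have jq: "j < q" by simp
  define e where "e = (t * u) div int q"
  define m where "m = - (t * v + e * p)"
  have jm: "int j * p - m * int q = t"
  proof -
    have je: "int j = t * u - int q * e" unfolding j e_def by (simp add: minus_mult_div_eq_mod)
    have "int j * p - m * int q = t * (u * p + v * int q)"
      unfolding m_def je by (simp add: algebra_simps)
    then show ?thesis using uv by simp
  qed
  define err where "err = real j * (\<alpha> - of_int p / real q)"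
  have err: "\<bar>err\<bar> \<le> 1 / real n"
  proof -
    have "\<bar>err\<bar> = (real j / real q) * \<bar>real q * \<alpha> - real_of_int p\<bar>"
      unfolding err_def abs_mult dist_eq by simp
    also have "\<dots> \<le> 1 * (1 / real n)"
      using jq q by (intro mult_mono) auto
    finally show ?thesis by simp
  qed
  have "real (i0 + j) * \<alpha> - real_of_int m = real i0 * \<alpha> + of_int t / real q + err"
  proof -
    have "real_of_int t = real j * real_of_int p - real_of_int m * real q"
      unfolding jm[symmetric] by simp
    then have "of_int t / real q = real j * (of_int p / real q) - real_of_int m"
      using q(2) by (simp add: diff_divide_distrib)
    then show ?thesis unfolding err_def by (simp add: algebra_simps)
  qed
  moreover have "\<tau> + 1 / real n \<le> real i0 * \<alpha> + of_int t / real q"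
    "real i0 * \<alpha> + of_int t / real q < \<tau> + 1 / real n + 1 / real q"
  proof -
    have div: "Y \<le> r / x" "r / x < Y + 1 / x" if "x * Y \<le> r" "r < x * Y + 1" "0 < x" for r x Y :: real
      using that by (auto simp: field_simps)
    show "\<tau> + 1 / real n \<le> real i0 * \<alpha> + of_int t / real q"
      "real i0 * \<alpha> + of_int t / real q < \<tau> + 1 / real n + 1 / real q"
      using div[of "real q", OF t[unfolded y_def]] q(2) by auto
  qed
  ultimately have "\<tau> \<le> real (i0 + j) * \<alpha> - real_of_int m"
    "real (i0 + j) * \<alpha> - real_of_int m < \<tau> + gap_bound n"
    using err width by (auto simp: abs_le_iff)
  then show thesis using that[of "i0 + j" m] jq q(3) by simp
qed

text \<open>The index is chosen so that the first value lies within \<open>gap_bound n\<close> below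
  the next integer; with the same floor the second value stays below that integer too.\<close>

lemma same_code_upper:
  fixes \<alpha> \<alpha>' \<rho> \<rho>' :: real
  assumes "\<alpha> \<in> slope_set" "1 \<le> n"
    and code: "\<And>i. i \<le> 3 * n \<Longrightarrow> \<lfloor>real i * \<alpha> + \<rho>\<rfloor> = \<lfloor>real i * \<alpha>' + \<rho>'\<rfloor>"
    and "i0 + n \<le> 3 * n"
  obtains i where "i0 \<le> i" "i < i0 + n" "(real i * \<alpha>' + \<rho>') - (real i * \<alpha> + \<rho>) < gap_bound n"
proof -
  obtain i m where i: "i0 \<le> i" "i < i0 + n" "1 - gap_bound n - \<rho> \<le> real i * \<alpha> - real_of_int m"
    "real i * \<alpha> - real_of_int m < (1 - gap_bound n - \<rho>) + gap_bound n"
    using slope_set_dense_orbit[OF assms(1,2)] by metis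
  have "real i * \<alpha> + \<rho> < real_of_int m + 1" using i(4) by simp
  then have "\<lfloor>real i * \<alpha> + \<rho>\<rfloor> \<le> m" by linarith
  then have "\<lfloor>real i * \<alpha>' + \<rho>'\<rfloor> \<le> m" using code[of i] i assms(4) by simp
  then have "real i * \<alpha>' + \<rho>' < real_of_int m + 1" by linarith
  then show thesis using that[of i] i by simp
qed

text \<open>\<open>same_code_upper\<close> in the window [2 n, 3 n) and, with exchanged roles, in
  [0, n) bounds the slope difference multiplied by at least n. One index below n then bounds the
  offsets.\<close>

lemma same_code_close:
  fixes \<alpha> \<alpha>' \<rho> \<rho>' :: real
  assumes \<alpha>: "\<alpha> \<in> slope_set" "\<alpha>' \<in> slope_set" and n: "1 \<le> n"
    and code: "\<And>i. i \<le> 3 * n \<Longrightarrow> \<lfloor>real i * \<alpha> + \<rho>\<rfloor> = \<lfloor>real i * \<alpha>' + \<rho>'\<rfloor>"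
  shows "\<bar>\<alpha>' - \<alpha>\<bar> \<le> 2 * gap_bound n / real n" "\<bar>\<rho>' - \<rho>\<bar> \<le> 3 * gap_bound n"
proof -
  have D: "0 \<le> gap_bound n" unfolding gap_bound_def by simp
  have slope: "\<alpha>' - \<alpha> \<le> 2 * gap_bound n / real n"
    if \<alpha>: "\<alpha> \<in> slope_set" "\<alpha>' \<in> slope_set"
      and code: "\<And>i. i \<le> 3 * n \<Longrightarrow> \<lfloor>real i * \<alpha> + \<rho>\<rfloor> = \<lfloor>real i * \<alpha>' + \<rho>'\<rfloor>"
    for \<alpha> \<alpha>' \<rho> \<rho>' :: real
  proof -
    obtain i where i: "2 * n \<le> i" "(real i * \<alpha>' + \<rho>') - (real i * \<alpha> + \<rho>) < gap_bound n"
      using same_code_upper[OF \<alpha>(1) n code, of "2 * n"] by (metis le_refl mult_Suc numeral_3_eq_3 add.commute mult_2 numeral_2_eq_2)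
    obtain j where j: "j < n" "(real j * \<alpha> + \<rho>) - (real j * \<alpha>' + \<rho>') < gap_bound n"
      using same_code_upper[OF \<alpha>(2) n code[symmetric], of 0] by (metis add_0 le_add1 mult_Suc numeral_3_eq_3)
    have "(real i - real j) * (\<alpha>' - \<alpha>) \<le> 2 * gap_bound n" using i(2) j(2) by (simp add: algebra_simps)
    moreover have "real n \<le> real i - real j" using i(1) j(1) by simp
    ultimately have "real n * (\<alpha>' - \<alpha>) \<le> 2 * gap_bound n"
    proof (cases "0 \<le> \<alpha>' - \<alpha>")
      case True
      then have "real n * (\<alpha>' - \<alpha>) \<le> (real i - real j) * (\<alpha>' - \<alpha>)"
        using \<open>real n \<le> real i - real j\<close> by (rule mult_right_mono[rotated])
      then show ?thesis using \<open>(real i - real j) * (\<alpha>' - \<alpha>) \<le> 2 * gap_bound n\<close> by linarith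
    next
      case False
      then have "real n * (\<alpha>' - \<alpha>) \<le> 0" by (intro mult_nonneg_nonpos) auto
      then show ?thesis using D by linarith
    qed
    then show ?thesis using n by (simp add: field_simps)
  qed
  have offset: "\<rho>' - \<rho> \<le> 3 * gap_bound n"
    if \<alpha>: "\<alpha> \<in> slope_set" "\<alpha>' \<in> slope_set"
      and code: "\<And>i. i \<le> 3 * n \<Longrightarrow> \<lfloor>real i * \<alpha> + \<rho>\<rfloor> = \<lfloor>real i * \<alpha>' + \<rho>'\<rfloor>"
    for \<alpha> \<alpha>' \<rho> \<rho>' :: real
  proof -
    obtain j where j: "j < n" "(real j * \<alpha>' + \<rho>') - (real j * \<alpha> + \<rho>) < gap_bound n"
      using same_code_upper[OF \<alpha>(1) n code, of 0] by (metis add_0 le_add1 mult_Suc numeral_3_eq_3)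
    have "real j * (\<alpha> - \<alpha>') \<le> real j * (2 * gap_bound n / real n)"
      using slope[OF \<alpha>(2,1) code[symmetric]] by (intro mult_left_mono) auto
    also have "\<dots> \<le> real n * (2 * gap_bound n / real n)" using j(1) D by (intro mult_right_mono) auto
    also have "\<dots> = 2 * gap_bound n" using n by simp
    finally show ?thesis using j(2) by (simp add: algebra_simps)
  qed
  show "\<bar>\<alpha>' - \<alpha>\<bar> \<le> 2 * gap_bound n / real n"
    using slope[OF \<alpha> code] slope[OF \<alpha>(2,1) code[symmetric]] by (simp add: abs_le_iff)
  show "\<bar>\<rho>' - \<rho>\<bar> \<le> 3 * gap_bound n"
    using offset[OF \<alpha> code] offset[OF \<alpha>(2,1) code[symmetric]] by (simp add: abs_le_iff)
qed

section \<open>Sturmian points and area in the plane of parameters\<close>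

definition sturmian_height :: "real \<Rightarrow> real \<Rightarrow> int \<Rightarrow> int" where
  "sturmian_height \<alpha> \<rho> i = \<lfloor>real_of_int i * \<alpha> + \<rho>\<rfloor>"

definition sturmian_digits :: "real \<Rightarrow> real \<Rightarrow> int \<Rightarrow> nat" where
  "sturmian_digits \<alpha> \<rho> k =
     nat (2 - (sturmian_height \<alpha> \<rho> ((k - 1) div 2 + 1) - sturmian_height \<alpha> \<rho> ((k - 1) div 2)))"

definition sturmian_point :: "real \<times> real \<Rightarrow> real" where
  "sturmian_point = (\<lambda>(\<alpha>, \<rho>). cfval (right_tail (sturmian_digits \<alpha> \<rho>) 1))"

lemma sturmian_height_step:
  assumes "0 \<le> \<alpha>" "\<alpha> \<le> 1"
  shows "sturmian_height \<alpha> \<rho> (i + 1) - sturmian_height \<alpha> \<rho> i = 0 \<or>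
    sturmian_height \<alpha> \<rho> (i + 1) - sturmian_height \<alpha> \<rho> i = 1"
proof -
  define x where "x = real_of_int i * \<alpha> + \<rho>"
  have eq: "real_of_int (i + 1) * \<alpha> + \<rho> = x + \<alpha>" unfolding x_def by (simp add: algebra_simps)
  have "\<lfloor>x + \<alpha>\<rfloor> - \<lfloor>x\<rfloor> = 0 \<or> \<lfloor>x + \<alpha>\<rfloor> - \<lfloor>x\<rfloor> = 1" using assms by linarith
  then show ?thesis unfolding sturmian_height_def eq x_def[symmetric] .
qed

lemma balanced_sturmian_height: "balanced (sturmian_height \<alpha> \<rho>)"
  unfolding balanced_def
proof (intro allI)
  fix i j n
  have "real_of_int (k + int n) * \<alpha> + \<rho> = (real_of_int k * \<alpha> + \<rho>) + real n * \<alpha>" for k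
    by (simp add: algebra_simps)
  then show "sturmian_height \<alpha> \<rho> (i + int n) - sturmian_height \<alpha> \<rho> i
      \<le> sturmian_height \<alpha> \<rho> (j + int n) - sturmian_height \<alpha> \<rho> j + 1"
    unfolding sturmian_height_def by simp linarith
qed

lemma sturmian_point_in_K3:
  assumes "0 \<le> \<alpha>" "\<alpha> \<le> 1"
  shows "sturmian_point (\<alpha>, \<rho>) \<in> K3"
proof -
  have "markov12 (sturmian_digits \<alpha> \<rho>)"
    by (rule balanced_imp_markov12[of "sturmian_height \<alpha> \<rho>"])
      (use sturmian_height_step[OF assms] balanced_sturmian_height in \<open>auto simp: sturmian_digits_def\<close>)
  then show ?thesis unfolding K3_iff sturmian_point_def by auto
qed

text \<open>Contrapositive of \<open>cfval12_separated\<close>; two digits per letter give 1/81 =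
  (1/9)^2. Offsets in [0, 1) make both heights 0 at index 0, and equal steps then keep them
  equal.\<close>

lemma sturmian_point_separated:
  assumes "0 \<le> \<alpha>" "\<alpha> \<le> 1" "0 \<le> \<alpha>'" "\<alpha>' \<le> 1" "0 \<le> \<rho>" "\<rho> < 1" "0 \<le> \<rho>'" "\<rho>' < 1"
    and close: "\<bar>sturmian_point (\<alpha>, \<rho>) - sturmian_point (\<alpha>', \<rho>')\<bar> < (1/14) * (1/81) ^ m"
    and "i \<le> m"
  shows "\<lfloor>real i * \<alpha> + \<rho>\<rfloor> = \<lfloor>real i * \<alpha>' + \<rho>'\<rfloor>"
proof -
  let ?h = "sturmian_height \<alpha> \<rho>" and ?h' = "sturmian_height \<alpha>' \<rho>'"
  let ?x = "word_digits 0 ?h" and ?y = "word_digits 0 ?h'"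
  note st = sturmian_height_step[OF assms(1,2), of \<rho>] and st' = sturmian_height_step[OF assms(3,4), of \<rho>']
  have tail: "right_tail (sturmian_digits a r) 1 = word_digits 0 (sturmian_height a r)" for a r
    unfolding right_tail_def sturmian_digits_def word_digits_def by (simp add: zdiv_int)
  note dig = digits12_word_digits[of ?h 0, OF st] digits12_word_digits[of ?h' 0, OF st']
  have agree: "?x k = ?y k" if "k \<le> 2 * m" for k
  proof (rule ccontr)
    assume "?x k \<noteq> ?y k"
    define n where "n = (LEAST k. ?x k \<noteq> ?y k)"
    have n: "?x n \<noteq> ?y n" unfolding n_def using \<open>?x k \<noteq> ?y k\<close> by (rule LeastI)
    have "n \<le> k" unfolding n_def using \<open>?x k \<noteq> ?y k\<close> by (rule Least_le)
    have "?x i = ?y i" if "i < n" for i using not_less_Least that unfolding n_def by blast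
    then have "(1/14) * (1/9) ^ n \<le> \<bar>cfval ?x - cfval ?y\<bar>" using cfval12_separated[OF dig _ n] by blast
    moreover have "(1/9 :: real) ^ (2 * m) \<le> (1/9) ^ n"
      using \<open>n \<le> k\<close> that by (intro power_decreasing) auto
    then have "(1/81 :: real) ^ m \<le> (1/9) ^ n" by (simp add: power_mult power2_eq_square)
    ultimately show False using close unfolding sturmian_point_def tail by simp
  qed
  have "?h (int i) = ?h' (int i)" using \<open>i \<le> m\<close>
  proof (induction i)
    case 0
    have "\<lfloor>\<rho>\<rfloor> = 0" "\<lfloor>\<rho>'\<rfloor> = 0" using assms by (auto simp: floor_eq_iff)
    then show ?case unfolding sturmian_height_def by simp
  next
    case (Suc i)
    have "?x (2 * i) = ?y (2 * i)" using agree Suc.prems by simp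
    then have "?h (int i + 1) - ?h (int i) = ?h' (int i + 1) - ?h' (int i)"
      unfolding word_digits_def using st[of "int i"] st'[of "int i"] by auto
    then show ?case using Suc by (simp add: add.commute)
  qed
  then show ?thesis unfolding sturmian_height_def by simp
qed

abbreviation plane :: "(real \<times> real) measure" where
  "plane \<equiv> lborel \<Otimes>\<^sub>M lborel"

definition parameter_set :: "(real \<times> real) set" where
  "parameter_set = slope_set \<times> {0..<1}"

lemma emeasure_parameter_set:
  "parameter_set \<in> sets plane"
  "ennreal (1/2) \<le> emeasure plane parameter_set"
proof -
  show "parameter_set \<in> sets plane"
    unfolding parameter_set_def using slope_set_measurable by (intro pair_measureI) auto
  have "emeasure plane parameter_set = emeasure lborel slope_set * emeasure lborel {0..<1::real}"
    unfolding parameter_set_def using slope_set_measurable by (intro lborel.emeasure_pair_measure_Times) auto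
  then show "ennreal (1/2) \<le> emeasure plane parameter_set"
    using emeasure_slope_set by simp
qed

lemma parameter_setD:
  assumes "(\<alpha>, \<rho>) \<in> parameter_set"
  shows "\<alpha> \<in> slope_set" "0 \<le> \<alpha>" "\<alpha> \<le> 1" "0 \<le> \<rho>" "\<rho> < 1"
  using assms unfolding parameter_set_def slope_set_def by auto

lemma parameters_close:
  assumes "z \<in> parameter_set" "z' \<in> parameter_set" "1 \<le> n"
    and "\<bar>sturmian_point z - sturmian_point z'\<bar> < (1/14) * (1/81) ^ (3 * n)"
  shows "\<bar>fst z' - fst z\<bar> \<le> 2 * gap_bound n / real n" "\<bar>snd z' - snd z\<bar> \<le> 3 * gap_bound n"
proof -
  obtain \<alpha> \<rho> \<alpha>' \<rho>' where z: "z = (\<alpha>, \<rho>)" "z' = (\<alpha>', \<rho>')" by (metis surj_pair)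
  note p = parameter_setD[OF assms(1)[unfolded z]] and p' = parameter_setD[OF assms(2)[unfolded z]]
  have "\<lfloor>real i * \<alpha> + \<rho>\<rfloor> = \<lfloor>real i * \<alpha>' + \<rho>'\<rfloor>" if "i \<le> 3 * n" for i
    using sturmian_point_separated[OF p(2,3) p'(2,3) p(4,5) p'(4,5) assms(4)[unfolded z] that] .
  then show "\<bar>fst z' - fst z\<bar> \<le> 2 * gap_bound n / real n" "\<bar>snd z' - snd z\<bar> \<le> 3 * gap_bound n"
    using same_code_close[OF p(1) p'(1) assms(3)] unfolding z by auto
qed

lemma box_measure:
  fixes z :: "real \<times> real"
  assumes "0 \<le> a" "0 \<le> b"
  defines "Q \<equiv> {fst z - a..fst z + a} \<times> {snd z - b..snd z + b}"
  shows "Q \<in> sets plane" "emeasure plane Q = ennreal (4 * a * b)"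
proof -
  show "Q \<in> sets plane" unfolding Q_def by (intro pair_measureI) auto
  have "emeasure plane Q
      = emeasure lborel {fst z - a..fst z + a} * emeasure lborel {snd z - b..snd z + b}"
    unfolding Q_def by (intro lborel.emeasure_pair_measure_Times) auto
  also have "\<dots> = ennreal (2 * a) * ennreal (2 * b)" using assms by simp
  also have "\<dots> = ennreal (4 * a * b)" using assms by (simp add: ennreal_mult[symmetric])
  finally show "emeasure plane Q = ennreal (4 * a * b)" .
qed

text \<open>One parameter of the preimage is fixed, and all others lie in a box around it. Its area
  is 4 (2 G/n) (3 G) with G = \<open>gap_bound n\<close>, which is n^(-3) up to a constant times
  log^4.\<close>

lemma preimage_in_box:
  assumes U: "bounded U" "diameter U < (1/14) * (1/81) ^ (3 * n)" and n: "1 \<le> n"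
  obtains Q where "Q \<in> sets plane"
    "{z \<in> parameter_set. sturmian_point z \<in> U} \<subseteq> Q"
    "emeasure plane Q \<le> ennreal (24 * (gap_bound n)\<^sup>2 / real n)"
proof (cases "{z \<in> parameter_set. sturmian_point z \<in> U} = {}")
  case True
  then show thesis using that[of "{}"] by simp
next
  case False
  then obtain z where z: "z \<in> parameter_set" "sturmian_point z \<in> U" by blast
  define a b where "a = 2 * gap_bound n / real n" and "b = 3 * gap_bound n"
  have ab: "0 \<le> a" "0 \<le> b" unfolding a_def b_def gap_bound_def by auto
  define Q where "Q = {fst z - a..fst z + a} \<times> {snd z - b..snd z + b}"
  have "z' \<in> Q" if z': "z' \<in> parameter_set" "sturmian_point z' \<in> U" for z'
  proof -
    have "\<bar>sturmian_point z - sturmian_point z'\<bar> \<le> diameter U"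
      using diameter_bounded_bound[OF U(1) z(2) z'(2)] by (simp add: dist_real_def)
    then have "\<bar>sturmian_point z - sturmian_point z'\<bar> < (1/14) * (1/81) ^ (3 * n)" using U(2) by linarith
    from parameters_close[OF z(1) z'(1) n this] show ?thesis
      unfolding Q_def a_def[symmetric] b_def[symmetric] by (cases z') (auto simp: abs_le_iff)
  qed
  then have "{z \<in> parameter_set. sturmian_point z \<in> U} \<subseteq> Q" by blast
  moreover have "4 * a * b = 24 * (gap_bound n)\<^sup>2 / real n"
    unfolding a_def b_def by (simp add: power2_eq_square)
  ultimately show thesis using that[of Q] box_measure[OF ab, of z] unfolding Q_def[symmetric] by simp
qed

text \<open>A mass distribution argument with planar area as the mass: each set of a cover has its
  preimage in a box of area at most g(diameter)/R, and the boxes together cover area at least 1/2.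
  Hence every fine cover costs at least R/2, for arbitrary R.\<close>

lemma K3_measure_infinite:
  assumes "C > 0"
    and "dimension_function_given_by g (\<lambda>\<epsilon>. exp (C * sqrt (ln \<bar>ln \<epsilon>\<bar>)) / \<bar>ln \<epsilon>\<bar> ^ 3)"
  shows "hausdorff_measure g K3 = \<infinity>"
proof -
  have g: "dimension_function g" using assms(2) unfolding dimension_function_given_by_def by simp
  then have g0: "g 0 = 0" and gpos: "\<And>r. r > 0 \<Longrightarrow> g r > 0" unfolding dimension_function_def by auto
  obtain b where b: "b > 0" "\<And>\<epsilon>. 0 < \<epsilon> \<Longrightarrow> \<epsilon> < b \<Longrightarrow>
      g \<epsilon> = exp (C * sqrt (ln \<bar>ln \<epsilon>\<bar>)) / \<bar>ln \<epsilon>\<bar> ^ 3"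
    using assms(2) unfolding dimension_function_given_by_def eventually_at_right_field by auto
  have lower: "ennreal (R / 2) \<le> hausdorff_measure g K3" if R: "0 < R" for R
  proof -
    \<comment> \<open>The factor 24 * 2500 comes from 24 \<open>gap_bound n\<close>^2, and 64000 =
      40^3 from l <= 40 n below.\<close>
    have "filterlim (\<lambda>n. exp (C * sqrt (ln (real n))) / (ln (real n + 2)) ^ 4) at_top sequentially"
      using \<open>C > 0\<close> by real_asymp
    then have "\<forall>\<^sub>F n in sequentially. R * (24 * 2500 * 64000) \<le> exp (C * sqrt (ln (real n))) / (ln (real n + 2)) ^ 4"
      by (simp add: filterlim_at_top)
    then obtain n0 where n0: "\<And>n. n0 \<le> n \<Longrightarrow>
        R * (24 * 2500 * 64000) \<le> exp (C * sqrt (ln (real n))) / (ln (real n + 2)) ^ 4"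
      by (auto simp: eventually_sequentially)
    define \<delta> where "\<delta> = min b (exp (- 20 * real (max 1 n0)))"
    have \<delta>: "0 < \<delta>" "\<delta> \<le> b" "\<delta> \<le> exp (- 20 * real (max 1 n0))" unfolding \<delta>_def using b by auto
    have box: "\<exists>Q\<in>sets plane. {z \<in> parameter_set. sturmian_point z \<in> U} \<subseteq> Q \<and>
        emeasure plane Q \<le> ennreal (g (diameter U) / R)" if U: "bounded U" "diameter U < \<delta>" for U
    \<comment> \<open>Such a set costs nothing, so its preimage has to be null; closeness of the
      parameters for every n makes it at most one point.\<close>
    proof (cases "diameter U = 0")
      case True
      show ?thesis
      proof (cases "{z \<in> parameter_set. sturmian_point z \<in> U} = {}")
        case True
        then show ?thesis by (intro bexI[of _ "{}"]) auto
      next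
        case False
        then obtain z where z: "z \<in> parameter_set" "sturmian_point z \<in> U" by blast
        have lim: "(\<lambda>n. 2 * gap_bound n / real n) \<longlonglongrightarrow> 0" "(\<lambda>n. 3 * gap_bound n) \<longlonglongrightarrow> 0"
          unfolding gap_bound_def by real_asymp+
        have "z' = z" if z': "z' \<in> parameter_set" "sturmian_point z' \<in> U" for z'
        proof -
          have "\<bar>sturmian_point z - sturmian_point z'\<bar> \<le> 0"
            using diameter_bounded_bound[OF U(1) z(2) z'(2)] True by (simp add: dist_real_def)
          then have "\<bar>sturmian_point z - sturmian_point z'\<bar> < (1/14) * (1/81) ^ (3 * n)" for n
            by (smt (verit) mult_pos_pos zero_less_divide_1_iff zero_less_numeral zero_less_power)
          then have le: "\<forall>n\<ge>1. \<bar>fst z' - fst z\<bar> \<le> 2 * gap_bound n / real n"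
            "\<forall>n\<ge>1. \<bar>snd z' - snd z\<bar> \<le> 3 * gap_bound n"
            using parameters_close[OF z(1) z'(1)] by blast+
          have "\<bar>fst z' - fst z\<bar> \<le> 0" by (rule LIMSEQ_le_const[OF lim(1)]) (use le in blast)
          moreover have "\<bar>snd z' - snd z\<bar> \<le> 0" by (rule LIMSEQ_le_const[OF lim(2)]) (use le in blast)
          ultimately show ?thesis by (simp add: prod_eq_iff)
        qed
        then have "{z \<in> parameter_set. sturmian_point z \<in> U} \<subseteq> {fst z - 0..fst z + 0} \<times> {snd z - 0..snd z + 0}"
          by auto
        then show ?thesis using box_measure[of 0 0 z] by (intro bexI) auto
      qed
    next
      case False
      define \<epsilon> where "\<epsilon> = diameter U"
      have \<epsilon>: "0 < \<epsilon>" "\<epsilon> < \<delta>" using False U diameter_ge_0[OF U(1)] unfolding \<epsilon>_def by auto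
      define l where "l = - ln \<epsilon>"
      have "ln \<epsilon> < ln (exp (- 20 * real (max 1 n0)))" using \<epsilon> \<delta>(3) by (intro ln_less_cancel_iff[THEN iffD2]) auto
      then have l20: "20 * real (max 1 n0) < l" unfolding l_def by simp
      \<comment> \<open>The 20 is chosen because e^20 exceeds 14 * 81^3 = 7440174, so that diameters
        up to exp(-20 n) resolve words of length 3 n.\<close>
      define n where "n = nat \<lfloor>l / 20\<rfloor>"
      have "max 1 n0 \<le> n" unfolding n_def using l20 by (intro le_nat_floor) simp
      then have n: "1 \<le> n" "n0 \<le> n" by auto
      have "real n = real_of_int \<lfloor>l / 20\<rfloor>" unfolding n_def using l20 by simp
      then have nl: "20 * real n \<le> l" "l < 20 * real n + 20" by linarith+
      have "14 * (81 :: real) ^ (3 * n) < exp (20 * real n)"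
      proof -
        have "(5/2 :: real) \<le> exp 1" using exp_lower_Taylor_quadratic[of 1] by simp
        then have "(5/2 :: real) ^ 20 \<le> exp 1 ^ 20" by (intro power_mono) auto
        then have e20: "7440174 < exp (20 :: real)" by (simp add: exp_of_nat_mult[symmetric] power_divide)
        have "14 * (81 :: real) ^ (3 * n) = 14 * 531441 ^ n" by (simp add: power_mult)
        also have "\<dots> \<le> 14 ^ n * 531441 ^ n" using n(1) by (intro mult_right_mono self_le_power) auto
        also have "\<dots> = 7440174 ^ n" by (simp add: power_mult_distrib[symmetric])
        also have "\<dots> < exp 20 ^ n" using e20 n(1) by (intro power_strict_mono) auto
        also have "\<dots> = exp (20 * real n)" by (simp add: exp_of_nat_mult[symmetric] mult.commute)
        finally show ?thesis .
      qed
      then have "exp (- (20 * real n)) < (1/14) * (1/81) ^ (3 * n)"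
        by (simp add: exp_minus field_simps)
      moreover have "\<epsilon> = exp (- l)" unfolding l_def using \<epsilon>(1) by simp
      moreover have "exp (- l) \<le> exp (- (20 * real n))" using nl(1) by simp
      ultimately have "diameter U < (1/14) * (1/81) ^ (3 * n)" unfolding \<epsilon>_def by linarith
      then obtain Q where Q: "Q \<in> sets plane" "{z \<in> parameter_set. sturmian_point z \<in> U} \<subseteq> Q"
        "emeasure plane Q \<le> ennreal (24 * (gap_bound n)\<^sup>2 / real n)"
        by (rule preimage_in_box[OF U(1) _ n(1)]) (rule that; assumption)
      have "24 * (gap_bound n)\<^sup>2 / real n \<le> g \<epsilon> / R"
      proof -
        define w where "w = ln (real n + 2)"
        have "0 < w" unfolding w_def using n by simp
        have lpos: "0 < l" "real n \<le> l" "l \<le> 40 * real n" using nl n(1) by auto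
        have abs: "\<bar>ln \<epsilon>\<bar> = l" using lpos unfolding l_def by simp
        have "exp (C * sqrt (ln (real n))) / (40 * real n) ^ 3 \<le> exp (C * sqrt (ln l)) / l ^ 3"
          using lpos n(1) \<open>C > 0\<close> by (intro frac_le power_mono) auto
        also have "\<dots> = g \<epsilon>" using b(2)[of \<epsilon>] \<epsilon> \<delta>(2) abs by simp
        finally have g_ge: "exp (C * sqrt (ln (real n))) / (40 * real n) ^ 3 \<le> g \<epsilon>" .
        have "R * (24 * 2500 * 64000) \<le> exp (C * sqrt (ln (real n))) / w ^ 4"
          using n0[OF n(2)] unfolding w_def .
        then have "R * (24 * 2500 * 64000) * w ^ 4 \<le> exp (C * sqrt (ln (real n)))"
          using \<open>0 < w\<close> by (simp add: field_simps)
        then have "(R * (24 * 2500 * 64000) * w ^ 4) / (40 * real n) ^ 3 \<le> g \<epsilon>"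
          using g_ge by (meson divide_right_mono order_trans zero_le_power of_nat_0_le_iff mult_nonneg_nonneg zero_le_numeral)
        moreover have "(R * (24 * 2500 * 64000) * w ^ 4) / (40 * real n) ^ 3 = R * (24 * (gap_bound n)\<^sup>2 / real n)"
          unfolding gap_bound_def w_def[symmetric] using n(1)
          by (simp add: field_simps power2_eq_square power3_eq_cube power4_eq_xxxx)
        ultimately show ?thesis using R by (simp add: field_simps)
      qed
      then have "emeasure plane Q \<le> ennreal (g (diameter U) / R)"
        using Q(3) unfolding \<epsilon>_def by (meson ennreal_leI order_trans)
      then show ?thesis using Q by blast
    qed
    have pre: "ennreal (R / 2) \<le> hausdorff_premeasure g \<delta> K3"
      unfolding hausdorff_premeasure_def
    proof (rule Inf_greatest, clarify)
      fix U :: "nat \<Rightarrow> real set"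
      assume cover: "K3 \<subseteq> (\<Union>i. U i)" and U: "\<forall>i. bounded (U i) \<and> diameter (U i) < \<delta>"
      have "\<forall>i. \<exists>Q. Q \<in> sets plane \<and> {z \<in> parameter_set. sturmian_point z \<in> U i} \<subseteq> Q \<and>
          emeasure plane Q \<le> ennreal (g (diameter (U i)) / R)" using box U by blast
      from choice[OF this] obtain Q where "\<forall>i. Q i \<in> sets plane \<and>
          {z \<in> parameter_set. sturmian_point z \<in> U i} \<subseteq> Q i \<and>
          emeasure plane (Q i) \<le> ennreal (g (diameter (U i)) / R)" by blast
      then have Q: "\<And>i. Q i \<in> sets plane" "\<And>i. {z \<in> parameter_set. sturmian_point z \<in> U i} \<subseteq> Q i"
        "\<And>i. emeasure plane (Q i) \<le> ennreal (g (diameter (U i)) / R)" by auto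
      have "parameter_set \<subseteq> (\<Union>i. Q i)"
      proof
        fix z assume z: "z \<in> parameter_set"
        obtain \<alpha> \<rho> where "z = (\<alpha>, \<rho>)" by (metis surj_pair)
        then have "sturmian_point z \<in> K3" using sturmian_point_in_K3 parameter_setD z by metis
        then obtain i where "sturmian_point z \<in> U i" using cover by blast
        then show "z \<in> (\<Union>i. Q i)" using Q(2)[of i] z by blast
      qed
      moreover have "(\<Union>i. Q i) \<in> sets plane" using Q(1) by (intro sets.countable_UN) auto
      ultimately have "emeasure plane parameter_set \<le> emeasure plane (\<Union>i. Q i)" by (rule emeasure_mono)
      then have "ennreal (1/2) \<le> emeasure plane (\<Union>i. Q i)"
        by (rule order_trans[OF emeasure_parameter_set(2)])
      also have "\<dots> \<le> (\<Sum>i. emeasure plane (Q i))"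
        using Q(1) by (intro emeasure_subadditive_countably) auto
      also have "\<dots> \<le> (\<Sum>i. ennreal (g (diameter (U i)) / R))"
        using Q(3) by (intro suminf_le) auto
      finally have "ennreal R * ennreal (1/2) \<le> ennreal R * (\<Sum>i. ennreal (g (diameter (U i)) / R))"
        by (rule mult_left_mono) simp
      also have "\<dots> = (\<Sum>i. ennreal R * ennreal (g (diameter (U i)) / R))" by simp
      also have "\<dots> = (\<Sum>i. ennreal (g (diameter (U i))))"
      proof (intro suminf_cong)
        fix i
        have "0 \<le> g (diameter (U i))"
          using g0 gpos[of "diameter (U i)"] diameter_ge_0 U by (metis less_eq_real_def)
        then show "ennreal R * ennreal (g (diameter (U i)) / R) = ennreal (g (diameter (U i)))"
          using R by (simp add: ennreal_mult[symmetric])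
      qed
      finally have "ennreal R * ennreal (1/2) \<le> (\<Sum>i. ennreal (g (diameter (U i))))" .
      moreover have "ennreal (R * (1/2)) = ennreal R * ennreal (1/2)" using R by (intro ennreal_mult) auto
      ultimately show "ennreal (R / 2) \<le> (\<Sum>i. ennreal (g (diameter (U i))))" by (metis times_divide_eq_right mult.right_neutral)
    qed
    show ?thesis
    proof (rule tendsto_lowerbound[OF hausdorff_premeasure_tendsto])
      have "ennreal (R / 2) \<le> hausdorff_premeasure g \<delta>' K3" if "\<delta>' < \<delta>" for \<delta>'
        using hausdorff_premeasure_antimono[of \<delta>' \<delta> g K3] pre that by (meson less_imp_le order_trans)
      then show "\<forall>\<^sub>F \<delta>' in at_right 0. ennreal (R / 2) \<le> hausdorff_premeasure g \<delta>' K3"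
        unfolding eventually_at_right_field using \<delta>(1) by blast
    qed simp
  qed
  show ?thesis
  proof (cases "hausdorff_measure g K3")
    case (real r)
    \<comment> \<open>With R = 2 r + 2 a finite value r would satisfy r + 1 <= r.\<close>
    have "ennreal ((2 * r + 2) / 2) \<le> ennreal r" using lower[of "2 * r + 2"] real by simp
    then have "(2 * r + 2) / 2 \<le> r" using real by (simp add: ennreal_le_iff)
    then show ?thesis by simp
  qed simp
qed

theorem theorem1p5:
  "(\<forall>g. dimension_function_given_by g
            (\<lambda>\<epsilon>. ln \<bar>ln \<epsilon>\<bar> / (\<bar>ln \<epsilon>\<bar> ^ 3 * ln (ln \<bar>ln \<epsilon>\<bar>))) \<longrightarrow>
          hausdorff_measure g K3 < \<infinity>) \<and>
   (\<exists>C\<^sub>0>0. \<forall>C\<ge>C\<^sub>0. \<forall>g. dimension_function_given_by g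
            (\<lambda>\<epsilon>. exp (C * sqrt (ln \<bar>ln \<epsilon>\<bar>)) / \<bar>ln \<epsilon>\<bar> ^ 3) \<longrightarrow>
          hausdorff_measure g K3 = \<infinity>)"
\<comment> \<open>\<open>K3_measure_infinite\<close> covers every positive C, so 1 can serve as the
  threshold.\<close>
proof (intro conjI allI impI exI[of _ "1::real"] K3_measure_finite)
  fix C :: real and g
  assume "1 \<le> C" "dimension_function_given_by g
      (\<lambda>\<epsilon>. exp (C * sqrt (ln \<bar>ln \<epsilon>\<bar>)) / \<bar>ln \<epsilon>\<bar> ^ 3)"
  then show "hausdorff_measure g K3 = \<infinity>" by (intro K3_measure_infinite[of C]) auto
qed simp_all

end
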